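(* Let $V\in C^\infty(\mathbb T^2;\mathbb R^2)$ be divergence free with mean zero and let $p\in\mathbb R^2$. For $A>0$ let $\kappa_A$ be the unique number such that $$-\Delta S+|p+DS|^2+AV(x)\cdot(p+DS)=\kappa_A$$ has a $\mathbb Z^2$-periodic solution $S$, and let $c_p=\inf_{\phi\in C^1(\mathbb T^2)}\max_{\mathbb T^2}\{V(x)\cdot(p+D\phi)\}$. Then $$\lim_{A\to+\infty}\frac{\kappa_A}{A}=c_p.$$
   Context: $\mathbb T^2=\mathbb R^2/\mathbb Z^2$; functions on it are $\mathbb Z^2$-periodic functions on $\mathbb R^2$. $\kappa_A$ is also given by $\kappa_A=\inf_{\phi\in C^2(\mathbb T^2)}\max_{\mathbb T^2}\{-\Delta\phi+|p+D\phi|^2+AV\cdot(p+D\phi)\}$. *)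

theory Defs
  imports "HOL-Analysis.Analysis"
begin

definition torus_periodic :: "(real^'n \<Rightarrow> 'b) \<Rightarrow> bool" where
  "torus_periodic f \<longleftrightarrow> (\<forall>x k. (\<forall>i. k $ i \<in> \<int>) \<longrightarrow> f (x + k) = f x)"

definition partial_deriv :: "'n::finite \<Rightarrow> (real^'n \<Rightarrow> real) \<Rightarrow> real^'n \<Rightarrow> real" where
  "partial_deriv i f x = frechet_derivative f (at x) (axis i 1)"

definition grad :: "(real^'n::finite \<Rightarrow> real) \<Rightarrow> real^'n \<Rightarrow> real^'n" where
  "grad f x = (\<chi> i. partial_deriv i f x)"

definition laplacian :: "(real^'n::finite \<Rightarrow> real) \<Rightarrow> real^'n \<Rightarrow> real" where
  "laplacian f x = (\<Sum>i\<in>UNIV. partial_deriv i (partial_deriv i f) x)"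

definition divergence :: "(real^'n::finite \<Rightarrow> real^'n) \<Rightarrow> real^'n \<Rightarrow> real" where
  "divergence V x = (\<Sum>i\<in>UNIV. partial_deriv i (\<lambda>y. V y $ i) x)"

primrec C_k :: "nat \<Rightarrow> (real^'n::finite \<Rightarrow> real) \<Rightarrow> bool" where
  "C_k 0 f \<longleftrightarrow> continuous_on UNIV f"
| "C_k (Suc k) f \<longleftrightarrow> (\<forall>x. f differentiable (at x)) \<and> (\<forall>i. C_k k (partial_deriv i f))"

definition C_infinity :: "(real^'n::finite \<Rightarrow> real^'n) \<Rightarrow> bool" where
  "C_infinity V \<longleftrightarrow> (\<forall>k i. C_k k (\<lambda>x. V x $ i))"

definition C_k_torus :: "nat \<Rightarrow> (real^2 \<Rightarrow> real) set" where
  "C_k_torus k = {\<phi>. torus_periodic \<phi> \<and> C_k k \<phi>}"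

text \<open>Solutions are classical, i.e. twice continuously differentiable.\<close>

definition cell_solution ::
    "(real^2 \<Rightarrow> real^2) \<Rightarrow> real^2 \<Rightarrow> real \<Rightarrow> real \<Rightarrow> (real^2 \<Rightarrow> real) \<Rightarrow> bool" where
  "cell_solution V p A \<kappa> S \<longleftrightarrow> S \<in> C_k_torus 2 \<and>
     (\<forall>x. - laplacian S x + (norm (p + grad S x))\<^sup>2 + A * (V x \<bullet> (p + grad S x)) = \<kappa>)"

definition is_cell_constant :: "(real^2 \<Rightarrow> real^2) \<Rightarrow> real^2 \<Rightarrow> real \<Rightarrow> real \<Rightarrow> bool" where
  "is_cell_constant V p A \<kappa> \<longleftrightarrow>
     (\<exists>S. cell_solution V p A \<kappa> S) \<and> (\<forall>\<kappa>'. (\<exists>S. cell_solution V p A \<kappa>' S) \<longrightarrow> \<kappa>' = \<kappa>)"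

text \<open>For continuous \<open>V\<close> of period one, the supremum below is taken of a continuous periodic
  function, so it is finite and attained: it is the maximum over the torus.\<close>

definition inviscid_constant :: "(real^2 \<Rightarrow> real^2) \<Rightarrow> real^2 \<Rightarrow> real" where
  "inviscid_constant V p = (INF \<phi>\<in>C_k_torus 1. SUP x. V x \<bullet> (p + grad \<phi> x))"

end

theory Submission
  imports Defs
begin

text \<open>
  Upper bound: at a minimum of \<open>S - \<phi>\<close> the maximum principle gives
  \<open>\<kappa>\<^sub>A \<le> max (- \<Delta>\<phi> + |p + D\<phi>|\<^sup>2 + A V \<bullet> (p + D\<phi>))\<close> for \<open>\<phi>\<close> of class \<open>C\<^sup>2\<close>; divide by \<open>A\<close>, and
  approximate \<open>C\<^sup>1\<close> functions by \<open>C\<^sup>2\<close> ones.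

  Lower bound: if \<open>w\<close> is \<open>C\<^sup>1\<close> and invariant, \<open>V \<bullet> Dw = 0\<close>, then multiplying the equation by \<open>w\<^sup>2\<close> and
  integrating by parts gives \<open>\<kappa>\<^sub>A \<integral>w\<^sup>2 \<ge> A \<integral>w\<^sup>2 V \<bullet> p - \<integral>|Dw|\<^sup>2\<close>. So it suffices to find an invariant
  \<open>w\<close> whose support carries drift at least \<open>c\<^sub>p - \<epsilon>\<close>. Let \<open>X\<close> be the flow of \<open>V\<close>. A mollification of
  \<open>x \<mapsto> (1/T) \<integral>\<^sub>0\<^sup>T p \<bullet> X\<^sub>s x ds - p \<bullet> x\<close> is a \<open>C\<^sup>1\<close> corrector \<open>\<phi>\<close> with
  \<open>V \<bullet> (p + D\<phi>) \<approx> p \<bullet> (X\<^sub>T x - x) / T\<close>; hence for \<open>b < c\<^sub>p\<close> there are orbits of drift at least \<open>b\<close>, and by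
  compactness one orbit with drift at least \<open>b\<close> at all times. If \<open>b > 0\<close>, this orbit returns infinitely
  often, modulo \<open>\<int>\<^sup>2\<close>, to a small box in which \<open>V \<bullet> p\<close> is positive; there the level sets of the stream
  function \<open>H\<close> are single orbit segments, so the orbit closes up modulo \<open>\<int>\<^sup>2\<close>, and so do all neighbouring
  ones, with nearly the same period. A bump function of \<open>H\<close> restricted to this annulus of closed orbits
  is the required \<open>w\<close>.
\<close>

section \<open>Calculus on the torus\<close>

text \<open>The flow is never differentiated. Only its Lipschitz dependence on the initial point is
  used, so time averages along orbits are merely Lipschitz and have to be mollified before they can
  serve as correctors. It is also built for \<open>t \<ge> 0\<close> only; arguments that would run
  backwards use injectivity of \<open>X t\<close> or go once more round a closed orbit. A weight
  that depends on \<open>H\<close> alone would not do: a level set of \<open>H\<close> may have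
  further components with a different drift. The bump is therefore restricted to a union of closed
  orbits, and the main labour is to show that this union is open and closed relative to a thin strip
  of levels. Correctors also enter the lower bound. On the support of \<open>w\<close> the drift is
  large only after averaging over a time \<open>T\<close>, but
  \<open>w\<^sup>2 (V \<bullet> D\<phi>)\<close> integrates to zero, so replacing \<open>p\<close>
  by \<open>p + D\<phi>\<close> turns the time average into a pointwise bound at no cost. For
  \<open>b \<le> 0\<close> no recurrence is available; there the weight 1 and the zero mean of
  \<open>V\<close> give a nonnegative cell constant, which is enough.\<close>

lemma frechet_derivative_eq_grad:
  assumes "f differentiable (at x)"
  shows "frechet_derivative f (at x) h = grad f x \<bullet> h"
proof -
  interpret linear "frechet_derivative f (at x)"
    using assms frechet_derivative_works has_derivative_linear by blast
  have "frechet_derivative f (at x) h = frechet_derivative f (at x) (\<Sum>i\<in>UNIV. h $ i *\<^sub>R axis i 1)"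
    using basis_expansion[of h] by (simp add: scalar_mult_eq_scaleR)
  also have "\<dots> = (\<Sum>i\<in>UNIV. h $ i * partial_deriv i f x)"
    by (simp add: sum scale partial_deriv_def)
  finally show ?thesis
    by (simp add: inner_vec_def grad_def mult.commute)
qed

lemma has_derivative_grad:
  assumes "f differentiable (at x)"
  shows "(f has_derivative (\<lambda>h. grad f x \<bullet> h)) (at x)"
proof -
  have "frechet_derivative f (at x) = (\<lambda>h. grad f x \<bullet> h)"
    using frechet_derivative_eq_grad[OF assms] by auto
  then show ?thesis
    using assms frechet_derivative_works by metis
qed

lemma grad_component [simp]: "grad f x $ i = partial_deriv i f x"
  by (simp add: grad_def)

lemma grad_eqI:
  assumes "(f has_derivative (\<lambda>h. g \<bullet> h)) (at x)"
  shows "grad f x = g"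
proof -
  have "frechet_derivative f (at x) = (\<lambda>h. g \<bullet> h)"
    using frechet_derivative_at[OF assms] by simp
  then show ?thesis
    by (simp add: vec_eq_iff partial_deriv_def inner_axis)
qed

lemma C_1_iff: "C_k 1 f \<longleftrightarrow> (\<forall>x. f differentiable (at x)) \<and> continuous_on UNIV (grad f)"
proof -
  have "continuous_on UNIV (grad f)" if "\<forall>i. continuous_on UNIV (partial_deriv i f)"
    unfolding grad_def using that by (intro continuous_on_vec_lambda) auto
  moreover have "continuous_on UNIV (partial_deriv i f)" if "continuous_on UNIV (grad f)" for i
    using continuous_on_component[OF that, of i] by simp
  ultimately show ?thesis
    unfolding One_nat_def C_k.simps by blast
qed

lemma C_1I:
  assumes "\<And>x. (f has_derivative (\<lambda>h. g x \<bullet> h)) (at x)" "continuous_on UNIV g"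
  shows "C_k 1 f" "grad f = g"
proof -
  show *: "grad f = g"
    using assms(1) grad_eqI by blast
  show "C_k 1 f"
    unfolding C_1_iff * using assms differentiable_def by blast
qed

lemma C_1D:
  assumes "C_k 1 f"
  shows "(f has_derivative (\<lambda>h. grad f x \<bullet> h)) (at x)" "continuous_on UNIV (grad f)"
    "continuous_on UNIV (partial_deriv i f)" "continuous_on UNIV f" "f differentiable (at x)"
proof -
  show d: "f differentiable (at x)" for x
    using assms C_1_iff by blast
  then show "(f has_derivative (\<lambda>h. grad f x \<bullet> h)) (at x)"
    by (rule has_derivative_grad)
  show "continuous_on UNIV (grad f)"
    using assms C_1_iff by blast
  then show "continuous_on UNIV (partial_deriv i f)"
    using continuous_on_component[of UNIV "grad f" i] by simp
  show "continuous_on UNIV f"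
    using d by (intro continuous_at_imp_continuous_on ballI differentiable_imp_continuous_within)
qed

lemma C_2_iff: "C_k 2 f \<longleftrightarrow> (\<forall>x. f differentiable (at x)) \<and> (\<forall>i. C_k 1 (partial_deriv i f))"
  by (simp add: numeral_2_eq_2 del: C_k.simps(1))

lemma C_2_imp_C_1: "C_k 2 f \<Longrightarrow> C_k 1 f"
  unfolding C_2_iff using C_1D(4) by (metis C_k.simps One_nat_def)

lemma has_real_derivative_line:
  assumes "f differentiable (at (x + t *\<^sub>R v))"
  shows "((\<lambda>t. f (x + t *\<^sub>R v)) has_real_derivative grad f (x + t *\<^sub>R v) \<bullet> v) (at t within S)"
proof -
  have "((\<lambda>t. x + t *\<^sub>R v) has_derivative (\<lambda>h. h *\<^sub>R v)) (at t within S)"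
    by (auto intro!: derivative_eq_intros)
  from has_derivative_compose[OF this has_derivative_grad[OF assms]] show ?thesis
    by (simp add: has_field_derivative_def mult.commute[of _ "grad f _ \<bullet> v"])
qed

lemma grad_lincomb:
  assumes "C_k 1 f" "C_k 1 g"
  shows "C_k 1 (\<lambda>x. a * f x + b * g x)"
    "grad (\<lambda>x. a * f x + b * g x) = (\<lambda>x. a *\<^sub>R grad f x + b *\<^sub>R grad g x)"
proof -
  have 1: "((\<lambda>x. a * f x + b * g x) has_derivative
      (\<lambda>h. (a *\<^sub>R grad f x + b *\<^sub>R grad g x) \<bullet> h)) (at x)" for x
    using C_1D(1)[OF assms(1)] C_1D(1)[OF assms(2)]
    by (auto intro!: derivative_eq_intros simp: inner_add_left)
  have 2: "continuous_on UNIV (\<lambda>x. a *\<^sub>R grad f x + b *\<^sub>R grad g x)"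
    using C_1D(2)[OF assms(1)] C_1D(2)[OF assms(2)] by (intro continuous_intros)
  show "C_k 1 (\<lambda>x. a * f x + b * g x)"
    "grad (\<lambda>x. a * f x + b * g x) = (\<lambda>x. a *\<^sub>R grad f x + b *\<^sub>R grad g x)"
    using C_1I[OF 1 2] by auto
qed

lemma grad_mult:
  assumes "C_k 1 f" "C_k 1 g"
  shows "C_k 1 (\<lambda>x. f x * g x)" "grad (\<lambda>x. f x * g x) = (\<lambda>x. g x *\<^sub>R grad f x + f x *\<^sub>R grad g x)"
proof -
  have 1: "((\<lambda>x. f x * g x) has_derivative (\<lambda>h. (g x *\<^sub>R grad f x + f x *\<^sub>R grad g x) \<bullet> h)) (at x)" for x
    using C_1D(1)[OF assms(1)] C_1D(1)[OF assms(2)]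
    by (auto intro!: derivative_eq_intros simp: inner_add_left)
  have 2: "continuous_on UNIV (\<lambda>x. g x *\<^sub>R grad f x + f x *\<^sub>R grad g x)"
    using assms[THEN C_1D(2)] assms[THEN C_1D(4)] by (intro continuous_intros)
  show "C_k 1 (\<lambda>x. f x * g x)" "grad (\<lambda>x. f x * g x) = (\<lambda>x. g x *\<^sub>R grad f x + f x *\<^sub>R grad g x)"
    using C_1I[OF 1 2] by auto
qed

lemma grad_inner_left:
  shows "C_k 1 (\<lambda>x. p \<bullet> x)" "grad (\<lambda>x. p \<bullet> x) = (\<lambda>x. p)"
proof -
  have "((\<lambda>x. p \<bullet> x) has_derivative (\<lambda>h. p \<bullet> h)) (at x)" for x
    by (auto intro!: derivative_eq_intros)
  from C_1I[OF this] show "C_k 1 (\<lambda>x. p \<bullet> x)" "grad (\<lambda>x. p \<bullet> x) = (\<lambda>x. p)"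
    by auto
qed

lemma grad_const:
  shows "C_k 1 (\<lambda>x :: real^'n. c)" "grad (\<lambda>x :: real^'n. c) = (\<lambda>x. 0)"
proof -
  have "((\<lambda>x. c) has_derivative (\<lambda>h. 0 \<bullet> h)) (at x)" for x :: "real^'n"
    by (auto intro!: derivative_eq_intros)
  from C_1I[OF this] show "C_k 1 (\<lambda>x :: real^'n. c)" "grad (\<lambda>x :: real^'n. c) = (\<lambda>x. 0)"
    by auto
qed

lemma C_1_cmult: "C_k 1 f \<Longrightarrow> C_k 1 (\<lambda>x. c * f x)"
  using grad_mult(1)[OF grad_const(1)] by blast

lemma C_1_diff: "C_k 1 f \<Longrightarrow> C_k 1 g \<Longrightarrow> C_k 1 (\<lambda>x. f x - g x)"
  using grad_lincomb(1)[of f g 1 "-1"] by simp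

lemma grad_diff: "C_k 1 f \<Longrightarrow> C_k 1 g \<Longrightarrow> grad (\<lambda>x. f x - g x) = (\<lambda>x. grad f x - grad g x)"
  using grad_lincomb(2)[of f g 1 "-1"] by simp

section \<open>Periodic functions and compactness of the period cell\<close>

lemma torus_periodicD: "torus_periodic f \<Longrightarrow> (\<And>i. k $ i \<in> \<int>) \<Longrightarrow> f (x + k) = f x"
  by (auto simp: torus_periodic_def)

lemma torus_periodicI: "(\<And>x k. (\<And>i. k $ i \<in> \<int>) \<Longrightarrow> f (x + k) = f x) \<Longrightarrow> torus_periodic f"
  by (auto simp: torus_periodic_def)

lemma torus_representative:
  fixes x :: "real^'n"
  obtains k where "\<And>i. k $ i \<in> \<int>" "x + k \<in> cbox 0 1"
proof
  show "(\<chi> i. - of_int \<lfloor>x $ i\<rfloor>) $ i \<in> \<int>" for i :: 'n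
    by simp
  show "x + (\<chi> i. - of_int \<lfloor>x $ i\<rfloor>) \<in> cbox 0 1"
    unfolding mem_box_cart by (simp add: of_int_floor_le) (metis add.commute diff_le_eq real_of_int_floor_add_one_ge diff_add_eq less_eq_real_def)
qed

lemma torus_periodic_range:
  assumes "torus_periodic f"
  shows "range f = f ` cbox 0 1"
proof -
  have "f x \<in> f ` cbox 0 1" for x
    using torus_representative[of x] torus_periodicD[OF assms] by (metis imageI)
  then show ?thesis by auto
qed

lemma compact_range_torus:
  fixes f :: "real^'n \<Rightarrow> 'b::topological_space"
  assumes "torus_periodic f" "continuous_on UNIV f"
  shows "compact (range f)"
  unfolding torus_periodic_range[OF assms(1)]
  by (intro compact_continuous_image continuous_on_subset[OF assms(2)]) auto

lemma torus_bound:
  fixes f :: "real^'n \<Rightarrow> 'b::real_normed_vector"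
  assumes "torus_periodic f" "continuous_on UNIV f"
  obtains M where "M > 0" "\<And>x. norm (f x) \<le> M"
  using compact_imp_bounded[OF compact_range_torus[OF assms]] unfolding bounded_pos by auto

lemma torus_attains_inf:
  fixes f :: "real^'n \<Rightarrow> real"
  assumes "torus_periodic f" "continuous_on UNIV f"
  obtains x where "\<And>y. f x \<le> f y"
  using compact_attains_inf[OF compact_range_torus[OF assms]] by auto

lemma torus_bdd_above:
  fixes f :: "real^'n \<Rightarrow> real"
  assumes "torus_periodic f" "continuous_on UNIV f"
  shows "bdd_above (range f)"
  using compact_imp_bounded[OF compact_range_torus[OF assms]] bounded_imp_bdd_above by auto

text \<open>Two close points may lie on different sides of the boundary of the unit cell, so
  compactness is applied to the larger cube \<open>cbox (-1) 2\<close>: a lattice shift moves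
  \<open>x\<close> into the unit cell, and \<open>y\<close>, at distance less than 1, stays in the
  larger cube.\<close>

lemma torus_uniformly_continuous:
  fixes f :: "real^'n \<Rightarrow> 'b::metric_space"
  assumes "torus_periodic f" "continuous_on UNIV f"
  shows "uniformly_continuous_on UNIV f"
  unfolding uniformly_continuous_on_def
proof (intro allI impI)
  fix e :: real assume "e > 0"
  have "uniformly_continuous_on (cbox (-1) 2 :: (real^'n) set) f"
    by (intro compact_uniformly_continuous continuous_on_subset[OF assms(2)]) auto
  then obtain d where d: "d > 0"
    "\<And>x y. x \<in> cbox (-1) 2 \<Longrightarrow> y \<in> cbox (-1) 2 \<Longrightarrow> dist y x < d \<Longrightarrow> dist (f y) (f x) < e"
    unfolding uniformly_continuous_on_def using \<open>e > 0\<close> by meson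
  show "\<exists>d>0. \<forall>x\<in>UNIV. \<forall>y\<in>UNIV. dist y x < d \<longrightarrow> dist (f y) (f x) < e"
  proof (intro exI[of _ "min d 1"] conjI ballI impI)
    fix x y :: "real^'n" assume xy: "dist y x < min d 1"
    obtain k where k: "\<And>i. k $ i \<in> \<int>" "x + k \<in> cbox 0 1"
      using torus_representative by blast
    have c: "\<bar>y $ i - x $ i\<bar> \<le> 1" for i
      using component_le_norm_cart[of "y - x" i] xy by (simp add: dist_norm)
    have "x $ i + k $ i \<ge> 0" "x $ i + k $ i \<le> 1" for i
      using k(2) by (auto simp: mem_box_cart)
    then have "x + k \<in> cbox (-1) 2" "y + k \<in> cbox (-1) 2"
      using c by (auto simp: mem_box_cart abs_le_iff) (smt (verit, best))+
    then have "dist (f (y + k)) (f (x + k)) < e"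
      using d(2) xy by simp
    then show "dist (f y) (f x) < e"
      using torus_periodicD[OF assms(1) k(1)] by simp
  qed (use d in auto)
qed

lemma partial_deriv_periodic:
  assumes "torus_periodic f" "C_k 1 f"
  shows "torus_periodic (grad f)" "torus_periodic (partial_deriv i f)"
proof -
  show *: "torus_periodic (grad f)"
  proof (rule torus_periodicI)
    fix x k :: "real^'a" assume k: "\<And>i. k $ i \<in> \<int>"
    have "((\<lambda>x. f (x + k)) has_derivative (\<lambda>h. grad f (x + k) \<bullet> h)) (at x)"
      by (rule has_derivative_compose[OF _ C_1D(1)[OF assms(2)], where f = "\<lambda>x. x + k"])
        (auto intro!: derivative_eq_intros)
    moreover have "(\<lambda>x. f (x + k)) = f"
      using torus_periodicD[OF assms(1) k] by auto
    ultimately show "grad f (x + k) = grad f x"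
      using grad_eqI by metis
  qed
  show "torus_periodic (partial_deriv i f)"
    using * by (auto simp: torus_periodic_def vec_eq_iff)
qed

section \<open>Integration over a period cell\<close>

lemma integral_torus_shift:
  fixes f :: "real^'n \<Rightarrow> real"
  assumes "torus_periodic f" "continuous_on UNIV f" "0 \<le> s" "s \<le> 1"
  shows "integral (cbox 0 1) (\<lambda>x. f (x + s *\<^sub>R axis i 1)) = integral (cbox 0 1) f"
proof -
  let ?e = "axis i 1 :: real^'n"
  have int: "f integrable_on cbox a b" for a b
    by (intro integrable_continuous continuous_on_subset[OF assms(2)]) auto
  have e: "?e \<in> Basis"
    by (simp add: axis_in_Basis_iff)
  have ek: "?e $ j \<in> \<int>" for j
    by (simp add: axis_def)
  have cart: "x \<bullet> ?e = x $ i" for x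
    by (simp add: inner_axis)
  \<comment> \<open>The shifted cell is cut along the hyperplane where the \<open>i\<close>-th
    coordinate is 1. \<open>B1\<close> is the part that stays inside the unit cell; the protruding
    slab, moved back by one period, is \<open>B2\<close>.\<close>
  define B1 where "B1 = cbox (s *\<^sub>R ?e) (1 :: real^'n)"
  define B2 where "B2 = cbox 0 (1 - (1 - s) *\<^sub>R ?e)"
  have "integral (cbox 0 1) (\<lambda>x. f (x + s *\<^sub>R ?e)) = integral (cbox (s *\<^sub>R ?e) (1 + s *\<^sub>R ?e)) f"
    using integral_shift_cbox_plus[of "0" 1 f "s *\<^sub>R ?e"] by (simp add: o_def add.commute)
  also have "\<dots> = integral (cbox (s *\<^sub>R ?e) (1 + s *\<^sub>R ?e) \<inter> {x. x \<bullet> ?e \<le> 1}) f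
      + integral (cbox (s *\<^sub>R ?e) (1 + s *\<^sub>R ?e) \<inter> {x. x \<bullet> ?e \<ge> 1}) f"
    by (rule integral_split[OF int e])
  also have "cbox (s *\<^sub>R ?e) (1 + s *\<^sub>R ?e) \<inter> {x. x \<bullet> ?e \<le> 1} = B1"
    unfolding B1_def cart using assms(3,4)
    by (auto simp: mem_box_cart axis_def split: if_splits) (smt (verit, best))
  also have "cbox (s *\<^sub>R ?e) (1 + s *\<^sub>R ?e) \<inter> {x. x \<bullet> ?e \<ge> 1} = cbox (0 + ?e) ((1 - (1 - s) *\<^sub>R ?e) + ?e)"
    unfolding cart using assms(3,4)
    by (auto simp: mem_box_cart axis_def split: if_splits) (smt (verit, best))+
  also have "integral (cbox (0 + ?e) ((1 - (1 - s) *\<^sub>R ?e) + ?e)) f = integral B2 f"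
    unfolding B2_def using integral_shift_cbox_plus[of 0 "1 - (1 - s) *\<^sub>R ?e" f ?e] torus_periodicD[OF assms(1) ek]
    by (simp add: o_def add.commute)
  also have "integral B1 f + integral B2 f = integral (cbox 0 1 \<inter> {x. x \<bullet> ?e \<le> s}) f + integral (cbox 0 1 \<inter> {x. x \<bullet> ?e \<ge> s}) f"
  proof -
    have "B1 = cbox 0 1 \<inter> {x. x \<bullet> ?e \<ge> s}"
      unfolding B1_def cart using assms(3,4) by (auto simp: mem_box_cart axis_def split: if_splits) (smt (verit, best))+
    moreover have "B2 = cbox 0 1 \<inter> {x. x \<bullet> ?e \<le> s}"
      unfolding B2_def cart using assms(3,4)
      by (auto simp: mem_box_cart axis_def split: if_splits) (smt (verit, best))+
    ultimately show ?thesis by simp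
  qed
  also have "\<dots> = integral (cbox 0 1) f"
    using integral_split[OF int e, of 0 1 s] by simp
  finally show ?thesis .
qed

text \<open>The integral over the cell is invariant under shifts along the \<open>i\<close>-th axis;
  differentiating this constant under the integral sign at shift 0 gives the claim. Shifts in
  \<open>{0..1}\<close> and a one-sided derivative suffice.\<close>

lemma integral_partial_deriv_torus:
  fixes f :: "real^'n \<Rightarrow> real"
  assumes "torus_periodic f" "C_k 1 f"
  shows "integral (cbox 0 1) (partial_deriv i f) = 0"
proof -
  let ?F = "\<lambda>s. integral (cbox 0 1) (\<lambda>x. f (x + s *\<^sub>R axis i 1))"
  note cf = C_1D(4)[OF assms(2)] C_1D(3)[OF assms(2)]
  have "(?F has_field_derivative integral (cbox 0 1) (\<lambda>x. partial_deriv i f (x + 0 *\<^sub>R axis i 1))) (at 0 within {0..1})"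
  proof (rule leibniz_rule_field_derivative)
    show "((\<lambda>s. f (x + s *\<^sub>R axis i 1)) has_real_derivative partial_deriv i f (x + s *\<^sub>R axis i 1)) (at s within {0..1})" for s x
      using has_real_derivative_line[OF C_1D(5)[OF assms(2)], where x = x and t = s and v = "axis i 1"]
      by (simp add: inner_axis)
    show "(\<lambda>x. f (x + s *\<^sub>R axis i 1)) integrable_on cbox 0 1" for s
      by (intro integrable_continuous continuous_intros continuous_on_compose2[OF cf(1)]) auto
    show "continuous_on ({0..1} \<times> cbox 0 1) (\<lambda>(s, x). partial_deriv i f (x + s *\<^sub>R axis i 1))"
      unfolding split_beta by (intro continuous_intros continuous_on_compose2[OF cf(2)]) auto
  qed auto
  moreover have "(?F has_field_derivative 0) (at 0 within {0..1})"
  proof (rule has_field_derivative_transform_within[OF DERIV_const zero_less_one])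
    show "s \<in> {0..1} \<Longrightarrow> integral (cbox 0 1) f = ?F s" for s
      using integral_torus_shift[OF assms(1) cf(1)] by simp
  qed auto
  ultimately have "integral (cbox 0 1) (\<lambda>x. partial_deriv i f (x + 0 *\<^sub>R axis i 1)) = 0"
    using vector_derivative_unique_within[of 0 "{0..1::real}"]
    by (simp add: has_real_derivative_iff_has_vector_derivative at_within_Icc_at_right)
  then show ?thesis by simp
qed

section \<open>Steklov averages and the upper bound\<close>

text \<open>Continuous partial derivatives imply total differentiability, so the smoothness of an
  average can be checked one coordinate line at a time. A derivative at parameter 0 for every base
  point already gives the derivative all along each line.\<close>

lemma C_1_partialsI:
  fixes f :: "real^2 \<Rightarrow> real"
  assumes d: "\<And>i x. ((\<lambda>t. f (x + t *\<^sub>R axis i 1)) has_real_derivative g i x) (at 0)"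
    and c: "\<And>i. continuous_on UNIV (g i)"
  shows "C_k 1 f" "partial_deriv i f = g i"
proof -
  define v where "v = (\<lambda>a b. a *\<^sub>R axis 1 1 + b *\<^sub>R axis 2 1 :: real^2)"
  have v: "v (x $ 1) (x $ 2) = x" for x
    unfolding v_def by (simp add: vec_eq_iff forall_2 axis_def)
  have cv: "continuous_on UNIV (\<lambda>z. v (fst z) (snd z))"
    unfolding v_def by (intro continuous_intros)
  have shift: "((\<lambda>t. f (x + t *\<^sub>R axis i 1)) has_real_derivative g i (x + t *\<^sub>R axis i 1)) (at t)" for x t i
    using DERIV_shift[of "\<lambda>t. f (x + t *\<^sub>R axis i 1)" "g i (x + t *\<^sub>R axis i 1)" 0 t] d[where x = "x + t *\<^sub>R axis i 1" and i = i]
    by (simp add: algebra_simps)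
  have D: "((\<lambda>(a, b). f (v a b)) has_derivative (\<lambda>(s, t). s * g 1 (v a b) + blinfun_mult_left (g 2 (v a b)) t))
      (at (a, b) within UNIV \<times> UNIV)" for a b
  proof (rule has_derivative_partialsI)
    show "((\<lambda>a. f (v a b)) has_derivative (\<lambda>s. s * g 1 (v a b))) (at a within UNIV)"
      using shift[where x = "b *\<^sub>R axis 2 1" and t = a and i = 1]
      by (simp add: has_field_derivative_def v_def add.commute mult_commute_abs)
    show "((\<lambda>b. f (v a b)) has_derivative blinfun_apply (blinfun_mult_left (g 2 (v a b)))) (at b within UNIV)" for a b
      using shift[where x = "a *\<^sub>R axis 1 1" and t = b and i = 2]
      by (simp add: has_field_derivative_def v_def mult_commute_abs)
    have "continuous_on UNIV (\<lambda>z. blinfun_mult_left (g 2 (v (fst z) (snd z))))"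
      by (intro bounded_linear.continuous_on[OF bounded_linear_blinfun_mult_left] continuous_on_compose2[OF c cv]) auto
    then show "continuous (at (a, b) within UNIV \<times> UNIV) (\<lambda>(a, b). blinfun_mult_left (g 2 (v a b)))"
      unfolding case_prod_unfold by (simp add: continuous_on_eq_continuous_at)
  qed auto
  have "(f has_derivative (\<lambda>h. (\<chi> i. g i x) \<bullet> h)) (at x)" for x
  proof -
    have "((\<lambda>x. (x $ 1, x $ 2)) has_derivative (\<lambda>h. (h $ 1, h $ 2))) (at x)" for x :: "real^2"
      by (intro bounded_linear_imp_has_derivative bounded_linear_Pair bounded_linear_vec_nth)
    from has_derivative_compose[OF this D[of "x $ 1" "x $ 2", unfolded UNIV_Times_UNIV]] show ?thesis
      by (simp add: v inner_vec_def sum_2 mult.commute)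
  qed
  moreover have "continuous_on UNIV (\<lambda>x. \<chi> i. g i x)"
    using c by (intro continuous_on_vec_lambda)
  ultimately have *: "C_k 1 f" "grad f = (\<lambda>x. \<chi> i. g i x)"
    by (rule C_1I)+
  then show "C_k 1 f" by simp
  have "partial_deriv i f = (\<lambda>x. grad f x $ i)" by simp
  then show "partial_deriv i f = g i"
    unfolding *(2) by simp
qed

section \<open>Averages over segments and squares\<close>

definition steklov :: "real \<Rightarrow> real^'n \<Rightarrow> (real^'n \<Rightarrow> real) \<Rightarrow> real^'n \<Rightarrow> real" where
  "steklov h v f x = integral {0..h} (\<lambda>s. f (x + s *\<^sub>R v)) / h"

lemma steklov_integrable:
  fixes f :: "real^'n \<Rightarrow> real"
  assumes "continuous_on UNIV f"
  shows "(\<lambda>s. f (x + s *\<^sub>R v)) integrable_on {a..b::real}"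
  by (intro integrable_continuous_interval continuous_intros continuous_on_compose2[OF assms]) auto

lemma continuous_on_steklov:
  assumes "continuous_on UNIV f"
  shows "continuous_on UNIV (steklov h v f)"
proof -
  have "continuous_on UNIV (\<lambda>x. integral (cbox 0 h) (\<lambda>s. f (x + s *\<^sub>R v)))"
    by (intro integral_continuous_on_param)
      (auto simp: split_beta intro!: continuous_intros continuous_on_compose2[OF assms])
  then show ?thesis
    unfolding steklov_def[abs_def] by (auto intro!: continuous_intros simp: divide_inverse)
qed

lemma torus_periodic_steklov:
  fixes f :: "real^'n \<Rightarrow> real"
  shows "torus_periodic f \<Longrightarrow> torus_periodic (steklov h v f)"
proof (rule torus_periodicI)
  fix x k :: "real^'n" assume f: "torus_periodic f" and k: "\<And>i. k $ i \<in> \<int>"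
  have "f (x + k + s *\<^sub>R v) = f (x + s *\<^sub>R v)" for s
    using torus_periodicD[OF f k, of "x + s *\<^sub>R v"] by (simp add: add_ac)
  then show "steklov h v f (x + k) = steklov h v f x"
    by (simp add: steklov_def)
qed

lemma steklov_close:
  assumes "continuous_on UNIV f" "h > 0" "\<And>s. s \<in> {0..h} \<Longrightarrow> \<bar>f (x + s *\<^sub>R v) - c\<bar> \<le> e"
  shows "\<bar>steklov h v f x - c\<bar> \<le> e"
proof -
  have int: "(\<lambda>s. f (x + s *\<^sub>R v)) integrable_on cbox 0 h"
    using steklov_integrable[OF assms(1)] by simp
  have "0 \<le> e"
    using assms(2) assms(3)[of 0] by simp
  then have "norm (integral (cbox 0 h) (\<lambda>s. f (x + s *\<^sub>R v) - c)) \<le> e * measure lborel (cbox 0 h)"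
  proof (rule integrable_bound)
    show "(\<lambda>s. f (x + s *\<^sub>R v) - c) integrable_on cbox 0 h"
      by (intro integrable_diff int integrable_const)
    show "norm (f (x + s *\<^sub>R v) - c) \<le> e" if "s \<in> cbox 0 h" for s
      using assms(3) that by simp
  qed
  moreover have "integral (cbox 0 h) (\<lambda>s. f (x + s *\<^sub>R v) - c) = h * (steklov h v f x - c)"
    unfolding integral_diff[OF int integrable_const[of c]]
    using assms(2) by (simp add: steklov_def right_diff_distrib)
  ultimately have "h * \<bar>steklov h v f x - c\<bar> \<le> h * e"
    using assms(2) by (simp add: abs_mult mult.commute)
  then show ?thesis
    using assms(2) by simp
qed

text \<open>Averaging along \<open>v\<close> gains one derivative in the direction \<open>v\<close>,
  and that derivative is a difference quotient of \<open>f\<close>. This gives a mollifier without a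
  smooth kernel.\<close>

lemma steklov_has_real_derivative:
  assumes "continuous_on UNIV f" "h > 0"
  shows "((\<lambda>t. steklov h v f (x + t *\<^sub>R v)) has_real_derivative (f (x + h *\<^sub>R v) - f x) / h) (at 0)"
proof -
  let ?k = "\<lambda>r. f (x + r *\<^sub>R v)"
  \<comment> \<open>The primitive starts at -1 so that 0 is an interior point and the derivative
    there is two-sided.\<close>
  define G where "G = (\<lambda>u. integral {-1..u} ?k)"
  have ck: "continuous_on S ?k" for S
    by (intro continuous_intros continuous_on_compose2[OF assms(1)]) auto
  have G: "(G has_real_derivative ?k u) (at u)" if "u > -1" for u
  proof -
    have "(G has_real_derivative ?k u) (at u within {-1..u + 1})"
      unfolding G_def by (rule integral_has_real_derivative[OF ck]) (use that in auto)
    then show ?thesis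
      using that by (simp add: at_within_Icc_at)
  qed
  have "((\<lambda>t. G (t + h)) has_real_derivative ?k (0 + h)) (at 0)"
    using DERIV_shift[of G "?k (0 + h)" 0 h] G[of "0 + h"] assms(2) by simp
  from DERIV_cdivide[OF DERIV_diff[OF this G[of 0]]]
  have "((\<lambda>t. (G (t + h) - G t) / h) has_real_derivative (?k (0 + h) - ?k 0) / h) (at 0)"
    by simp
  moreover have "\<forall>\<^sub>F t in nhds 0. steklov h v f (x + t *\<^sub>R v) = (G (t + h) - G t) / h"
  proof -
    have *: "steklov h v f (x + t *\<^sub>R v) = (G (t + h) - G t) / h" if "t > -1" for t
    proof -
      have "integral {0..h} (\<lambda>s. f (x + t *\<^sub>R v + s *\<^sub>R v)) = integral {0 + t..h + t} ?k"
        using integral_shift_Icc_real[of 0 h ?k t] by (simp add: o_def algebra_simps)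
      moreover have "G t + integral {t..t + h} ?k = G (t + h)"
        unfolding G_def using that assms(2)
        by (intro Henstock_Kurzweil_Integration.integral_combine integrable_continuous_interval ck) auto
      ultimately show ?thesis
        by (simp add: steklov_def add.commute)
    qed
    have "\<forall>\<^sub>F t in nhds 0. t > (-1 :: real)"
      by (intro order_tendstoD(1)[OF filterlim_ident]) auto
    then show ?thesis
      by (rule eventually_mono) (rule *)
  qed
  ultimately have "((\<lambda>t. steklov h v f (x + t *\<^sub>R v)) has_real_derivative (?k (0 + h) - ?k 0) / h) (at 0)"
    by (subst DERIV_cong_ev[OF refl _ refl])
  then show ?thesis by simp
qed

lemma steklov_has_real_derivative_param:
  assumes "continuous_on UNIV f" "continuous_on UNIV g"
    and "\<And>x. ((\<lambda>t. f (x + t *\<^sub>R w)) has_real_derivative g x) (at 0)"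
  shows "((\<lambda>t. steklov h v f (x + t *\<^sub>R w)) has_real_derivative steklov h v g x) (at 0)"
proof -
  have shift: "((\<lambda>t. f (y + t *\<^sub>R w)) has_real_derivative g (y + t *\<^sub>R w)) (at t)" for y t
    using DERIV_shift[of "\<lambda>t. f (y + t *\<^sub>R w)" "g (y + t *\<^sub>R w)" 0 t] assms(3)[where x = "y + t *\<^sub>R w"]
    by (simp add: algebra_simps)
  have "((\<lambda>t. integral (cbox 0 h) (\<lambda>s. f (x + s *\<^sub>R v + t *\<^sub>R w))) has_field_derivative
      integral (cbox 0 h) (\<lambda>s. g (x + s *\<^sub>R v + 0 *\<^sub>R w))) (at 0 within UNIV)"
  proof (rule leibniz_rule_field_derivative)
    show "(\<lambda>s. f (x + s *\<^sub>R v + t *\<^sub>R w)) integrable_on cbox 0 h" for t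
      by (intro integrable_continuous continuous_intros continuous_on_compose2[OF assms(1)]) auto
    show "continuous_on (UNIV \<times> cbox 0 h) (\<lambda>(t, s). g (x + s *\<^sub>R v + t *\<^sub>R w))"
      unfolding case_prod_unfold by (intro continuous_intros continuous_on_compose2[OF assms(2)]) auto
  qed (use shift in auto)
  from DERIV_cdivide[OF this, of h] show ?thesis
    by (simp add: steklov_def[abs_def] add_ac)
qed

text \<open>The mean of \<open>f\<close> over the square of side \<open>h\<close> with lower corner
  \<open>x\<close>, written as iterated segment averages so that each coordinate direction gains a
  derivative.\<close>

definition mollify :: "real \<Rightarrow> (real^2 \<Rightarrow> real) \<Rightarrow> real^2 \<Rightarrow> real" where
  "mollify h f = steklov h (axis 1 1) (steklov h (axis 2 1) f)"

lemma mollify_C_1: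
  assumes "continuous_on UNIV f" "h > 0"
  shows "C_k 1 (mollify h f)"
proof -
  let ?e = "\<lambda>i. axis i 1 :: real^2"
  let ?Q = "\<lambda>i f x. (f (x + h *\<^sub>R ?e i) - f x) / h"
  have cQ: "continuous_on UNIV (?Q i u)" if "continuous_on UNIV u" for i u
    using assms(2) by (intro continuous_intros continuous_on_compose2[OF that]) auto
  define g where "g = (\<lambda>i::2. if i = 1 then ?Q 1 (steklov h (?e 2) f) else steklov h (?e 1) (?Q 2 f))"
  show ?thesis
  proof (rule C_1_partialsI(1)[where g = g])
    show "continuous_on UNIV (g i)" for i
      unfolding g_def by (simp add: cQ continuous_on_steklov assms)
    have "((\<lambda>t. mollify h f (x + t *\<^sub>R ?e 1)) has_real_derivative ?Q 1 (steklov h (?e 2) f) x) (at 0)" for x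
      unfolding mollify_def by (intro steklov_has_real_derivative continuous_on_steklov assms)
    moreover have "((\<lambda>t. mollify h f (x + t *\<^sub>R ?e 2)) has_real_derivative steklov h (?e 1) (?Q 2 f) x) (at 0)" for x
      unfolding mollify_def
      by (intro steklov_has_real_derivative_param steklov_has_real_derivative continuous_on_steklov cQ assms)
    ultimately show "((\<lambda>t. mollify h f (x + t *\<^sub>R axis i 1)) has_real_derivative g i x) (at 0)" for i x
      using exhaust_2[of i] by (auto simp: g_def)
  qed
qed

text \<open>Averaging commutes with partial derivatives, so the partial derivatives of the average
  are averages of continuous functions and hence again continuously differentiable.\<close>

lemma mollify_C_2:
  assumes "C_k 1 f" "h > 0"
  shows "C_k 2 (mollify h f)" "partial_deriv i (mollify h f) = mollify h (partial_deriv i f)"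
proof -
  note c = C_1D(4)[OF assms(1)] C_1D(3)[OF assms(1)]
  have d: "((\<lambda>t. f (x + t *\<^sub>R axis i 1)) has_real_derivative partial_deriv i f x) (at 0)" for x i
    using has_real_derivative_line[OF C_1D(5)[OF assms(1)], where x = x and t = 0 and v = "axis i 1"]
    by (simp add: inner_axis)
  have 1: "((\<lambda>t. mollify h f (x + t *\<^sub>R axis i 1)) has_real_derivative mollify h (partial_deriv i f) x) (at 0)" for x i
    unfolding mollify_def
    by (intro steklov_has_real_derivative_param continuous_on_steklov c d)
  have 2: "continuous_on UNIV (mollify h (partial_deriv i f))" for i
    unfolding mollify_def by (intro continuous_on_steklov c)
  note * = C_1_partialsI[OF 1 2]
  show pd: "partial_deriv i (mollify h f) = mollify h (partial_deriv i f)" for i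
    by (rule *(2))
  show "C_k 2 (mollify h f)"
    unfolding C_2_iff pd using *(1) C_1D(5) mollify_C_1[OF c(2) assms(2)] by blast
qed

lemma torus_periodic_mollify: "torus_periodic f \<Longrightarrow> torus_periodic (mollify h f)"
  unfolding mollify_def by (intro torus_periodic_steklov)

lemma mollify_close:
  assumes "continuous_on UNIV f" "h > 0"
    and "\<And>y. norm (y - x) \<le> 2 * h \<Longrightarrow> \<bar>f y - c\<bar> \<le> e"
  shows "\<bar>mollify h f x - c\<bar> \<le> e"
  unfolding mollify_def
proof (intro steklov_close continuous_on_steklov assms(1,2))
  fix s t assume st: "s \<in> {0..h}" "t \<in> {0..h}"
  have "norm (s *\<^sub>R axis 1 1 + t *\<^sub>R axis 2 1 :: real^2) \<le> 2 * h"
    by (rule order_trans[OF norm_triangle_ineq]) (use st in simp)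
  then show "\<bar>f (x + s *\<^sub>R axis 1 1 + t *\<^sub>R axis 2 1) - c\<bar> \<le> e"
    by (intro assms(3)) (simp add: add.assoc)
qed

text \<open>Increments of the average are averages of increments. A bound on increments of
  \<open>f\<close> that is uniform near \<open>x\<close> therefore passes to
  \<open>mollify h f\<close>, even when \<open>f\<close> itself has no derivative.\<close>

lemma mollify_diff:
  assumes "continuous_on UNIV f" "h > 0"
  shows "mollify h f (x + u) - mollify h f x = mollify h (\<lambda>z. f (z + u) - f z) x"
proof -
  have *: "steklov h v f (x + u) - steklov h v f x = steklov h v (\<lambda>z. f (z + u) - f z) x"
    if "continuous_on UNIV f" for v :: "real^2" and f x
  proof -
    have "continuous_on UNIV (\<lambda>z. f (z + u))"
      by (intro continuous_intros continuous_on_compose2[OF that]) auto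
    from integral_diff[OF steklov_integrable[OF this] steklov_integrable[OF that]]
    have "integral {0..h} (\<lambda>s. f (x + s *\<^sub>R v + u) - f (x + s *\<^sub>R v))
        = integral {0..h} (\<lambda>s. f (x + s *\<^sub>R v + u)) - integral {0..h} (\<lambda>s. f (x + s *\<^sub>R v))" .
    then show ?thesis
      by (simp add: steklov_def diff_divide_distrib add_ac)
  qed
  show ?thesis
    unfolding mollify_def by (subst *[OF continuous_on_steklov[OF assms(1)]]) (simp add: *[OF assms(1)])
qed

lemma torus_C_1_approx_C_2:
  assumes "f \<in> C_k_torus 1" "e > 0"
  obtains g where "g \<in> C_k_torus 2" "\<And>i x. \<bar>partial_deriv i g x - partial_deriv i f x\<bar> \<le> e"
proof -
  from assms have f: "torus_periodic f" "C_k 1 f"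
    by (auto simp: C_k_torus_def)
  have uc: "uniformly_continuous_on UNIV (partial_deriv i f)" for i
    using torus_uniformly_continuous partial_deriv_periodic(2)[OF f] C_1D(3)[OF f(2)] by blast
  have "\<exists>d>0. \<forall>x y. dist y x < d \<longrightarrow> dist (partial_deriv i f y) (partial_deriv i f x) < e" for i
    using uc[of i] assms(2) unfolding uniformly_continuous_on_def by simp
  then obtain d where d: "\<And>i. d i > 0"
    "\<And>i x y. dist y x < d i \<Longrightarrow> dist (partial_deriv i f y) (partial_deriv i f x) < e"
    by metis
  \<comment> \<open>\<open>mollify_close\<close> looks at points up to distance
    \<open>2 * h\<close>, hence a third of the smaller modulus of continuity.\<close>
  define h where "h = min (d 1) (d 2) / 3"
  have h: "h > 0" "2 * h < d i" for i
    using d(1)[of 1] d(1)[of 2] exhaust_2[of i] by (auto simp: h_def)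
  show thesis
  proof
    show "mollify h f \<in> C_k_torus 2"
      using torus_periodic_mollify[OF f(1)] mollify_C_2(1)[OF f(2) h(1)] by (simp add: C_k_torus_def)
    show "\<bar>partial_deriv i (mollify h f) x - partial_deriv i f x\<bar> \<le> e" for i x
      unfolding mollify_C_2(2)[OF f(2) h(1)]
    proof (rule mollify_close[OF C_1D(3)[OF f(2)] h(1)])
      fix y assume "norm (y - x) \<le> 2 * h"
      then show "\<bar>partial_deriv i f y - partial_deriv i f x\<bar> \<le> e"
        using d(2)[of y x i] h(2)[of i] by (simp add: dist_norm)
    qed
  qed
qed

section \<open>Comparison with twice differentiable test functions\<close>

lemma second_derivative_test_min:
  fixes u :: "real^'n \<Rightarrow> real"
  assumes "C_k 2 u" "\<And>y. u x \<le> u y"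
  shows "partial_deriv i u x = 0" "partial_deriv i (partial_deriv i u) x \<ge> 0"
proof -
  let ?e = "axis i 1 :: real^'n"
  from assms(1) have c: "u differentiable (at y)" "C_k 1 (partial_deriv i u)" for y
    unfolding C_2_iff by auto
  have d1: "((\<lambda>t. u (x + t *\<^sub>R ?e)) has_real_derivative partial_deriv i u (x + t *\<^sub>R ?e)) (at t)" for t
    using has_real_derivative_line[OF c(1), where x = x and t = t and v = "?e"] by (simp add: inner_axis)
  have d2: "((\<lambda>t. partial_deriv i u (x + t *\<^sub>R ?e)) has_real_derivative partial_deriv i (partial_deriv i u) x) (at 0)"
    using has_real_derivative_line[OF C_1D(5)[OF c(2)], where x = x and t = 0 and v = "?e"] by (simp add: inner_axis)
  show 0: "partial_deriv i u x = 0"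
    using DERIV_local_min[OF d1[of 0], of 1] assms(2) by simp
  show "partial_deriv i (partial_deriv i u) x \<ge> 0"
  proof (rule ccontr)
    assume "\<not> ?thesis"
    then have "partial_deriv i (partial_deriv i u) x < 0" by simp
    from DERIV_neg_dec_right[OF d2 this] obtain d where "d > 0"
      and "\<forall>t>0. t < d \<longrightarrow> partial_deriv i u (x + 0 *\<^sub>R ?e) > partial_deriv i u (x + (0 + t) *\<^sub>R ?e)"
      by blast
    then have d: "d > 0" "\<And>t. 0 < t \<Longrightarrow> t < d \<Longrightarrow> partial_deriv i u (x + t *\<^sub>R ?e) < 0"
      using 0 by (simp_all only: scaleR_zero_left add_0_right add_0_left)
    have "\<exists>z>0. z < d / 2 \<and>
        u (x + (d / 2) *\<^sub>R ?e) - u (x + 0 *\<^sub>R ?e) = (d / 2 - 0) * partial_deriv i u (x + z *\<^sub>R ?e)"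
      using d(1) by (intro MVT2 d1) auto
    then obtain z where z: "0 < z" "z < d / 2"
      "u (x + (d / 2) *\<^sub>R ?e) - u x = (d / 2) * partial_deriv i u (x + z *\<^sub>R ?e)"
      by auto
    have "(d / 2) * partial_deriv i u (x + z *\<^sub>R ?e) < 0"
      using d z by (intro mult_pos_neg) auto
    then show False
      using z(3) assms(2)[of "x + (d / 2) *\<^sub>R ?e"] by simp
  qed
qed

lemma C_k_torusD:
  "\<phi> \<in> C_k_torus k \<Longrightarrow> torus_periodic \<phi>" "\<phi> \<in> C_k_torus k \<Longrightarrow> C_k k \<phi>"
  by (auto simp: C_k_torus_def)

lemma torus_periodic_combine: "torus_periodic f \<Longrightarrow> torus_periodic g \<Longrightarrow> torus_periodic (\<lambda>x. F (f x) (g x))"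
  by (auto simp: torus_periodic_def)

lemma partial_deriv_diff:
  assumes "C_k 1 f" "C_k 1 g"
  shows "partial_deriv i (\<lambda>x. f x - g x) = (\<lambda>x. partial_deriv i f x - partial_deriv i g x)"
proof
  fix x
  have "grad (\<lambda>x. f x - g x) x $ i = (grad f x - grad g x) $ i"
    unfolding grad_diff[OF assms] ..
  then show "partial_deriv i (\<lambda>x. f x - g x) x = partial_deriv i f x - partial_deriv i g x"
    by simp
qed

text \<open>At the minimum of \<open>S - \<phi>\<close> the gradients agree, so the quadratic and
  the drift terms coincide and only the two Laplacians have to be compared.\<close>

lemma cell_constant_upper:
  assumes "cell_solution V p A \<kappa> S" "\<phi> \<in> C_k_torus 2"
  shows "\<exists>x. \<kappa> \<le> - laplacian \<phi> x + (norm (p + grad \<phi> x))\<^sup>2 + A * (V x \<bullet> (p + grad \<phi> x))"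
proof -
  from assms(1) have S: "torus_periodic S" "C_k 2 S"
    and eq: "\<And>x. - laplacian S x + (norm (p + grad S x))\<^sup>2 + A * (V x \<bullet> (p + grad S x)) = \<kappa>"
    by (auto simp: cell_solution_def C_k_torus_def)
  note \<phi> = C_k_torusD[OF assms(2)]
  note C1 = S(2)[THEN C_2_imp_C_1] \<phi>(2)[THEN C_2_imp_C_1]
  define u where "u = (\<lambda>x. S x - \<phi> x)"
  have pu: "partial_deriv i u = (\<lambda>x. partial_deriv i S x - partial_deriv i \<phi> x)" for i
    unfolding u_def by (rule partial_deriv_diff[OF C1])
  have C1p: "C_k 1 (partial_deriv i S)" "C_k 1 (partial_deriv i \<phi>)" for i
    using S(2) \<phi>(2) by (auto simp: C_2_iff)
  have "C_k 1 u"
    unfolding u_def by (rule C_1_diff[OF C1])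
  then have u2: "C_k 2 u"
    unfolding C_2_iff using C_1D(5) pu C_1_diff[OF C1p] by metis
  have "torus_periodic u"
    unfolding u_def by (rule torus_periodic_combine[OF S(1) \<phi>(1)])
  then obtain x where x: "\<And>y. u x \<le> u y"
    using torus_attains_inf C_1D(4)[OF \<open>C_k 1 u\<close>] by blast
  note test = second_derivative_test_min[OF u2 x]
  have "grad S x = grad \<phi> x"
    using test(1) by (simp add: vec_eq_iff pu)
  moreover have "laplacian \<phi> x \<le> laplacian S x"
    unfolding laplacian_def
    using test(2) by (intro sum_mono) (simp add: pu partial_deriv_diff[OF C1p])
  ultimately show ?thesis
    using eq[of x] by (intro exI[of _ x]) simp
qed

section \<open>Solenoidal fields\<close>

lemma continuous_on_componentI:
  fixes V :: "'a::topological_space \<Rightarrow> real^'n"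
  assumes "\<And>i. continuous_on S (\<lambda>x. V x $ i)"
  shows "continuous_on S V"
proof -
  have "continuous_on S (\<lambda>x. \<chi> i. V x $ i)"
    by (intro continuous_on_vec_lambda assms)
  then show ?thesis by simp
qed

lemma partial_deriv_mult:
  assumes "C_k 1 f" "C_k 1 g"
  shows "partial_deriv i (\<lambda>x. f x * g x) x = g x * partial_deriv i f x + f x * partial_deriv i g x"
proof -
  have "grad (\<lambda>x. f x * g x) x $ i = (g x *\<^sub>R grad f x + f x *\<^sub>R grad g x) $ i"
    unfolding grad_mult(2)[OF assms] ..
  then show ?thesis by simp
qed

lemma partial_deriv_diff_at:
  assumes "C_k 1 f" "C_k 1 g"
  shows "partial_deriv i (\<lambda>x. f x - g x) x = partial_deriv i f x - partial_deriv i g x"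
  unfolding partial_deriv_diff[OF assms] ..

lemma partial_deriv_const [simp]: "partial_deriv i (\<lambda>x::real^'n. c) x = 0"
proof -
  have "grad (\<lambda>x::real^'n. c) x $ i = 0"
    unfolding grad_const by simp
  then show ?thesis by simp
qed

lemma C_1_mult: "C_k 1 f \<Longrightarrow> C_k 1 g \<Longrightarrow> C_k 1 (\<lambda>x. f x * g x)"
  by (rule grad_mult)

lemma integral_divergence_torus:
  fixes F :: "'n::finite \<Rightarrow> real^'n \<Rightarrow> real"
  assumes "\<And>i. torus_periodic (F i)" "\<And>i. C_k 1 (F i)"
  shows "integral (cbox 0 1) (\<lambda>x. \<Sum>i\<in>UNIV. partial_deriv i (F i) x) = 0"
proof -
  have "partial_deriv i (F i) integrable_on cbox 0 1" for i
    using C_1D(3)[OF assms(2)] by (intro integrable_continuous) (blast intro: continuous_on_subset)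
  then have "integral (cbox 0 1) (\<lambda>x. \<Sum>i\<in>UNIV. partial_deriv i (F i) x)
      = (\<Sum>i\<in>UNIV. integral (cbox 0 1) (partial_deriv i (F i)))"
    by (intro integral_sum) auto
  also have "\<dots> = 0"
    by (intro sum.neutral ballI integral_partial_deriv_torus assms)
  finally show ?thesis .
qed

lemma content_unit_cube_cart: "measure lborel (cbox 0 (1 :: real^'n)) = 1"
proof -
  have "cbox 0 (1 :: real^'n) \<noteq> {}"
    unfolding box_ne_empty by (simp add: Basis_vec_def inner_axis)
  then show ?thesis
    by (subst content_cbox_cart) auto
qed

section \<open>Upper bound, and lower bounds from invariant weights\<close>

locale solenoidal_field =
  fixes V :: "real^2 \<Rightarrow> real^2"
  assumes C_1: "C_k 1 (\<lambda>x. V x $ i)"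
    and periodic: "torus_periodic V"
    and divergence_free: "divergence V x = 0"
    and mean_zero: "integral (cbox 0 1) V = 0"
begin

lemma continuous: "continuous_on UNIV V"
  by (rule continuous_on_componentI[OF C_1D(4)[OF C_1]])

lemma periodic_drift:
  assumes "\<phi> \<in> C_k_torus 1"
  shows "torus_periodic (\<lambda>x. V x \<bullet> (p + grad \<phi> x))"
    "continuous_on UNIV (\<lambda>x. V x \<bullet> (p + grad \<phi> x))"
proof -
  show "torus_periodic (\<lambda>x. V x \<bullet> (p + grad \<phi> x))"
    by (rule torus_periodic_combine[OF periodic partial_deriv_periodic(1)])
      (use C_k_torusD[OF assms] in auto)
  show "continuous_on UNIV (\<lambda>x. V x \<bullet> (p + grad \<phi> x))"
    using C_1D(2)[OF C_k_torusD(2)[OF assms]] by (intro continuous_intros continuous)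
qed

text \<open>The real infimum behaves as expected only for a set bounded below. It is: at a maximum
  of a competitor its gradient vanishes, so its supremum is at least \<open>V x \<bullet> p\<close>,
  hence at least \<open>- (M * norm p)\<close>.\<close>

lemma inviscid_constant_le:
  assumes "\<phi> \<in> C_k_torus 1" "\<And>x. V x \<bullet> (p + grad \<phi> x) \<le> b"
  shows "inviscid_constant V p \<le> b"
proof -
  obtain M where M: "\<And>x. norm (V x) \<le> M"
    using torus_bound[OF periodic continuous] by blast
  have "(INF \<phi>\<in>C_k_torus 1. SUP x. V x \<bullet> (p + grad \<phi> x)) \<le> (SUP x. V x \<bullet> (p + grad \<phi> x))"
  proof (rule cINF_lower[OF bdd_belowI2 assms(1)])
    fix \<psi> assume \<psi>: "\<psi> \<in> C_k_torus 1"
    note \<psi>' = C_k_torusD[OF \<psi>]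
    have "torus_periodic (\<lambda>x. - \<psi> x)"
      using \<psi>'(1) by (simp add: torus_periodic_def)
    moreover have "continuous_on UNIV (\<lambda>x. - \<psi> x)"
      using C_1D(4)[OF \<psi>'(2)] by (intro continuous_intros)
    ultimately obtain x where x: "\<And>y. - \<psi> x \<le> - \<psi> y"
      using torus_attains_inf by blast
    have "(\<lambda>h. grad \<psi> x \<bullet> h) = (\<lambda>h. 0)"
      by (rule differential_zero_maxmin[OF _ _ C_1D(1)[OF \<psi>'(2)], of x UNIV]) (use x in auto)
    then have "grad \<psi> x = 0"
      by (metis inner_eq_zero_iff)
    then have "V x \<bullet> (p + grad \<psi> x) = V x \<bullet> p" by simp
    also have "\<dots> \<ge> - (norm (V x) * norm p)"
      using Cauchy_Schwarz_ineq2[of "V x" p] by linarith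
    also have "- (norm (V x) * norm p) \<ge> - (M * norm p)"
      using M by (simp add: mult_right_mono)
    finally have "- (M * norm p) \<le> V x \<bullet> (p + grad \<psi> x)" .
    also have "\<dots> \<le> (SUP x. V x \<bullet> (p + grad \<psi> x))"
      by (rule cSUP_upper) (use torus_bdd_above[OF periodic_drift[OF \<psi>]] in auto)
    finally show "- (M * norm p) \<le> (SUP x. V x \<bullet> (p + grad \<psi> x))" .
  qed
  also have "\<dots> \<le> b"
    by (rule cSUP_least) (use assms(2) in auto)
  finally show ?thesis
    unfolding inviscid_constant_def .
qed

lemma cell_constant_eventually_le:
  assumes sol: "\<And>A. A > 0 \<Longrightarrow> \<exists>S. cell_solution V p A (\<kappa> A) S" and e: "e > 0"
  shows "\<forall>\<^sub>F A in at_top. \<kappa> A / A \<le> inviscid_constant V p + e"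
proof -
  let ?c = "inviscid_constant V p"
  have "(\<lambda>x. 0) \<in> C_k_torus 1"
    using grad_const(1)[of 0] by (simp add: C_k_torus_def torus_periodic_def)
  then have ne: "(\<lambda>\<phi>. SUP x. V x \<bullet> (p + grad \<phi> x)) ` C_k_torus 1 \<noteq> {}" by blast
  have "Inf ((\<lambda>\<phi>. SUP x. V x \<bullet> (p + grad \<phi> x)) ` C_k_torus 1) < ?c + e / 2"
    unfolding inviscid_constant_def using e by simp
  from cInf_lessD[OF ne this]
  obtain \<phi> where \<phi>: "\<phi> \<in> C_k_torus 1" "(SUP x. V x \<bullet> (p + grad \<phi> x)) < ?c + e / 2"
    by auto
  have \<phi>_le: "V x \<bullet> (p + grad \<phi> x) \<le> ?c + e / 2" for x
  proof -
    have "V x \<bullet> (p + grad \<phi> x) \<le> (SUP x. V x \<bullet> (p + grad \<phi> x))"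
      by (rule cSUP_upper) (use torus_bdd_above[OF periodic_drift[OF \<phi>(1)]] in auto)
    then show ?thesis using \<phi>(2) by linarith
  qed
  obtain M where M: "M > 0" "\<And>x. norm (V x) \<le> M"
    using torus_bound[OF periodic continuous] by blast
  \<comment> \<open>Error budget: \<open>e / 2\<close> for a nearly optimal \<open>\<phi>\<close>;
    \<open>e / 4\<close> for its smoothing, as two gradient components are each off by
    \<open>e / (8 * M)\<close> and the speed is at most \<open>M\<close>; \<open>e / 4\<close> for
    the terms without the factor \<open>A\<close>, which are collected in \<open>R\<close> and
    become negligible after division by a large \<open>A\<close>.\<close>
  have "e / (8 * M) > 0" using e M by simp
  then obtain g where g: "g \<in> C_k_torus 2"
    "\<And>i x. \<bar>partial_deriv i g x - partial_deriv i \<phi> x\<bar> \<le> e / (8 * M)"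
    using torus_C_1_approx_C_2[OF \<phi>(1)] by blast
  have g_le: "V x \<bullet> (p + grad g x) \<le> ?c + 3 * e / 4" for x
  proof -
    have "norm (grad g x - grad \<phi> x) \<le> (\<Sum>i\<in>UNIV. \<bar>(grad g x - grad \<phi> x) $ i\<bar>)"
      by (rule norm_le_l1_cart)
    also have "\<dots> \<le> e / (8 * M) + e / (8 * M)"
      unfolding sum_2 using g(2)[of 1 x] g(2)[of 2 x] by simp
    finally have "norm (V x) * norm (grad g x - grad \<phi> x) \<le> M * (e / (8 * M) + e / (8 * M))"
      using M(1) M(2)[of x] by (intro mult_mono) auto
    also have "\<dots> = e / 4" using M(1) by simp
    finally have "V x \<bullet> (grad g x - grad \<phi> x) \<le> e / 4"
      using norm_cauchy_schwarz[of "V x" "grad g x - grad \<phi> x"] by linarith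
    then show ?thesis
      using \<phi>_le[of x] by (simp add: inner_add_right inner_diff_right)
  qed
  note g' = C_k_torusD[OF g(1)]
  have g1: "C_k 1 g" "\<And>i. C_k 1 (partial_deriv i g)"
    using g'(2) C_2_imp_C_1 unfolding C_2_iff by auto
  define R where "R = (\<lambda>x. (norm (p + grad g x))\<^sup>2 - laplacian g x)"
  have "torus_periodic R"
  proof (rule torus_periodicI)
    fix x k :: "real^2" assume k: "\<And>i. k $ i \<in> \<int>"
    show "R (x + k) = R x"
      unfolding R_def laplacian_def
      using torus_periodicD[OF partial_deriv_periodic(1)[OF g'(1) g1(1)] k]
        torus_periodicD[OF partial_deriv_periodic(2)[OF partial_deriv_periodic(2)[OF g'(1) g1(1)] g1(2)] k]
      by simp
  qed
  moreover have "continuous_on UNIV R"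
    unfolding R_def laplacian_def
    by (intro continuous_intros C_1D(2)[OF g1(1)] C_1D(3)[OF g1(2)])
  ultimately obtain B where B: "B > 0" "\<And>x. norm (R x) \<le> B"
    using torus_bound by blast
  have "\<kappa> A / A \<le> ?c + e" if A: "A \<ge> 4 * B / e" for A
  proof -
    have A0: "A > 0"
      using A B(1) e by (smt (verit, best) divide_pos_pos mult_pos_pos)
    obtain S where "cell_solution V p A (\<kappa> A) S"
      using sol[OF A0] by blast
    from cell_constant_upper[OF this g(1)] obtain x where
      "\<kappa> A \<le> R x + A * (V x \<bullet> (p + grad g x))"
      unfolding R_def by auto
    also have "\<dots> \<le> B + A * (?c + 3 * e / 4)"
      using B(2)[of x] g_le[of x] A0 by (intro add_mono mult_left_mono) auto
    also have "B \<le> A * (e / 4)"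
      using A e by (simp add: field_simps)
    finally have "\<kappa> A \<le> A * (?c + e)"
      by (simp add: algebra_simps)
    then show ?thesis
      using A0 by (simp add: field_simps)
  qed
  then show ?thesis
    unfolding eventually_at_top_linorder by blast
qed

text \<open>A corrector \<open>\<phi>\<close> may be inserted freely: since \<open>V\<close> is
  divergence free and \<open>w\<close> is invariant, the field \<open>w\<^sup>2 \<phi> V\<close> has
  divergence \<open>w\<^sup>2 (V \<bullet> D\<phi>)\<close>, whose integral over the cell is
  zero.\<close>

lemma cell_constant_lower:
  assumes sol: "cell_solution V p A \<kappa> S"
    and w: "w \<in> C_k_torus 1" "\<And>x. V x \<bullet> grad w x = 0" "\<And>x. (norm (grad w x))\<^sup>2 \<le> B"
    and \<phi>: "\<phi> \<in> C_k_torus 1"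
  shows "\<kappa> * integral (cbox 0 1) (\<lambda>x. (w x)\<^sup>2)
    \<ge> A * integral (cbox 0 1) (\<lambda>x. (w x)\<^sup>2 * (V x \<bullet> (p + grad \<phi> x))) - B"
proof -
  from sol have S: "torus_periodic S" "C_k 2 S"
    and eq: "\<And>x. - laplacian S x + (norm (p + grad S x))\<^sup>2 + A * (V x \<bullet> (p + grad S x)) = \<kappa>"
    by (auto simp: cell_solution_def C_k_torus_def)
  have S1: "C_k 1 S" "\<And>i. C_k 1 (partial_deriv i S)"
    using S(2) C_2_imp_C_1 unfolding C_2_iff by auto
  note w' = C_k_torusD[OF w(1)] and \<phi>' = C_k_torusD[OF \<phi>]
  note C1 = S1 w'(2) \<phi>'(2) C_1 grad_const(1)
  \<comment> \<open>\<open>F\<close> gathers everything that integrates away: its divergence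
    \<open>D\<close> contains the Laplacian of \<open>S\<close>, the difference between
    \<open>V \<bullet> DS\<close> and \<open>V \<bullet> D\<phi>\<close>, and a cross term in
    \<open>grad w\<close>.\<close>
  define F where "F = (\<lambda>i x. (w x * w x) * ((A * (S x - \<phi> x)) * V x $ i - partial_deriv i S x - p $ i))"
  have F: "torus_periodic (F i)" for i
  proof (rule torus_periodicI)
    fix x k :: "real^2" assume k: "\<And>i. k $ i \<in> \<int>"
    show "F i (x + k) = F i x"
      unfolding F_def using torus_periodicD[OF S(1) k] torus_periodicD[OF w'(1) k] torus_periodicD[OF \<phi>'(1) k]
        torus_periodicD[OF periodic k] torus_periodicD[OF partial_deriv_periodic(2)[OF S(1) S1(1)] k]
      by simp
  qed
  have F1: "C_k 1 (F i)" for i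
    unfolding F_def by (intro C_1_mult C_1_diff C1)
  define D where "D = (\<lambda>x. \<Sum>i\<in>UNIV. partial_deriv i (F i) x)"
  have pF: "partial_deriv i (F i) x = 2 * w x * partial_deriv i w x * ((A * (S x - \<phi> x)) * V x $ i - partial_deriv i S x - p $ i)
      + (w x * w x) * (A * (partial_deriv i S x - partial_deriv i \<phi> x) * V x $ i
        + A * (S x - \<phi> x) * partial_deriv i (\<lambda>x. V x $ i) x - partial_deriv i (partial_deriv i S) x)" for i x
  proof -
    define G where "G = (\<lambda>x. (A * (S x - \<phi> x)) * V x $ i - partial_deriv i S x - p $ i)"
    have G: "partial_deriv i G x = A * (partial_deriv i S x - partial_deriv i \<phi> x) * V x $ i
        + A * (S x - \<phi> x) * partial_deriv i (\<lambda>x. V x $ i) x - partial_deriv i (partial_deriv i S) x"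
      unfolding G_def
      by (subst partial_deriv_diff_at partial_deriv_mult, (intro C_1_mult C_1_diff C1)+)+ (simp add: algebra_simps)
    have "C_k 1 G"
      unfolding G_def by (intro C_1_mult C_1_diff C1)
    then have FG: "partial_deriv i (F i) x = G x * partial_deriv i (\<lambda>x. w x * w x) x + (w x * w x) * partial_deriv i G x"
      unfolding F_def G_def by (intro partial_deriv_mult C_1_mult C1)
    have ww: "partial_deriv i (\<lambda>x. w x * w x) x = w x * partial_deriv i w x + w x * partial_deriv i w x"
      by (intro partial_deriv_mult C1)
    show ?thesis
      unfolding FG ww G by (simp add: G_def[THEN fun_cong] algebra_simps)
  qed
  have D: "D x = 2 * w x * (A * (S x - \<phi> x)) * (V x \<bullet> grad w x) - 2 * w x * (grad w x \<bullet> (p + grad S x))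
      + (w x)\<^sup>2 * (A * (V x \<bullet> (grad S x - grad \<phi> x)) + A * (S x - \<phi> x) * divergence V x - laplacian S x)" for x
    unfolding D_def sum_2 pF
    by (simp add: inner_vec_def sum_2 laplacian_def divergence_def power2_eq_square algebra_simps)
  have key: "\<kappa> * (w x)\<^sup>2 \<ge> D x + (A * ((w x)\<^sup>2 * (V x \<bullet> (p + grad \<phi> x))) - B)" for x
  proof -
    let ?q = "p + grad S x"
    have "\<kappa> * (w x)\<^sup>2 = (- laplacian S x + (norm ?q)\<^sup>2 + A * (V x \<bullet> ?q)) * (w x)\<^sup>2"
      using eq by simp
    also have "\<dots> = D x + A * ((w x)\<^sup>2 * (V x \<bullet> (p + grad \<phi> x))) + (2 * w x * (grad w x \<bullet> ?q) + (w x)\<^sup>2 * (norm ?q)\<^sup>2)"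
      unfolding D w(2) divergence_free by (simp add: inner_simps algebra_simps)
    \<comment> \<open>Completing the square: the cross term left over from the divergence combines
      with the quadratic term of the equation, and the only loss is
      \<open>(norm (grad w x))\<^sup>2\<close>, which does not grow with \<open>A\<close>.\<close>
    also have "2 * w x * (grad w x \<bullet> ?q) + (w x)\<^sup>2 * (norm ?q)\<^sup>2 = (norm (grad w x + w x *\<^sub>R ?q))\<^sup>2 - (norm (grad w x))\<^sup>2"
      unfolding power2_norm_eq_inner
      by (simp add: inner_add_left inner_add_right inner_commute power2_eq_square algebra_simps)
    finally show ?thesis
      using w(3)[of x] zero_le_power2[of "norm (grad w x + w x *\<^sub>R ?q)"] by linarith
  qed
  have cD: "continuous_on UNIV D"
    unfolding D_def by (intro continuous_intros C_1D(3)[OF F1])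
  have cw: "continuous_on UNIV w"
    by (rule C_1D(4)[OF w'(2)])
  note int = integrable_continuous[OF continuous_on_subset[OF _ subset_UNIV]]
  have i1: "D integrable_on cbox 0 1"
    "(\<lambda>x. (w x)\<^sup>2) integrable_on cbox 0 1" "(\<lambda>x. (w x)\<^sup>2 * (V x \<bullet> (p + grad \<phi> x))) integrable_on cbox 0 1"
    by (rule int, intro continuous_intros cD cw periodic_drift(2)[OF \<phi>])+
  have "integral (cbox 0 1) (\<lambda>x. D x + (A * ((w x)\<^sup>2 * (V x \<bullet> (p + grad \<phi> x))) - B)) \<le> integral (cbox 0 1) (\<lambda>x. \<kappa> * (w x)\<^sup>2)"
    by (intro integral_le integrable_add integrable_diff integrable_on_mult_right i1 integrable_const key)
  moreover have "integral (cbox 0 1) (\<lambda>x. D x + (A * ((w x)\<^sup>2 * (V x \<bullet> (p + grad \<phi> x))) - B))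
      = integral (cbox 0 1) D + (A * integral (cbox 0 1) (\<lambda>x. (w x)\<^sup>2 * (V x \<bullet> (p + grad \<phi> x))) - integral (cbox 0 (1::real^2)) (\<lambda>x. B))"
    by (subst integral_add integral_diff,
        (intro integral_le integrable_add integrable_diff integrable_on_mult_right i1 integrable_const)+)+ simp
  moreover have "integral (cbox 0 1) D = 0"
    unfolding D_def by (rule integral_divergence_torus[OF F F1])
  ultimately show ?thesis
    by (simp add: content_unit_cube_cart)
qed

text \<open>The weight 1 has no gradient, and with corrector 0 the drift integral is the mean of
  \<open>V \<bullet> p\<close>, which is zero.\<close>

lemma cell_constant_nonneg:
  assumes "cell_solution V p A \<kappa> S"
  shows "\<kappa> \<ge> 0"
proof -
  have c: "(\<lambda>x::real^2. c) \<in> C_k_torus 1" for c :: real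
    using grad_const(1) by (simp add: C_k_torus_def torus_periodic_def)
  have "V integrable_on cbox 0 1"
    by (intro integrable_continuous continuous_on_subset[OF continuous]) auto
  from integral_linear[OF this bounded_linear_inner_left[of p]]
  have "integral (cbox 0 1) (\<lambda>x. V x \<bullet> p) = 0"
    by (simp add: mean_zero o_def)
  then show ?thesis
    using cell_constant_lower[OF assms c[of 1] _ _ c[of 0], of 0] 
    by (simp add: grad_const content_unit_cube_cart)
qed

text \<open>After division by \<open>A * m\<close>, where \<open>m\<close> is the integral of
  \<open>w\<^sup>2\<close>, the gradient loss becomes \<open>N\<^sup>2 / (A * m)\<close> and tends
  to zero. A single point with \<open>w x0 \<noteq> 0\<close> makes \<open>m\<close> positive, by
  continuity and periodicity.\<close>

lemma cell_constant_eventually_ge: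
  assumes sol: "\<And>A. A > 0 \<Longrightarrow> \<exists>S. cell_solution V p A (\<kappa> A) S" and e: "e > 0"
    and w: "w \<in> C_k_torus 1" "\<And>x. V x \<bullet> grad w x = 0" "w x0 \<noteq> 0"
    and \<phi>: "\<phi> \<in> C_k_torus 1" "\<And>x. w x \<noteq> 0 \<Longrightarrow> V x \<bullet> (p + grad \<phi> x) \<ge> b"
  shows "\<forall>\<^sub>F A in at_top. \<kappa> A / A \<ge> b - e"
proof -
  note w' = C_k_torusD[OF w(1)]
  obtain N where "\<And>x. norm (grad w x) \<le> N"
    using torus_bound[OF partial_deriv_periodic(1)[OF w'] C_1D(2)[OF w'(2)]] by blast
  then have N: "(norm (grad w x))\<^sup>2 \<le> N\<^sup>2" for x
    by (simp add: power_mono)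
  have cw: "continuous_on S w" for S
    by (rule continuous_on_subset[OF C_1D(4)[OF w'(2)]]) auto
  define m where "m = integral (cbox 0 1) (\<lambda>x. (w x)\<^sup>2)"
  have "m \<noteq> 0"
  proof
    assume "m = 0"
    moreover have "box 0 (1::real^2) \<noteq> {}"
      unfolding box_ne_empty by (simp add: Basis_vec_def inner_axis)
    ultimately have 0: "\<forall>x\<in>cbox 0 1. (w x)\<^sup>2 = 0"
      unfolding m_def by (subst (asm) integral_cbox_eq_0_iff) (auto intro!: continuous_intros cw)
    obtain k where "\<And>i. k $ i \<in> \<int>" "x0 + k \<in> cbox 0 1"
      using torus_representative by blast
    then show False
      using 0 w(3) torus_periodicD[OF w'(1), of k x0] by auto
  qed
  moreover have "m \<ge> 0"
    unfolding m_def by (intro integral_nonneg integrable_continuous continuous_intros cw) auto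
  ultimately have m: "m > 0" by simp
  have i: "integral (cbox 0 1) (\<lambda>x. (w x)\<^sup>2 * (V x \<bullet> (p + grad \<phi> x))) \<ge> b * m"
  proof -
    have "integral (cbox 0 1) (\<lambda>x. b * (w x)\<^sup>2) \<le> integral (cbox 0 1) (\<lambda>x. (w x)\<^sup>2 * (V x \<bullet> (p + grad \<phi> x)))"
    proof (rule integral_le)
      show "(\<lambda>x. (w x)\<^sup>2 * (V x \<bullet> (p + grad \<phi> x))) integrable_on cbox 0 1"
        by (intro integrable_continuous continuous_intros cw continuous_on_subset[OF periodic_drift(2)[OF \<phi>(1)]]) auto
      show "b * (w x)\<^sup>2 \<le> (w x)\<^sup>2 * (V x \<bullet> (p + grad \<phi> x))" for x
        using \<phi>(2)[of x] by (cases "w x = 0") (auto simp: mult.commute intro!: mult_left_mono)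
    qed (intro integrable_continuous continuous_intros cw)
    then show ?thesis
      by (simp add: m_def)
  qed
  have "\<kappa> A / A \<ge> b - e" if A: "A \<ge> N\<^sup>2 / (e * m)" "A > 0" for A
  proof -
    obtain S where "cell_solution V p A (\<kappa> A) S"
      using sol[OF A(2)] by blast
    from cell_constant_lower[OF this w(1,2) N \<phi>(1)]
    have "\<kappa> A * m \<ge> A * (b * m) - N\<^sup>2"
      using mult_left_mono[OF i, of A] A(2) unfolding m_def by linarith
    moreover have "N\<^sup>2 \<le> A * (e * m)"
      using A e m by (simp add: field_simps)
    ultimately have "\<kappa> A * m \<ge> (A * (b - e)) * m"
      by (simp add: algebra_simps)
    then have "\<kappa> A \<ge> A * (b - e)"
      using m by simp
    then show ?thesis
      using A(2) by (simp add: field_simps)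
  qed
  moreover have "\<forall>\<^sub>F A in at_top. A \<ge> N\<^sup>2 / (e * m) \<and> A > 0"
    by (intro eventually_conj eventually_ge_at_top eventually_gt_at_top)
  ultimately show ?thesis
    by (auto elim!: eventually_mono)
qed

end

section \<open>The flow of a Lipschitz field\<close>

lemma integral_has_vector_derivative_halfline:
  fixes k :: "real \<Rightarrow> 'a::banach"
  assumes "continuous_on {0..} k" "t \<ge> 0"
  shows "((\<lambda>u. integral {0..u} k) has_vector_derivative k t) (at t within {0..})"
proof -
  have "((\<lambda>u. integral {0..u} k) has_vector_derivative k t) (at t within {0..t + 1})"
    using assms(2) by (intro integral_has_vector_derivative continuous_on_subset[OF assms(1)]) auto
  moreover have "at t within {0..t + 1} = at t within {0..}"
    by (rule at_within_nhd[of t "{..<t + 1}"]) auto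
  ultimately show ?thesis by simp
qed

lemma integral_exp_le:
  fixes c :: real
  assumes "c > 0" "t \<ge> 0"
  shows "integral {0..t} (\<lambda>s. exp (c * s)) \<le> exp (c * t) / c"
proof -
  have "((\<lambda>s. exp (c * s)) has_integral exp (c * t) / c - exp (c * 0) / c) {0..t}"
    using assms by (intro fundamental_theorem_of_calculus)
      (auto intro!: derivative_eq_intros simp: has_real_derivative_iff_has_vector_derivative[symmetric])
  then show ?thesis
    using assms by (simp add: integral_unique)
qed

text \<open>Picard iteration in the exponentially weighted norm is a contraction on the whole half line
  \<open>t \<ge> 0\<close>, so no gluing of local solutions is needed; the unknown is \<open>v t = exp (- 2 L t) (u t - x)\<close>.\<close>

lemma global_forward_solution:
  fixes V :: "'a::euclidean_space \<Rightarrow> 'a"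
  assumes L: "L > 0" "\<And>x y. norm (V x - V y) \<le> L * norm (x - y)" and M: "\<And>x. norm (V x) \<le> M"
  obtains u where "u 0 = x" "\<And>t. t \<ge> 0 \<Longrightarrow> (u has_vector_derivative V (u t)) (at t within {0..})"
proof -
  have cV: "continuous_on UNIV V"
    by (rule lipschitz_on_continuous_on[of L]) (use L in \<open>auto intro!: lipschitz_onI simp: dist_norm\<close>)
  define K where "K = (\<lambda>(v :: real \<Rightarrow>\<^sub>C 'a) s. V (x + exp (2 * L * s) *\<^sub>R v s))"
  have cK: "continuous_on S (K v)" for v S
    unfolding K_def by (intro continuous_on_compose2[OF cV] continuous_intros) auto
  have iK: "K v integrable_on {0..t}" for v t
    by (intro integrable_continuous_interval cK)
  define I where "I = (\<lambda>v t. integral {0..t} (K v))"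
  have dI: "(I v has_vector_derivative K v t) (at t within {0..})" if "t \<ge> 0" for v t
    unfolding I_def using that by (intro integral_has_vector_derivative_halfline cK)
  have cI: "continuous_on {0..} (I v)" for v
    using dI by (auto intro!: has_vector_derivative_continuous simp: continuous_on_eq_continuous_within)
  have max0: "max t 0 \<in> {0..}" for t :: real by simp
  \<comment> \<open>Elements of the function space live on the whole line; \<open>max t 0\<close>
    extends the iterate to negative times by its value at 0.\<close>
  define T where "T = (\<lambda>v t. exp (- (2 * L * max t 0)) *\<^sub>R I v (max t 0))"
  have T: "T v \<in> bcontfun" for v
  proof (rule bcontfun_normI)
    show "continuous_on UNIV (T v)"
      unfolding T_def by (intro continuous_intros continuous_on_compose2[OF cI] image_subsetI max0)
    fix t :: real
    define s where "s = max t 0"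
    have s: "s \<ge> 0" by (simp add: s_def)
    have M0: "0 \<le> M" using M[of 0] norm_ge_zero order_trans by blast
    have "norm (I v s) \<le> integral {0..s} (\<lambda>_. M)"
      unfolding I_def by (intro integral_norm_bound_integral iK) (auto simp: K_def M)
    then have "norm (I v s) \<le> M * s" using s by (simp add: mult.commute)
    also have "2 * L * s \<le> exp (2 * L * s)"
      using exp_ge_add_one_self[of "2 * L * s"] by linarith
    then have "M * s \<le> M * (exp (2 * L * s) / (2 * L))"
      using L(1) M0 by (intro mult_left_mono) (simp_all add: field_simps)
    finally have "exp (- (2 * L * s)) * norm (I v s) \<le> exp (- (2 * L * s)) * (M * (exp (2 * L * s) / (2 * L)))"
      by (intro mult_left_mono) auto
    also have "\<dots> = M / (2 * L)"
      by (simp add: exp_minus field_simps)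
    finally show "norm (T v t) \<le> M / (2 * L)"
      by (simp add: T_def s_def)
  qed
  \<comment> \<open>The rate \<open>2 * L\<close> of the weight produces the factor 1/2: the
    integral of \<open>L * exp (2 * L * r)\<close> over \<open>{0..s}\<close> is at most
    \<open>exp (2 * L * s) / 2\<close>.\<close>
  have contraction: "dist (Bcontfun (T v)) (Bcontfun (T w)) \<le> 1 / 2 * dist v w" for v w
  proof (rule dist_bound)
    fix t :: real
    define s where "s = max t 0"
    have s: "s \<ge> 0" by (simp add: s_def)
    have "norm (I v s - I w s) = norm (integral {0..s} (\<lambda>r. K v r - K w r))"
      unfolding I_def by (simp add: integral_diff iK)
    also have "\<dots> \<le> integral {0..s} (\<lambda>r. (L * dist v w) * exp (2 * L * r))"
    proof (rule integral_norm_bound_integral)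
      show "(\<lambda>r. K v r - K w r) integrable_on {0..s}"
        by (intro integrable_diff iK)
      show "(\<lambda>r. (L * dist v w) * exp (2 * L * r)) integrable_on {0..s}"
        by (intro integrable_continuous_interval continuous_intros)
      fix r assume "r \<in> {0..s}"
      have "norm (K v r - K w r) \<le> L * norm (exp (2 * L * r) *\<^sub>R (v r - w r))"
        unfolding K_def using L(2)[of "x + exp (2 * L * r) *\<^sub>R v r" "x + exp (2 * L * r) *\<^sub>R w r"]
        by (simp add: scaleR_diff_right)
      also have "\<dots> = L * exp (2 * L * r) * dist (v r) (w r)"
        by (simp add: dist_norm)
      also have "\<dots> \<le> L * exp (2 * L * r) * dist v w"
        using L(1) by (intro mult_left_mono dist_bounded) auto
      finally show "norm (K v r - K w r) \<le> (L * dist v w) * exp (2 * L * r)"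
        by (simp add: mult_ac)
    qed
    also have "\<dots> = (L * dist v w) * integral {0..s} (\<lambda>r. exp (2 * L * r))"
      by simp
    also have "\<dots> \<le> (L * dist v w) * (exp (2 * L * s) / (2 * L))"
      using L(1) s by (intro mult_left_mono integral_exp_le) auto
    also have "\<dots> = dist v w / 2 * exp (2 * L * s)"
      using L(1) by simp
    finally have "exp (- (2 * L * s)) * norm (I v s - I w s) \<le> exp (- (2 * L * s)) * (dist v w / 2 * exp (2 * L * s))"
      by (intro mult_left_mono) auto
    also have "\<dots> = dist v w / 2"
      by (simp add: exp_minus field_simps)
    finally have "norm (T v t - T w t) \<le> 1 / 2 * dist v w"
      unfolding T_def s_def[symmetric] scaleR_diff_right[symmetric] by simp
    then show "dist (apply_bcontfun (Bcontfun (T v)) t) (apply_bcontfun (Bcontfun (T w)) t) \<le> 1 / 2 * dist v w"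
      by (simp add: Bcontfun_inverse T dist_norm)
  qed
  have "\<exists>!v. Bcontfun (T v) = v"
    by (rule banach_fix_type[of "1 / 2"]) (use contraction in auto)
  then obtain v where "Bcontfun (T v) = v" by blast
  then have fixed: "v t = T v t" for t
    using Bcontfun_inverse[OF T[of v]] by metis
  have eq: "exp (2 * L * t) *\<^sub>R v t = I v t" if "t \<ge> 0" for t
    using that unfolding fixed T_def by (simp add: exp_minus)
  show thesis
  proof
    show "x + I v 0 = x" by (simp add: I_def)
    fix t :: real assume t: "t \<ge> 0"
    have "((\<lambda>t. x + I v t) has_vector_derivative 0 + K v t) (at t within {0..})"
      by (intro has_vector_derivative_add has_vector_derivative_const dI t)
    then show "((\<lambda>t. x + I v t) has_vector_derivative V (x + I v t)) (at t within {0..})"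
      unfolding K_def eq[OF t] by simp
  qed
qed

section \<open>The forward flow map\<close>

locale lipschitz_flow =
  fixes V :: "real^'n \<Rightarrow> real^'n" and L M :: real
  assumes L_pos: "L > 0" and lipschitz: "norm (V x - V y) \<le> L * norm (x - y)"
    and M_pos: "M > 0" and bounded: "norm (V x) \<le> M"
    and torus_periodic: "torus_periodic V"
begin

definition solution :: "(real \<Rightarrow> real^'n) \<Rightarrow> bool" where
  "solution u \<longleftrightarrow> (\<forall>t\<ge>0. (u has_vector_derivative V (u t)) (at t within {0..}))"

text \<open>For \<open>t \<ge> 0\<close> the choice is immaterial by \<open>solution_unique\<close>;
  values at negative times carry no information.\<close>

definition X :: "real \<Rightarrow> real^'n \<Rightarrow> real^'n" where
  "X t x = (SOME u. u 0 = x \<and> solution u) t"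

lemma X_0 [simp]: "X 0 x = x" and X_solution: "solution (\<lambda>t. X t x)"
proof -
  have "\<exists>u. u 0 = x \<and> solution u"
    using global_forward_solution[OF L_pos lipschitz bounded] unfolding solution_def by metis
  from someI_ex[OF this] show "X 0 x = x" "solution (\<lambda>t. X t x)"
    by (auto simp: X_def)
qed

lemma solution_continuous: "solution u \<Longrightarrow> continuous_on {0..} u"
  by (auto intro!: has_vector_derivative_continuous simp: continuous_on_eq_continuous_within solution_def)

lemma solution_at: "solution u \<Longrightarrow> t > 0 \<Longrightarrow> (u has_vector_derivative V (u t)) (at t)"
proof -
  assume u: "solution u" and t: "t > 0"
  have "at t within {0..} = at t"
    by (rule at_within_open_subset[of t "{0<..}"]) (use t in auto)
  then show ?thesis
    using u t by (metis less_eq_real_def solution_def)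
qed

text \<open>The squared distance \<open>d\<close> has derivative bounded by \<open>2 * L * d\<close>
  in absolute value, so \<open>exp (- (2 * L * t)) * d t\<close> decreases and
  \<open>exp (2 * L * t) * d t\<close> increases. The second estimate makes \<open>X t\<close>
  injective, which stands in for a backward flow.\<close>

lemma solution_gronwall:
  assumes u: "solution u" and v: "solution v" and t: "t \<ge> 0"
  shows "norm (u t - v t) \<le> exp (L * t) * norm (u 0 - v 0)"
    "norm (u 0 - v 0) \<le> exp (L * t) * norm (u t - v t)"
proof -
  have e2: "exp (2 * L * t) = (exp (L * t))\<^sup>2"
    using exp_double[of "L * t"] by (simp add: mult.assoc)
  define d where "d = (\<lambda>t. (norm (u t - v t))\<^sup>2)"
  have cd: "continuous_on {0..t} d"
    unfolding d_def using solution_continuous[OF u] solution_continuous[OF v]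
    by (intro continuous_intros) (auto elim: continuous_on_subset)
  have dd: "(d has_real_derivative 2 * ((u s - v s) \<bullet> (V (u s) - V (v s)))) (at s)" if "s > 0" for s
    unfolding d_def power2_norm_eq_inner has_real_derivative_iff_has_vector_derivative
    using solution_at[OF u that] solution_at[OF v that]
    by (auto intro!: derivative_eq_intros simp: has_vector_derivative_def inner_diff_left inner_diff_right inner_commute algebra_simps)
  have bound: "\<bar>2 * ((u s - v s) \<bullet> (V (u s) - V (v s)))\<bar> \<le> 2 * L * d s" for s
  proof -
    have "\<bar>(u s - v s) \<bullet> (V (u s) - V (v s))\<bar> \<le> norm (u s - v s) * norm (V (u s) - V (v s))"
      by (rule Cauchy_Schwarz_ineq2)
    also have "\<dots> \<le> norm (u s - v s) * (L * norm (u s - v s))"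
      by (intro mult_left_mono lipschitz) auto
    finally show ?thesis
      by (simp add: d_def power2_eq_square abs_mult mult_ac)
  qed
  have "exp (- (2 * L * t)) * d t \<le> exp (- (2 * L * 0)) * d 0"
  proof (rule DERIV_nonpos_imp_decreasing_open[OF t])
    fix s :: real assume s: "0 < s" "s < t"
    have "((\<lambda>s. exp (- (2 * L * s)) * d s) has_real_derivative
        exp (- (2 * L * s)) * (2 * ((u s - v s) \<bullet> (V (u s) - V (v s))) - 2 * L * d s)) (at s)"
      by (auto intro!: derivative_eq_intros dd s simp: algebra_simps)
    moreover have "exp (- (2 * L * s)) * (2 * ((u s - v s) \<bullet> (V (u s) - V (v s))) - 2 * L * d s) \<le> 0"
      using bound[of s] by (intro mult_nonneg_nonpos) auto
    ultimately show "\<exists>y. ((\<lambda>s. exp (- (2 * L * s)) * d s) has_real_derivative y) (at s) \<and> y \<le> 0"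
      by blast
  qed (intro continuous_intros cd)
  then have "d t \<le> exp (2 * L * t) * d 0"
    by (simp add: exp_minus field_simps)
  also have "\<dots> = (exp (L * t) * norm (u 0 - v 0))\<^sup>2"
    unfolding e2 by (simp add: d_def power_mult_distrib)
  finally show "norm (u t - v t) \<le> exp (L * t) * norm (u 0 - v 0)"
    unfolding d_def by (rule power2_le_imp_le) auto
  have "exp (2 * L * 0) * d 0 \<le> exp (2 * L * t) * d t"
  proof (rule DERIV_nonneg_imp_increasing_open[OF t])
    fix s :: real assume s: "0 < s" "s < t"
    have "((\<lambda>s. exp (2 * L * s) * d s) has_real_derivative
        exp (2 * L * s) * (2 * ((u s - v s) \<bullet> (V (u s) - V (v s))) + 2 * L * d s)) (at s)"
      by (auto intro!: derivative_eq_intros dd s simp: algebra_simps)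
    moreover have "exp (2 * L * s) * (2 * ((u s - v s) \<bullet> (V (u s) - V (v s))) + 2 * L * d s) \<ge> 0"
      using bound[of s] by (intro mult_nonneg_nonneg) auto
    ultimately show "\<exists>y. ((\<lambda>s. exp (2 * L * s) * d s) has_real_derivative y) (at s) \<and> y \<ge> 0"
      by blast
  qed (intro continuous_intros cd)
  then have "d 0 \<le> (exp (L * t) * norm (u t - v t))\<^sup>2"
    unfolding e2 by (simp add: d_def power_mult_distrib)
  then show "norm (u 0 - v 0) \<le> exp (L * t) * norm (u t - v t)"
    unfolding d_def by (rule power2_le_imp_le) auto
qed

lemma solution_unique: "solution u \<Longrightarrow> t \<ge> 0 \<Longrightarrow> u t = X t (u 0)"
  using solution_gronwall(1)[OF _ X_solution, of u t "u 0"] by simp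

lemma X_lipschitz: "t \<ge> 0 \<Longrightarrow> norm (X t x - X t y) \<le> exp (L * t) * norm (x - y)"
  using solution_gronwall(1)[OF X_solution X_solution, of t x y] by simp

lemma X_inject: "t \<ge> 0 \<Longrightarrow> X t x = X t y \<longleftrightarrow> x = y"
  using solution_gronwall(2)[OF X_solution X_solution, of t x y] by auto

lemma X_add:
  assumes "s \<ge> 0" "t \<ge> 0"
  shows "X (s + t) x = X t (X s x)"
proof -
  have "solution (\<lambda>t. X (s + t) x)"
    unfolding solution_def
  proof (intro allI impI)
    fix t :: real assume t: "t \<ge> 0"
    have "((\<lambda>t. X t x) has_vector_derivative V (X (s + t) x)) (at (s + t) within {0..})"
      using X_solution[of x] t assms(1) by (simp add: solution_def)
    then have "((\<lambda>t. X t x) has_vector_derivative V (X (s + t) x)) (at (s + t) within (\<lambda>t. s + t) ` {0..})"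
      by (rule has_vector_derivative_within_subset) (use assms(1) in auto)
    moreover have "((\<lambda>t. s + t) has_vector_derivative 1) (at t within {0..})"
      by (auto intro!: derivative_eq_intros)
    ultimately show "((\<lambda>t. X (s + t) x) has_vector_derivative V (X (s + t) x)) (at t within {0..})"
      using vector_diff_chain_within[of "\<lambda>t. s + t" 1 t "{0..}"] by (fastforce simp: o_def)
  qed
  from solution_unique[OF this assms(2)] show ?thesis by simp
qed

lemma V_shift: "(\<And>i. k $ i \<in> \<int>) \<Longrightarrow> V (x + k) = V x"
  by (rule torus_periodicD[OF torus_periodic])

lemma X_shift:
  assumes "\<And>i. k $ i \<in> \<int>" "t \<ge> 0"
  shows "X t (x + k) = X t x + k"
proof -
  have "solution (\<lambda>t. X t x + k)"
    using X_solution[of x] unfolding solution_def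
    by (auto intro!: derivative_eq_intros simp: V_shift[OF assms(1)])
  from solution_unique[OF this assms(2)] show ?thesis by simp
qed

lemma X_speed:
  assumes "0 \<le> s" "s \<le> t"
  shows "norm (X t x - X s x) \<le> M * (t - s)"
proof (cases "s = t")
  case False
  then have "s < t" using assms by simp
  have "norm (X t x - X s x) \<le> M * t - M * s"
  proof (rule differentiable_bound_general[OF \<open>s < t\<close>])
    show "continuous_on {s..t} (\<lambda>t. X t x)"
      by (rule continuous_on_subset[OF solution_continuous[OF X_solution]]) (use assms in auto)
    show "((\<lambda>t. X t x) has_vector_derivative V (X r x)) (at r)" if "s < r" for r
      using solution_at[OF X_solution, of r x] that assms by simp
    show "((\<lambda>t. M * t) has_vector_derivative M) (at r)" for r
      by (auto intro!: derivative_eq_intros simp: has_vector_derivative_def)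
  qed (auto intro!: continuous_intros bounded)
  then show ?thesis by (simp add: algebra_simps)
qed simp

lemma X_dist:
  assumes "0 \<le> s" "0 \<le> t"
  shows "norm (X t x - X s y) \<le> M * \<bar>t - s\<bar> + exp (L * t) * norm (x - y)"
proof -
  have "norm (X t y - X s y) \<le> M * \<bar>t - s\<bar>"
    using X_speed[of s t y] X_speed[of t s y] assms by (cases "s \<le> t") (auto simp: norm_minus_commute)
  moreover have "norm (X t x - X s y) \<le> norm (X t x - X t y) + norm (X t y - X s y)"
    using norm_triangle_ineq[of "X t x - X t y" "X t y - X s y"] by simp
  ultimately show ?thesis
    using X_lipschitz[OF assms(2), of x y] by linarith
qed

lemma X_tendsto:
  assumes "(f \<longlongrightarrow> t) F" "(g \<longlongrightarrow> x) F" "\<forall>\<^sub>F n in F. f n \<ge> 0" "t \<ge> 0"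
  shows "((\<lambda>n. X (f n) (g n)) \<longlongrightarrow> X t x) F"
proof (rule Lim_null[THEN iffD2], rule Lim_null_comparison)
  show "\<forall>\<^sub>F n in F. norm (X (f n) (g n) - X t x) \<le> M * \<bar>f n - t\<bar> + exp (L * f n) * norm (g n - x)"
    using assms(3) by eventually_elim (rule X_dist[OF assms(4)])
  have "((\<lambda>n. M * \<bar>f n - t\<bar> + exp (L * f n) * norm (g n - x)) \<longlongrightarrow> M * \<bar>t - t\<bar> + exp (L * t) * norm (x - x)) F"
    by (intro tendsto_intros assms)
  then show "((\<lambda>n. M * \<bar>f n - t\<bar> + exp (L * f n) * norm (g n - x)) \<longlongrightarrow> 0) F"
    by simp
qed

lemma X_continuous: "t \<ge> 0 \<Longrightarrow> continuous_on S (X t)"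
  unfolding continuous_on_def by (intro ballI X_tendsto) (auto intro: tendsto_intros)

lemma X_continuous_time: "continuous_on {0..} (\<lambda>t. X t x)"
  by (rule solution_continuous[OF X_solution])

end

section \<open>Averaged correctors and stream functions\<close>

text \<open>The error quadratic in \<open>t\<close> disappears in the limit and only the linear one
  survives. This reads off a directional derivative of a mollified function from increments of the
  rough one.\<close>

lemma real_derivative_approx:
  fixes f :: "real \<Rightarrow> real"
  assumes "(f has_real_derivative D) (at 0)" "\<And>t. 0 < t \<Longrightarrow> \<bar>f t - f 0 - t * g\<bar> \<le> t * (a + b * t)"
  shows "\<bar>D - g\<bar> \<le> a"
proof (rule tendsto_le[OF trivial_limit_at_right_real])
  have "((\<lambda>t. (f t - f 0) / t) \<longlongrightarrow> D) (at_right 0)"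
    using assms(1) unfolding has_field_derivative_iff by (auto intro: tendsto_within_subset)
  then show "((\<lambda>t. \<bar>(f t - f 0) / t - g\<bar>) \<longlongrightarrow> \<bar>D - g\<bar>) (at_right 0)"
    by (intro tendsto_intros)
  have "((\<lambda>t. a + b * t) \<longlongrightarrow> a + b * 0) (at_right 0)"
    by (intro tendsto_intros)
  then show "((\<lambda>t. a + b * t) \<longlongrightarrow> a) (at_right 0)" by simp
  have "\<bar>(f t - f 0) / t - g\<bar> \<le> a + b * t" if "t > 0" for t
  proof -
    have "t * \<bar>(f t - f 0) / t - g\<bar> = \<bar>t * ((f t - f 0) / t - g)\<bar>"
      using that by (simp add: abs_mult)
    also have "t * ((f t - f 0) / t - g) = f t - f 0 - t * g"
      using that by (simp add: field_simps)
    also have "\<bar>\<dots>\<bar> \<le> t * (a + b * t)" by (rule assms(2)[OF that])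
    finally show ?thesis using that by simp
  qed
  then show "\<forall>\<^sub>F t in at_right 0. \<bar>(f t - f 0) / t - g\<bar> \<le> a + b * t"
    unfolding eventually_at_right_field by (intro exI[of _ 1]) auto
qed

lemma torus_periodic_axisI:
  fixes f :: "real^2 \<Rightarrow> 'b"
  assumes "\<And>x i. f (x + axis i 1) = f x"
  shows "torus_periodic f"
proof (rule torus_periodicI)
  have *: "f (x + of_int m *\<^sub>R axis i 1) = f x" for m i x
  proof (induction m arbitrary: x rule: int_induct[where k = 0])
    case (step1 m)
    show ?case
      using assms[of "x + of_int m *\<^sub>R axis i 1" i] step1 by (simp add: algebra_simps)
  next
    case (step2 m)
    show ?case
      using assms[of "x + of_int (m - 1) *\<^sub>R axis i 1" i] step2(2)[of x] by (simp add: algebra_simps)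
  qed simp
  fix x k :: "real^2" assume k: "\<And>i. k $ i \<in> \<int>"
  obtain m1 m2 where "k $ 1 = of_int m1" "k $ 2 = of_int m2"
    using k by (metis Ints_cases)
  then have "k = of_int m1 *\<^sub>R axis 1 1 + of_int m2 *\<^sub>R axis 2 1"
    by (simp add: vec_eq_iff forall_2 axis_def)
  then have "f (x + k) = f (x + of_int m1 *\<^sub>R axis 1 1 + of_int m2 *\<^sub>R axis 2 1)"
    by (simp add: add.assoc)
  then show "f (x + k) = f x"
    by (simp add: *)
qed

text \<open>The Poincare lemma on the plane: \<open>H x\<close> is the line integral of
  \<open>W\<close> along the segment from 0 to \<open>x\<close>.\<close>

lemma potential_exists:
  fixes W :: "real^2 \<Rightarrow> real^2"
  assumes C1: "\<And>i. C_k 1 (\<lambda>x. W x $ i)"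
    and closed: "\<And>i j x. partial_deriv i (\<lambda>x. W x $ j) x = partial_deriv j (\<lambda>x. W x $ i) x"
  obtains H where "C_k 1 H" "grad H = W"
proof -
  let ?d = "\<lambda>i j. partial_deriv i (\<lambda>x. W x $ j)"
  let ?e = "\<lambda>i. axis i 1 :: real^2"
  define H where "H = (\<lambda>x. integral (cbox 0 1) (\<lambda>s. x \<bullet> W (s *\<^sub>R x)))"
  have cW: "continuous_on UNIV (\<lambda>x. W x $ i)" "continuous_on UNIV (?d i j)" for i j
    using C_1D(4)[OF C1] C_1D(3)[OF C1] by auto
  have cW': "continuous_on UNIV W"
    by (rule continuous_on_componentI[OF cW(1)])
  have dW: "((\<lambda>t. W (s *\<^sub>R (x + t *\<^sub>R ?e i)) $ j) has_real_derivative s * ?d i j (s *\<^sub>R (x + t *\<^sub>R ?e i))) (at t)" for s x i j t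
    using has_real_derivative_line[OF C_1D(5)[OF C1], where x = "s *\<^sub>R x" and t = t and v = "s *\<^sub>R ?e i"]
    by (simp add: scaleR_add_right inner_axis mult.commute)
  \<comment> \<open>\<open>G i x s\<close> is the \<open>i\<close>-th partial derivative of the
    integrand in \<open>x\<close>. Since \<open>W\<close> is closed it is also the derivative of
    \<open>s * W (s *\<^sub>R x) $ i\<close> in \<open>s\<close>, so its integral over
    \<open>{0..1}\<close> is \<open>W x $ i\<close>.\<close>
  define G where "G = (\<lambda>i x s. W (s *\<^sub>R x) $ i + s * (x $ 1 * ?d i 1 (s *\<^sub>R x) + x $ 2 * ?d i 2 (s *\<^sub>R x)))"
  have dK: "((\<lambda>t. (x + t *\<^sub>R ?e i) \<bullet> W (s *\<^sub>R (x + t *\<^sub>R ?e i))) has_real_derivative G i (x + t *\<^sub>R ?e i) s) (at t)" for s x i t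
  proof -
    have dx: "((\<lambda>t. (x + t *\<^sub>R ?e i) $ j) has_real_derivative (if j = i then 1 else 0)) (at t)" for j
      by (cases "j = i") (auto intro!: derivative_eq_intros simp: axis_def)
    let ?y = "x + t *\<^sub>R ?e i"
    let ?D = "\<lambda>j. ?y $ j * (s * ?d i j (s *\<^sub>R ?y)) + (if j = i then 1 else 0) * W (s *\<^sub>R ?y) $ j"
    have "((\<lambda>t. (x + t *\<^sub>R ?e i) \<bullet> W (s *\<^sub>R (x + t *\<^sub>R ?e i))) has_real_derivative ?D 1 + ?D 2) (at t)"
      unfolding inner_vec_def sum_2 inner_real_def by (intro DERIV_add DERIV_mult' dx dW)
    moreover have "?D 1 + ?D 2 = G i ?y s"
      unfolding G_def using exhaust_2[of i] by (elim disjE) (simp_all add: ring_distribs)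
    ultimately show ?thesis by simp
  qed
  have leib: "((\<lambda>t. H (x + t *\<^sub>R ?e i)) has_field_derivative integral (cbox 0 1) (G i (x + 0 *\<^sub>R ?e i))) (at 0 within UNIV)" for x i
    unfolding H_def
  proof (rule leibniz_rule_field_derivative)
    show "(\<lambda>s. (x + t *\<^sub>R ?e i) \<bullet> W (s *\<^sub>R (x + t *\<^sub>R ?e i))) integrable_on cbox 0 1" for t
      by (intro integrable_continuous continuous_intros continuous_on_compose2[OF cW']) auto
    show "continuous_on (UNIV \<times> cbox 0 1) (\<lambda>(t, s). G i (x + t *\<^sub>R ?e i) s)"
      unfolding case_prod_unfold G_def
      by (intro continuous_intros continuous_on_compose2[OF cW(1)] continuous_on_compose2[OF cW(2)]) auto
  qed (use dK in auto)
  have int: "integral (cbox 0 1) (G i x) = W x $ i" for i x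
  proof -
    have "(G i x has_integral (1 * W (1 *\<^sub>R x) $ i - 0 * W (0 *\<^sub>R x) $ i)) {0..1}"
    proof (rule fundamental_theorem_of_calculus)
      fix s :: real
      have "((\<lambda>s. W (0 + s *\<^sub>R x) $ i) has_real_derivative grad (\<lambda>x. W x $ i) (0 + s *\<^sub>R x) \<bullet> x) (at s within {0..1})"
        by (rule has_real_derivative_line[OF C_1D(5)[OF C1]])
      then have "((\<lambda>s. W (s *\<^sub>R x) $ i) has_real_derivative x $ 1 * ?d i 1 (s *\<^sub>R x) + x $ 2 * ?d i 2 (s *\<^sub>R x)) (at s within {0..1})"
        by (simp add: inner_vec_def sum_2 closed[of i] mult.commute)
      then have "((\<lambda>s. s * W (s *\<^sub>R x) $ i) has_real_derivative G i x s) (at s within {0..1})"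
        by (auto intro!: derivative_eq_intros simp: G_def)
      then show "((\<lambda>s. s * W (s *\<^sub>R x) $ i) has_vector_derivative G i x s) (at s within {0..1})"
        by (simp add: has_real_derivative_iff_has_vector_derivative)
    qed auto
    then show ?thesis by (simp add: integral_unique)
  qed
  have *: "((\<lambda>t. H (x + t *\<^sub>R ?e i)) has_real_derivative W x $ i) (at 0)" for x i
    using leib[of x i] int by simp
  show thesis
  proof
    show "C_k 1 H" by (rule C_1_partialsI(1)[OF * cW(1)])
    show "grad H = W"
      using C_1_partialsI(2)[OF * cW(1)] by (simp add: fun_eq_iff vec_eq_iff)
  qed
qed

section \<open>Correctors from time averages along orbits\<close>

locale planar_flow = solenoidal_field V + lipschitz_flow V L M
  for V :: "real^2 \<Rightarrow> real^2" and L M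
begin

lemma orbit_integrable: "0 \<le> a \<Longrightarrow> (\<lambda>s. p \<bullet> X s x) integrable_on {a..b}"
  by (intro integrable_continuous_interval continuous_intros continuous_on_subset[OF X_continuous_time]) auto

lemma averaged_corrector:
  assumes T: "T > 0" and e: "e > 0"
  obtains \<phi> where "\<phi> \<in> C_k_torus 1"
    "\<And>x. \<bar>V x \<bullet> (p + grad \<phi> x) - p \<bullet> (X T x - x) / T\<bar> \<le> e"
proof -
  define P where "P = (\<lambda>x. integral {0..T} (\<lambda>s. p \<bullet> X s x) / T)"
  define K where "K = norm p * exp (L * T)"
  have K: "K \<ge> 0" by (simp add: K_def)
  have Cauchy: "\<bar>p \<bullet> y\<bar> \<le> norm p * r" if "norm y \<le> r" for y r
    using Cauchy_Schwarz_ineq2[of p y] mult_left_mono[OF that, of "norm p"] by simp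
  have int_bound: "\<bar>integral {a..b} f - (b - a) * c\<bar> \<le> (b - a) * r"
    if "f integrable_on {a..b}" "a \<le> b" "\<And>s. s \<in> {a..b} \<Longrightarrow> \<bar>f s - c\<bar> \<le> r" for f and a b c r :: real
  proof -
    have "norm (integral {a..b} (\<lambda>s. f s - c)) \<le> integral {a..b} (\<lambda>s. r)"
      by (intro integral_norm_bound_integral integrable_diff that) (use that in auto)
    also have "integral {a..b} (\<lambda>s. f s - c) = integral {a..b} f - (b - a) * c"
      using that by (subst integral_diff) auto
    finally show ?thesis using that(2) by simp
  qed
  have P_lip: "\<bar>P x - P y\<bar> \<le> K * norm (x - y)" for x y
  proof -
    have "\<bar>integral {0..T} (\<lambda>s. p \<bullet> X s x - p \<bullet> X s y) - (T - 0) * 0\<bar> \<le> (T - 0) * (K * norm (x - y))"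
    proof (rule int_bound)
      fix s assume s: "s \<in> {0..T}"
      have "norm (X s x - X s y) \<le> exp (L * s) * norm (x - y)"
        using s by (intro X_lipschitz) auto
      also have "\<dots> \<le> exp (L * T) * norm (x - y)"
        using s L_pos by (intro mult_right_mono) auto
      finally show "\<bar>p \<bullet> X s x - p \<bullet> X s y - 0\<bar> \<le> K * norm (x - y)"
        using Cauchy by (simp add: inner_diff_right[symmetric] K_def mult.assoc)
    qed (use T in \<open>auto intro!: integrable_diff orbit_integrable\<close>)
    moreover have "integral {0..T} (\<lambda>s. p \<bullet> X s x - p \<bullet> X s y) = T * (P x - P y)"
      using T by (simp add: P_def integral_diff orbit_integrable right_diff_distrib)
    ultimately show ?thesis
      using T by (simp add: abs_mult)
  qed
  have cP: "continuous_on UNIV P"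
    by (rule lipschitz_on_continuous_on[of K]) (use P_lip K in \<open>auto intro!: lipschitz_onI simp: dist_norm\<close>)
  have P_shift: "P (x + k) = P x + p \<bullet> k" if k: "\<And>i. k $ i \<in> \<int>" for x k
  proof -
    have "integral {0..T} (\<lambda>s. p \<bullet> X s (x + k)) = integral {0..T} (\<lambda>s. p \<bullet> X s x + p \<bullet> k)"
      by (rule integral_cong) (simp add: X_shift[OF k] inner_add_right)
    also have "\<dots> = integral {0..T} (\<lambda>s. p \<bullet> X s x) + T * (p \<bullet> k)"
      using T by (subst integral_add) (auto intro!: orbit_integrable)
    finally show ?thesis
      using T by (simp add: P_def add_divide_distrib)
  qed
  \<comment> \<open>Flowing for time \<open>t\<close> shifts the window of integration, so the two
    averages differ only by integrals over \<open>{T..T + t}\<close> and \<open>{0..t}\<close>. On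
    these short intervals the integrands stay within \<open>norm p * (M * t)\<close> of their values
    at \<open>T\<close> and at 0.\<close>
  have P_flow: "\<bar>P (X t z) - P z - t * (p \<bullet> (X T z - z) / T)\<bar> \<le> t * (2 * norm p * M / T * t)" if t: "t > 0" for t z
  proof -
    let ?k = "\<lambda>s. p \<bullet> X s z"
    have "integral {0..T} (\<lambda>s. p \<bullet> X s (X t z)) = integral {0..T} (?k \<circ> (+) t)"
      by (rule integral_cong) (use t in \<open>simp add: X_add\<close>)
    also have "\<dots> = integral {t..T + t} ?k"
      using integral_shift_Icc_real[of 0 T ?k t] by simp
    finally have 1: "T * P (X t z) = integral {t..T + t} ?k"
      using T by (simp add: P_def)
    have 2: "T * P z = integral {0..T} ?k"
      using T by (simp add: P_def)
    have "integral {0..t} ?k + integral {t..T + t} ?k = integral {0..T + t} ?k"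
      "integral {0..T} ?k + integral {T..T + t} ?k = integral {0..T + t} ?k"
      using T t by (intro Henstock_Kurzweil_Integration.integral_combine orbit_integrable; simp)+
    then have "T * (P (X t z) - P z) = integral {T..T + t} ?k - integral {0..t} ?k"
      using 1 2 by (simp add: right_diff_distrib)
    moreover have "\<bar>integral {T..T + t} ?k - (T + t - T) * (p \<bullet> X T z)\<bar> \<le> (T + t - T) * (norm p * (M * t))"
    proof (rule int_bound)
      fix s assume s: "s \<in> {T..T + t}"
      have "norm (X s z - X T z) \<le> M * (s - T)"
        using s T by (intro X_speed) auto
      also have "\<dots> \<le> M * t" using s M_pos by simp
      finally show "\<bar>p \<bullet> X s z - p \<bullet> X T z\<bar> \<le> norm p * (M * t)"
        using Cauchy by (simp add: inner_diff_right[symmetric])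
    qed (use T t in \<open>auto intro!: orbit_integrable\<close>)
    moreover have "\<bar>integral {0..t} ?k - (t - 0) * (p \<bullet> z)\<bar> \<le> (t - 0) * (norm p * (M * t))"
    proof (rule int_bound)
      fix s assume s: "s \<in> {0..t}"
      have "norm (X s z - X 0 z) \<le> M * (s - 0)"
        using s T by (intro X_speed) auto
      also have "\<dots> \<le> M * t" using s M_pos by simp
      finally show "\<bar>p \<bullet> X s z - p \<bullet> z\<bar> \<le> norm p * (M * t)"
        using Cauchy by (simp add: inner_diff_right[symmetric])
    qed (use T t in \<open>auto intro!: orbit_integrable\<close>)
    ultimately have "\<bar>T * (P (X t z) - P z) - t * (p \<bullet> (X T z - z))\<bar> \<le> 2 * (t * (norm p * (M * t)))"
      by (simp add: inner_diff_right right_diff_distrib)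
    also have "T * (P (X t z) - P z) - t * (p \<bullet> (X T z - z)) = T * (P (X t z) - P z - t * (p \<bullet> (X T z - z) / T))"
      using T by (simp add: field_simps)
    also have "\<bar>\<dots>\<bar> = T * \<bar>P (X t z) - P z - t * (p \<bullet> (X T z - z) / T)\<bar>"
      using T by (simp add: abs_mult)
    finally show ?thesis
      using T by (simp add: field_simps)
  qed
  have tangent: "norm (X t z - (z + t *\<^sub>R V x)) \<le> t * (L * norm (z - x) + L * M * t)" if t: "t > 0" for t z x
  proof -
    have "norm ((X t z - t *\<^sub>R V x) - (X 0 z - 0 *\<^sub>R V x)) \<le> (L * norm (z - x) + L * M * t) * t - (L * norm (z - x) + L * M * t) * 0"
    proof (rule differentiable_bound_general[OF t])
      show "continuous_on {0..t} (\<lambda>t. X t z - t *\<^sub>R V x)"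
        by (intro continuous_intros continuous_on_subset[OF X_continuous_time]) auto
      show "((\<lambda>t. X t z - t *\<^sub>R V x) has_vector_derivative V (X s z) - V x) (at s)" if "0 < s" for s
        using solution_at[OF X_solution that, of z] by (auto intro!: derivative_eq_intros)
      show "((\<lambda>s. (L * norm (z - x) + L * M * t) * s) has_vector_derivative L * norm (z - x) + L * M * t) (at s)" for s
        by (auto intro!: derivative_eq_intros simp: has_real_derivative_iff_has_vector_derivative[symmetric])
      show "norm (V (X s z) - V x) \<le> L * norm (z - x) + L * M * t" if "0 < s" "s < t" for s
      proof -
        have "norm (X s z - X 0 z) \<le> M * (s - 0)"
          using that by (intro X_speed) auto
        also have "\<dots> \<le> M * t" using that M_pos by simp
        finally have "norm (X s z - x) \<le> M * t + norm (z - x)"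
          using norm_triangle_ineq[of "X s z - z" "z - x"] by simp
        then show ?thesis
          using lipschitz[of "X s z" x] mult_left_mono[of "norm (X s z - x)" "M * t + norm (z - x)" L] L_pos
          by (simp add: algebra_simps)
      qed
    qed (intro continuous_intros)
    then show ?thesis by (simp add: algebra_simps)
  qed
  \<comment> \<open>\<open>C1\<close> collects the errors linear in \<open>t\<close>, per unit of
    \<open>h\<close>; its factor 2 reflects that the average reaches points at distance up to
    \<open>2 * h\<close>. \<open>C2\<close> collects the errors quadratic in \<open>t\<close>. Only
    \<open>C1 * h\<close> survives in the derivative, so \<open>h\<close> is chosen to make it at
    most \<open>e\<close>.\<close>
  define C1 where "C1 = 2 * (K * L + norm p * (exp (L * T) + 1) / T)"
  define C2 where "C2 = K * L * M + 2 * norm p * M / T"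
  have C1: "C1 \<ge> 0"
    unfolding C1_def using K L_pos T by (intro mult_nonneg_nonneg add_nonneg_nonneg divide_nonneg_nonneg) auto
  define g where "g = (\<lambda>x. p \<bullet> (X T x - x) / T)"
  define h where "h = e / (C1 + 1)"
  have h: "h > 0" "C1 * h \<le> e"
    using C1 e by (auto simp: h_def field_simps)
  have main: "\<bar>P (z + t *\<^sub>R V x) - P z - t * g x\<bar> \<le> t * (C1 * h + C2 * t)"
    if t: "t > 0" and z: "norm (z - x) \<le> 2 * h" for t z x
  proof -
    have "\<bar>P (z + t *\<^sub>R V x) - P (X t z)\<bar> \<le> K * (t * (L * norm (z - x) + L * M * t))"
      using P_lip[of "z + t *\<^sub>R V x" "X t z"] mult_left_mono[OF tangent[OF t, of z x] K]
      by (simp add: norm_minus_commute)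
    also have "\<dots> \<le> K * (t * (L * (2 * h) + L * M * t))"
      using z K t L_pos M_pos by (intro mult_left_mono add_mono) auto
    finally have 1: "\<bar>P (z + t *\<^sub>R V x) - P (X t z)\<bar> \<le> t * (K * L * 2 * h + K * L * M * t)"
      by (simp add: algebra_simps)
    have "norm ((X T z - z) - (X T x - x)) \<le> norm (X T z - X T x) + norm (z - x)"
      using norm_triangle_ineq4[of "X T z - X T x" "z - x"] by (simp add: algebra_simps)
    also have "\<dots> \<le> (exp (L * T) + 1) * norm (z - x)"
      using X_lipschitz[of T z x] T by (simp add: algebra_simps)
    also have "\<dots> \<le> (exp (L * T) + 1) * (2 * h)"
      using z by (intro mult_left_mono) auto
    finally have "\<bar>p \<bullet> ((X T z - z) - (X T x - x))\<bar> / T \<le> norm p * ((exp (L * T) + 1) * (2 * h)) / T"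
      using T by (intro divide_right_mono Cauchy) auto
    then have "\<bar>g z - g x\<bar> \<le> norm p * ((exp (L * T) + 1) * (2 * h)) / T"
      using T by (simp add: g_def inner_diff_right diff_divide_distrib[symmetric] abs_divide)
    then have "t * \<bar>g z - g x\<bar> \<le> t * (norm p * ((exp (L * T) + 1) * (2 * h)) / T)"
      using t by (intro mult_left_mono) auto
    then have 2: "\<bar>t * g z - t * g x\<bar> \<le> t * (norm p * (exp (L * T) + 1) / T * 2 * h)"
      using t by (simp add: abs_mult right_diff_distrib[symmetric] mult_ac)
    have abs3: "\<bar>u + v + w\<bar> \<le> a + b + c" if "\<bar>u\<bar> \<le> a" "\<bar>v\<bar> \<le> b" "\<bar>w\<bar> \<le> c" for u v w a b c :: real
      using that by linarith
    have "P (z + t *\<^sub>R V x) - P z - t * g x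
        = (P (z + t *\<^sub>R V x) - P (X t z)) + (P (X t z) - P z - t * g z) + (t * g z - t * g x)"
      by simp
    also have "\<bar>\<dots>\<bar> \<le> t * (K * L * 2 * h + K * L * M * t)
        + t * (2 * norm p * M / T * t) + t * (norm p * (exp (L * T) + 1) / T * 2 * h)"
      by (rule abs3[OF 1 _ 2]) (use P_flow[OF t, of z] in \<open>simp add: g_def\<close>)
    also have "\<dots> = t * (C1 * h + C2 * t)"
      by (simp add: C1_def C2_def algebra_simps)
    finally show ?thesis .
  qed
  define Q where "Q = mollify h P"
  have Q1: "C_k 1 Q"
    unfolding Q_def by (rule mollify_C_1[OF cP h(1)])
  have Q: "\<bar>V x \<bullet> grad Q x - g x\<bar> \<le> e" for x
  proof -
    have "\<bar>grad Q (x + 0 *\<^sub>R V x) \<bullet> V x - g x\<bar> \<le> C1 * h"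
    proof (rule real_derivative_approx[where b = C2])
      show "((\<lambda>t. Q (x + t *\<^sub>R V x)) has_real_derivative grad Q (x + 0 *\<^sub>R V x) \<bullet> V x) (at 0)"
        by (rule has_real_derivative_line[OF C_1D(5)[OF Q1]])
      fix t :: real assume t: "t > 0"
      have "\<bar>mollify h (\<lambda>z. P (z + t *\<^sub>R V x) - P z) x - t * g x\<bar> \<le> t * (C1 * h + C2 * t)"
        by (rule mollify_close[OF _ h(1)])
          (auto intro!: main t continuous_intros continuous_on_compose2[OF cP])
      then show "\<bar>Q (x + t *\<^sub>R V x) - Q (x + 0 *\<^sub>R V x) - t * g x\<bar> \<le> t * (C1 * h + C2 * t)"
        unfolding Q_def by (simp add: mollify_diff[OF cP h(1)])
    qed
    then show ?thesis using h(2) by (simp add: inner_commute)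
  qed
  show thesis
  proof
    let ?\<phi> = "\<lambda>x. Q x - p \<bullet> x"
    \<comment> \<open>Because \<open>X s (x + k) = X s x + k\<close>, a lattice shift by
      \<open>k\<close> adds \<open>p \<bullet> k\<close> to \<open>P\<close> and to its average.
      Subtracting \<open>p \<bullet> x\<close> restores periodicity.\<close>
    have "Q (x + k) = Q x + p \<bullet> k" if k: "\<And>i. k $ i \<in> \<int>" for x k
    proof -
      have "\<bar>mollify h (\<lambda>z. P (z + k) - P z) x - p \<bullet> k\<bar> \<le> 0"
        by (rule mollify_close[OF _ h(1)]) (simp_all add: P_shift[OF k])
      then show ?thesis
        using mollify_diff[OF cP h(1), of x k] by (simp add: Q_def)
    qed
    then have "torus_periodic ?\<phi>"
      by (intro torus_periodicI) (simp add: inner_add_right)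
    then show "?\<phi> \<in> C_k_torus 1"
      unfolding C_k_torus_def using C_1_diff[OF Q1 grad_inner_left(1)] by simp
    show "\<bar>V x \<bullet> (p + grad ?\<phi> x) - p \<bullet> (X T x - x) / T\<bar> \<le> e" for x
      using Q[of x] unfolding grad_diff[OF Q1 grad_inner_left(1)] grad_inner_left(2) g_def by simp
  qed
qed

text \<open>If no point drifted that far in time \<open>T\<close>, the averaged corrector with error
  half the gap would compete in the infimum with a value strictly below it.\<close>

lemma exists_drifting_point:
  assumes "b < inviscid_constant V p" "T > 0"
  shows "\<exists>x. p \<bullet> (X T x - x) \<ge> b * T"
proof (rule ccontr)
  assume "\<not> ?thesis"
  then have *: "p \<bullet> (X T x - x) / T \<le> b" for x
    using assms(2) by (simp add: not_le divide_le_eq less_imp_le)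
  define e where "e = (inviscid_constant V p - b) / 2"
  have "e > 0" using assms(1) by (simp add: e_def)
  then obtain \<phi> where \<phi>: "\<phi> \<in> C_k_torus 1" "\<And>x. \<bar>V x \<bullet> (p + grad \<phi> x) - p \<bullet> (X T x - x) / T\<bar> \<le> e"
    using averaged_corrector[OF assms(2), of e p] by blast
  have "inviscid_constant V p \<le> b + e"
  proof (rule inviscid_constant_le[OF \<phi>(1)])
    show "V x \<bullet> (p + grad \<phi> x) \<le> b + e" for x
      using \<phi>(2)[of x] *[of x] by linarith
  qed
  then show False
    using assms(1) by (simp add: e_def field_simps)
qed

end

section \<open>Recurrence and closed orbits\<close>

context planar_flow
begin

text \<open>A large drift over \<open>{0..n}\<close> does not control intermediate times. Restarting
  the orbit at the minimum \<open>s\<close> of \<open>p \<bullet> X s x - b * s\<close> does, up to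
  time \<open>n - s\<close>. The surplus of \<open>b'\<close> over \<open>b\<close> must be gained
  after \<open>s\<close>, at a rate of at most \<open>N\<close>, so \<open>n - s\<close> is at least
  \<open>n * r\<close>. Shifting the restart points into the unit cell and passing to a limit
  removes the time horizon.\<close>

lemma persistent_drift:
  assumes "b < inviscid_constant V p"
  obtains x where "\<And>t. t \<ge> 0 \<Longrightarrow> p \<bullet> (X t x - x) \<ge> b * t"
proof -
  obtain b' where b': "b < b'" "b' < inviscid_constant V p"
    using dense[OF assms] by blast
  define N where "N = norm p * M + \<bar>b\<bar> + 1"
  have N: "N > 0"
    unfolding N_def using M_pos by (simp add: add_nonneg_pos)
  define r where "r = (b' - b) / N"
  have r: "r > 0" using b' N by (simp add: r_def)
  have "\<exists>y\<in>cbox 0 1. \<forall>t. 0 \<le> t \<and> t \<le> real n * r \<longrightarrow> p \<bullet> (X t y - y) \<ge> b * t" for n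
  proof (cases "n = 0")
    case True
    have "(0 :: real^2) \<in> cbox 0 1" by (simp add: mem_box_cart)
    then show ?thesis using True by (intro bexI[of _ 0]) auto
  next
    case False
    then obtain x where x: "p \<bullet> (X (real n) x - x) \<ge> b' * real n"
      using exists_drifting_point[OF b'(2), of "real n"] by auto
    define f where "f = (\<lambda>s. p \<bullet> X s x - b * s)"
    have "continuous_on {0..real n} f"
      unfolding f_def by (intro continuous_intros continuous_on_subset[OF X_continuous_time]) auto
    then obtain s where s: "s \<in> {0..real n}" "\<And>t. t \<in> {0..real n} \<Longrightarrow> f s \<le> f t"
      using continuous_attains_inf[of "{0..real n}" f] by auto
    have "(b' - b) * real n \<le> f (real n) - f 0"
      using x by (simp add: f_def inner_diff_right algebra_simps)
    also have "\<dots> \<le> f (real n) - f s"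
      using s(2)[of 0] by simp
    also have "\<dots> = p \<bullet> (X (real n) x - X s x) - b * (real n - s)"
      by (simp add: f_def inner_diff_right algebra_simps)
    also have "\<dots> \<le> norm p * (M * (real n - s)) + \<bar>b\<bar> * (real n - s)"
    proof -
      have "p \<bullet> (X (real n) x - X s x) \<le> norm p * norm (X (real n) x - X s x)"
        by (rule norm_cauchy_schwarz)
      also have "\<dots> \<le> norm p * (M * (real n - s))"
        using s(1) by (intro mult_left_mono X_speed) auto
      finally have "p \<bullet> (X (real n) x - X s x) \<le> norm p * (M * (real n - s))" .
      moreover have "- b * (real n - s) \<le> \<bar>b\<bar> * (real n - s)"
        using s(1) by (intro mult_right_mono) auto
      ultimately show ?thesis by simp
    qed
    also have "\<dots> \<le> N * (real n - s)"
      using s(1) by (simp add: N_def algebra_simps)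
    finally have sn: "real n * r \<le> real n - s"
      using N by (simp add: r_def field_simps)
    obtain k where k: "\<And>i. k $ i \<in> \<int>" "X s x + k \<in> cbox 0 1"
      using torus_representative by blast
    have "p \<bullet> (X t (X s x + k) - (X s x + k)) \<ge> b * t" if t: "0 \<le> t" "t \<le> real n * r" for t
    proof -
      have "X t (X s x + k) - (X s x + k) = X (s + t) x - X s x"
        using X_shift[OF k(1) t(1)] X_add[of s t x] s(1) t(1) by simp
      moreover have "f s \<le> f (s + t)"
        using s(1) t sn by (intro s(2)) auto
      ultimately show ?thesis
        by (simp add: f_def inner_diff_right algebra_simps)
    qed
    then show ?thesis using k(2) by blast
  qed
  then obtain y where y: "\<And>n. y n \<in> cbox 0 1"
    "\<And>n t. 0 \<le> t \<Longrightarrow> t \<le> real n * r \<Longrightarrow> p \<bullet> (X t (y n) - y n) \<ge> b * t"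
    by metis
  obtain l \<sigma> where \<sigma>: "strict_mono \<sigma>" "(\<lambda>n. y (\<sigma> n)) \<longlonglongrightarrow> l"
    by (rule seq_compactE[OF compact_imp_seq_compact[OF compact_cbox], of y 0 1]) (simp_all add: y(1) o_def)
  show thesis
  proof
    fix t :: real assume t: "t \<ge> 0"
    obtain n0 :: nat where n0: "t \<le> real n0 * r"
      using ex_less_of_nat_mult[OF r, of t] less_imp_le by blast
    have "(\<lambda>n. p \<bullet> (X t (y (\<sigma> n)) - y (\<sigma> n))) \<longlonglongrightarrow> p \<bullet> (X t l - l)"
      using t by (intro tendsto_intros X_tendsto \<sigma>(2)) auto
    then show "b * t \<le> p \<bullet> (X t l - l)"
    proof (rule tendsto_lowerbound)
      have "b * t \<le> p \<bullet> (X t (y (\<sigma> n)) - y (\<sigma> n))" if "n \<ge> n0" for n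
      proof (rule y(2)[OF t])
        have "real n0 \<le> real (\<sigma> n)"
          using strict_mono_imp_increasing[OF \<sigma>(1), of n] that by simp
        then show "t \<le> real (\<sigma> n) * r"
          using n0 r by (meson mult_right_mono less_imp_le order_trans)
      qed
      then show "\<forall>\<^sub>F n in sequentially. b * t \<le> p \<bullet> (X t (y (\<sigma> n)) - y (\<sigma> n))"
        unfolding eventually_sequentially by blast
    qed simp
  qed
qed

text \<open>The rotated field \<open>W\<close> is closed because \<open>V\<close> is divergence
  free, so it has a potential. The increments of this potential over the two periods are constants,
  forming \<open>a\<close>; the potential minus \<open>a \<bullet> x\<close> is periodic, its
  gradient \<open>W - a\<close> has mean zero, and the zero mean of \<open>V\<close> forces
  \<open>a = 0\<close>.\<close>

lemma stream_function_exists: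
  obtains H where "C_k 1 H" "torus_periodic H" "\<And>x. grad H x $ 1 = V x $ 2" "\<And>x. grad H x $ 2 = - V x $ 1"
proof -
  define W where "W = (\<lambda>x. \<chi> i::2. if i = 1 then V x $ 2 else -1 * V x $ 1)"
  have W1: "C_k 1 (\<lambda>x. W x $ i)" for i
    using exhaust_2[of i] C_1[of 2] C_1_cmult[OF C_1[of 1], of "-1"] by (auto simp: W_def simp del: C_k.simps)
  have pd: "partial_deriv i (\<lambda>x. -1 * V x $ 1) x = - partial_deriv i (\<lambda>x. V x $ 1) x" for i x
    using partial_deriv_mult[OF grad_const(1)[of "-1"] C_1[of 1], of i x] by simp
  have "partial_deriv 1 (\<lambda>x. W x $ 2) x = partial_deriv 2 (\<lambda>x. W x $ 1) x" for x
    using divergence_free[of x] by (simp add: W_def pd[simplified] divergence_def sum_2)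
  then have "partial_deriv i (\<lambda>x. W x $ j) x = partial_deriv j (\<lambda>x. W x $ i) x" for i j x
    using exhaust_2[of i] exhaust_2[of j] by auto
  from potential_exists[OF W1 this] obtain H where H: "C_k 1 H" "grad H = W" by blast
  have Wp: "W (x + axis i 1) = W x" for x i
  proof -
    have "V (x + axis i 1) = V x"
      by (rule torus_periodicD[OF periodic]) (simp add: axis_def)
    then show ?thesis unfolding W_def by (simp cong del: if_weak_cong)
  qed
  have shift: "H (x + axis i 1) - H x = H (axis i 1) - H 0" for x i
  proof -
    have "((\<lambda>x. H (x + axis i 1)) has_derivative (\<lambda>h. grad H (x + axis i 1) \<bullet> h)) (at x)" for x
      by (rule has_derivative_compose[OF _ C_1D(1)[OF H(1)], where f = "\<lambda>x. x + axis i 1"])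
        (auto intro!: derivative_eq_intros)
    from has_derivative_diff[OF this C_1D(1)[OF H(1)]]
    have "((\<lambda>x. H (x + axis i 1) - H x) has_derivative (\<lambda>h. 0)) (at x within UNIV)" for x
      by (simp add: H(2) Wp)
    then have "\<exists>c. \<forall>x\<in>UNIV. H (x + axis i 1) - H x = c"
      by (intro has_derivative_zero_constant) auto
    then show ?thesis
      by (metis UNIV_I add_0)
  qed
  define a where "a = (\<chi> i. H (axis i 1) - H 0)"
  define H' where "H' = (\<lambda>x. H x - a \<bullet> x)"
  have H'1: "C_k 1 H'" and gH': "grad H' = (\<lambda>x. W x - a)"
    unfolding H'_def using C_1_diff[OF H(1) grad_inner_left(1)] grad_diff[OF H(1) grad_inner_left(1)]
    by (auto simp: H(2) grad_inner_left(2))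
  have H'p: "torus_periodic H'"
  proof (rule torus_periodic_axisI)
    show "H' (x + axis i 1) = H' x" for x i
      using shift[of x i] by (simp add: H'_def inner_add_right inner_axis a_def)
  qed
  have "a $ i = 0" for i
  proof -
    have pH': "partial_deriv i H' = (\<lambda>x. W x $ i - a $ i)"
    proof
      show "partial_deriv i H' x = W x $ i - a $ i" for x
        using grad_component[of H' x i] by (simp add: gH')
    qed
    have iV: "V integrable_on cbox 0 1"
      by (intro integrable_continuous continuous_on_subset[OF continuous]) auto
    have iW: "(\<lambda>x. W x $ i) integrable_on cbox 0 1"
      by (intro integrable_continuous continuous_on_subset[OF C_1D(4)[OF W1]]) auto
    have "integral (cbox 0 1) (\<lambda>x. V x $ j) = 0" for j
      using integral_component_eq_cart[OF iV, of j] mean_zero by simp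
    then have "integral (cbox 0 1) (\<lambda>x. W x $ i) = 0"
      using exhaust_2[of i] by (auto simp: W_def)
    moreover have "integral (cbox 0 1) (\<lambda>x. W x $ i - a $ i) = integral (cbox 0 1) (\<lambda>x. W x $ i) - a $ i"
      by (subst integral_diff[OF iW integrable_const]) (simp add: content_unit_cube_cart)
    ultimately show ?thesis
      using integral_partial_deriv_torus[OF H'p H'1, of i] unfolding pH' by simp
  qed
  then have "a = 0"
    by (simp add: vec_eq_iff)
  then have "H' = H"
    by (simp add: H'_def)
  then show thesis
    using that[of H] H H'p by (simp add: W_def)
qed

lemma X_iterate:
  assumes k: "\<And>i. k $ i \<in> \<int>" and \<tau>: "\<tau> \<ge> 0" "X \<tau> x = x + k"
  shows "X (real m * \<tau>) x = x + real m *\<^sub>R k"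
proof (induction m)
  case (Suc m)
  have "X (real (Suc m) * \<tau>) x = X \<tau> (X (real m * \<tau>) x)"
    using X_add[of "real m * \<tau>" \<tau> x] \<tau>(1) by (simp add: algebra_simps)
  also have "\<dots> = X \<tau> x + real m *\<^sub>R k"
    unfolding Suc.IH using k \<tau>(1) by (intro X_shift) auto
  finally show ?case
    using \<tau>(2) by (simp add: algebra_simps)
qed simp

lemma X_reduce:
  assumes k: "\<And>i. k $ i \<in> \<int>" and \<tau>: "\<tau> > 0" "X \<tau> x = x + k" and t: "t \<ge> 0"
  obtains m s where "0 \<le> s" "s < \<tau>" "t = real m * \<tau> + s" "X t x = X s x + real m *\<^sub>R k"
proof -
  define m where "m = nat \<lfloor>t / \<tau>\<rfloor>"
  have m: "real m = of_int \<lfloor>t / \<tau>\<rfloor>"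
    using t \<tau>(1) by (simp add: m_def)
  then have m': "real m \<le> t / \<tau>" "t / \<tau> < real m + 1"
    by linarith+
  define s where "s = t - real m * \<tau>"
  have s: "0 \<le> s" "s < \<tau>"
    using m' \<tau>(1) by (simp_all add: s_def field_simps)
  have "X t x = X s (X (real m * \<tau>) x)"
    using X_add[of "real m * \<tau>" s x] s(1) \<tau>(1) by (simp add: s_def)
  also have "\<dots> = X s x + real m *\<^sub>R k"
    unfolding X_iterate[OF k less_imp_le[OF \<tau>(1)] \<tau>(2)] using k s(1) by (intro X_shift) auto
  finally show thesis
    using s by (intro that[of s m]) (auto simp: s_def)
qed

end

section \<open>Level sets of the stream function and closing of orbits\<close>

lemma perp_multiple:
  fixes p y :: "real^2"
  assumes "p \<bullet> y = 0" "p \<noteq> 0"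
  obtains c where "y = c *\<^sub>R (\<chi> i. if i = 1 then - p $ 2 else p $ 1)"
proof -
  have y: "p $ 1 * y $ 1 + p $ 2 * y $ 2 = 0"
    using assms(1) by (simp add: inner_vec_def sum_2)
  have p: "(p $ 1)\<^sup>2 + (p $ 2)\<^sup>2 \<noteq> 0"
    using assms(2) by (auto simp: vec_eq_iff forall_2 sum_power2_eq_zero_iff)
  define c where "c = (y $ 2 * p $ 1 - y $ 1 * p $ 2) / ((p $ 1)\<^sup>2 + (p $ 2)\<^sup>2)"
  have 1: "((p $ 1)\<^sup>2 + (p $ 2)\<^sup>2) * y $ 1 = - ((y $ 2 * p $ 1 - y $ 1 * p $ 2) * p $ 2)"
    using arg_cong[OF y, of "\<lambda>t. p $ 1 * t"] by (simp add: power2_eq_square algebra_simps)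
  have 2: "((p $ 1)\<^sup>2 + (p $ 2)\<^sup>2) * y $ 2 = (y $ 2 * p $ 1 - y $ 1 * p $ 2) * p $ 1"
    using arg_cong[OF y, of "\<lambda>t. p $ 2 * t"] by (simp add: power2_eq_square algebra_simps)
  have "y $ 1 = - (c * p $ 2)"
    unfolding c_def using 1 p by (simp add: field_simps)
  moreover have "y $ 2 = c * p $ 1"
    unfolding c_def using 2 p by (simp add: field_simps)
  ultimately show thesis
    by (intro that[of c]) (simp add: vec_eq_iff forall_2)
qed

locale hamiltonian_flow = planar_flow V L M for V :: "real^2 \<Rightarrow> real^2" and L M +
  fixes H :: "real^2 \<Rightarrow> real"
  assumes H_C_1: "C_k 1 H" and H_periodic: "torus_periodic H"
    and grad_H: "grad H x $ 1 = V x $ 2" "grad H x $ 2 = - V x $ 1"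
begin

lemma H_shift: "(\<And>i. k $ i \<in> \<int>) \<Longrightarrow> H (x + k) = H x"
  by (rule torus_periodicD[OF H_periodic])

lemma partial_deriv_H: "partial_deriv 1 H x = V x $ 2" "partial_deriv 2 H x = - V x $ 1"
  using grad_H[of x] by simp_all

lemma H_conserved:
  assumes "t \<ge> 0"
  shows "H (X t x) = H x"
proof -
  have "((\<lambda>t. H (X t x)) has_derivative (\<lambda>h. 0)) (at s within {0..})" if "s \<in> {0..}" for s
  proof -
    have "((\<lambda>t. X t x) has_derivative (\<lambda>h. h *\<^sub>R V (X s x))) (at s within {0..})"
      using X_solution[of x] that by (simp add: solution_def has_vector_derivative_def)
    from has_derivative_compose[OF this C_1D(1)[OF H_C_1]] show ?thesis
      by (simp add: inner_vec_def sum_2 partial_deriv_H)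
  qed
  then have "\<exists>c. \<forall>s\<in>{0..}. H (X s x) = c"
    by (intro has_derivative_zero_constant) auto
  then show ?thesis
    using assms X_0 by (metis atLeast_iff order_refl)
qed

text \<open>The vector is \<open>p\<close> rotated by a quarter turn. Where
  \<open>V \<bullet> p\<close> is positive, \<open>H\<close> is thus strictly decreasing in that
  direction.\<close>

lemma grad_H_perp: "grad H x \<bullet> (\<chi> i. if i = 1 then - p $ 2 else p $ 1) = - (V x \<bullet> p)"
  by (simp add: inner_vec_def sum_2 partial_deriv_H)

text \<open>Near a point where \<open>V \<bullet> p\<close> is bounded below, level sets of \<open>H\<close> are transversal to the lines
  orthogonal to \<open>p\<close>, so each of them is locally a single orbit segment.\<close>

lemma orbit_arc:
  assumes \<alpha>: "\<alpha> > 0"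
  obtains r where "r > 0"
    "\<And>z a b. \<alpha> \<le> V z \<bullet> p \<Longrightarrow> norm (a - z) \<le> r \<Longrightarrow> norm (b - z) \<le> r \<Longrightarrow> H a = H b \<Longrightarrow> p \<bullet> a \<le> p \<bullet> b \<Longrightarrow>
      \<exists>s. 0 \<le> s \<and> s \<le> 2 / \<alpha> * (p \<bullet> (b - a)) \<and> X s a = b"
proof -
  \<comment> \<open>Within distance \<open>R\<close> of \<open>z\<close> the Lipschitz bound keeps
    \<open>V \<bullet> p\<close> above \<open>\<alpha> / 2\<close>. The factor \<open>C\<close>
    shrinks \<open>R\<close> to \<open>r\<close> so that an orbit starting within \<open>r\<close>
    stays within \<open>R\<close> during the time \<open>s1\<close>.\<close>
  define R where "R = \<alpha> / (2 * (L * norm p) + 1)"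
  define C where "C = 1 + 4 * norm p * M / \<alpha>"
  define r where "r = R / C"
  have Lp: "2 * (L * norm p) + 1 > 0"
    using L_pos by (simp add: add_nonneg_pos)
  have R: "R > 0" "L * norm p * R \<le> \<alpha> / 2"
    using \<alpha> Lp by (auto simp: R_def field_simps)
  have C: "C > 0"
    unfolding C_def using \<alpha> M_pos by (intro add_pos_nonneg) auto
  have r: "r > 0" "r * C = R"
    using R C by (auto simp: r_def)
  show thesis
  proof (rule that[OF r(1)])
    fix z a b
    assume z: "\<alpha> \<le> V z \<bullet> p" and a: "norm (a - z) \<le> r" and b: "norm (b - z) \<le> r"
      and H: "H a = H b" and le: "p \<bullet> a \<le> p \<bullet> b"
    have near: "V y \<bullet> p \<ge> \<alpha> / 2" if "norm (y - z) \<le> R" for y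
    proof -
      have "\<bar>(V y - V z) \<bullet> p\<bar> \<le> norm (V y - V z) * norm p"
        by (rule Cauchy_Schwarz_ineq2)
      also have "\<dots> \<le> L * R * norm p"
        using order_trans[OF lipschitz mult_left_mono[OF that]] L_pos by (intro mult_right_mono) auto
      also have "\<dots> \<le> \<alpha> / 2" using R(2) by (simp add: mult_ac)
      finally show ?thesis
        using z unfolding inner_diff_left by linarith
    qed
    have p: "p \<noteq> 0" using z \<alpha> by auto
    \<comment> \<open>The height \<open>p \<bullet> X t a\<close> rises at rate at least
      \<open>\<alpha> / 2\<close>, so by time \<open>s1\<close> it has reached the height of
      \<open>b\<close>.\<close>
    define s1 where "s1 = 2 / \<alpha> * (p \<bullet> (b - a))"
    have s1: "s1 \<ge> 0"
      unfolding s1_def using \<alpha> le by (simp add: inner_diff_right)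
    have "norm (b - a) \<le> 2 * r"
      using a b norm_triangle_ineq4[of "b - z" "a - z"] by simp
    then have "p \<bullet> (b - a) \<le> norm p * (2 * r)"
      using norm_cauchy_schwarz[of p "b - a"] by (meson mult_left_mono norm_ge_zero order_trans)
    then have "s1 \<le> 2 / \<alpha> * (norm p * (2 * r))"
      unfolding s1_def using \<alpha> by (intro mult_left_mono) auto
    then have "r + M * s1 \<le> r + M * (2 / \<alpha> * (norm p * (2 * r)))"
      using M_pos by (intro add_left_mono mult_left_mono) auto
    also have "\<dots> = r * C"
      using \<alpha> by (simp add: C_def algebra_simps)
    finally have rs: "r + M * s1 \<le> R" using r(2) by simp
    have orbit: "norm (X t a - z) \<le> R" if "0 \<le> t" "t \<le> s1" for t
    proof -
      have "norm (X t a - z) \<le> norm (X t a - X 0 a) + norm (a - z)"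
        using norm_triangle_ineq[of "X t a - X 0 a" "a - z"] by simp
      also have "norm (X t a - X 0 a) \<le> M * (t - 0)"
        using that by (intro X_speed) auto
      also have "\<dots> \<le> M * s1" using that M_pos by simp
      finally show ?thesis using a rs by linarith
    qed
    have "p \<bullet> X 0 a - \<alpha> / 2 * 0 \<le> p \<bullet> X s1 a - \<alpha> / 2 * s1"
    proof (rule DERIV_nonneg_imp_increasing_open[OF s1])
      fix t assume t: "0 < t" "t < s1"
      have "((\<lambda>t. p \<bullet> X t a - \<alpha> / 2 * t) has_real_derivative p \<bullet> V (X t a) - \<alpha> / 2) (at t)"
        unfolding has_real_derivative_iff_has_vector_derivative has_vector_derivative_def
        using solution_at[OF X_solution t(1), of a]
        by (auto intro!: derivative_eq_intros simp: has_vector_derivative_def algebra_simps)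
      moreover have "p \<bullet> V (X t a) - \<alpha> / 2 \<ge> 0"
        using near[OF orbit[of t]] t by (simp add: inner_commute)
      ultimately show "\<exists>y. ((\<lambda>t. p \<bullet> X t a - \<alpha> / 2 * t) has_real_derivative y) (at t) \<and> y \<ge> 0"
        by blast
    qed (intro continuous_intros continuous_on_subset[OF X_continuous_time], auto)
    moreover have "\<alpha> / 2 * s1 = p \<bullet> (b - a)"
      using \<alpha> by (simp add: s1_def)
    ultimately have "p \<bullet> b \<le> p \<bullet> X s1 a"
      unfolding inner_diff_right X_0 by linarith
    moreover have "continuous_on {0..s1} (\<lambda>t. p \<bullet> X t a)"
      by (intro continuous_intros continuous_on_subset[OF X_continuous_time]) auto
    ultimately obtain s where s: "0 \<le> s" "s \<le> s1" "p \<bullet> X s a = p \<bullet> b"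
      using IVT'[of "\<lambda>t. p \<bullet> X t a" 0 "p \<bullet> b" s1] le s1 by auto
    \<comment> \<open>At equal heights \<open>X s a\<close> and \<open>b\<close> lie on a line
      orthogonal to \<open>p\<close>. They have the same value of \<open>H\<close>, so by the mean
      value theorem \<open>c * (V \<bullet> p)\<close> vanishes somewhere between them; as
      \<open>V \<bullet> p\<close> is positive there, the points coincide.\<close>
    define d where "d = X s a - b"
    have "p \<bullet> d = 0" using s(3) by (simp add: d_def inner_diff_right)
    then obtain c where c: "d = c *\<^sub>R (\<chi> i. if i = 1 then - p $ 2 else p $ 1)"
      using perp_multiple p by blast
    have "r \<le> R" using rs M_pos s1 by (smt (verit) mult_nonneg_nonneg)
    then have bR: "norm (b - z) \<le> R" using b by linarith
    have "\<exists>l>0. l < 1 \<and> H (b + 1 *\<^sub>R d) - H (b + 0 *\<^sub>R d) = (1 - 0) * (grad H (b + l *\<^sub>R d) \<bullet> d)"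
      by (intro MVT2 has_real_derivative_line C_1D(5)[OF H_C_1]) auto
    then obtain l where l: "0 < l" "l < 1" "H (b + d) - H b = grad H (b + l *\<^sub>R d) \<bullet> d"
      by auto
    have "b + d = X s a" by (simp add: d_def)
    then have "H (b + d) = H b"
      using H H_conserved[OF s(1)] by simp
    then have "c * (V (b + l *\<^sub>R d) \<bullet> p) = 0"
      using l(3) grad_H_perp[of "b + l *\<^sub>R d" p] by (simp add: c)
    moreover have "norm (b + l *\<^sub>R d - z) \<le> R"
    proof -
      have "b + l *\<^sub>R d - z = (1 - l) *\<^sub>R (b - z) + l *\<^sub>R (X s a - z)"
        by (simp add: d_def algebra_simps)
      then have "norm (b + l *\<^sub>R d - z) \<le> (1 - l) * norm (b - z) + l * norm (X s a - z)"
        using l norm_triangle_ineq[of "(1 - l) *\<^sub>R (b - z)" "l *\<^sub>R (X s a - z)"] by simp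
      also have "\<dots> \<le> (1 - l) * R + l * R"
        using l bR orbit[OF s(1,2)] by (intro add_mono mult_left_mono) auto
      finally show ?thesis by (simp add: algebra_simps)
    qed
    then have "V (b + l *\<^sub>R d) \<bullet> p > 0"
      using near \<alpha> by (meson half_gt_zero less_le_trans)
    ultimately have "d = 0" using c by simp
    then show "\<exists>s. 0 \<le> s \<and> s \<le> 2 / \<alpha> * (p \<bullet> (b - a)) \<and> X s a = b"
      using s unfolding d_def s1_def by (intro exI[of _ s]) auto
  qed
qed

lemma periodic_orbit_exists:
  assumes b: "b > 0" and drift: "\<And>t. t \<ge> 0 \<Longrightarrow> p \<bullet> (X t x - x) \<ge> b * t"
  obtains y k \<tau> where "\<tau> > 0" "\<And>i. k $ i \<in> \<int>" "X \<tau> y = y + k" "p \<bullet> k \<ge> b * \<tau>" "V y \<bullet> p > 0"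
proof -
  define \<alpha> where "\<alpha> = b / 2"
  have \<alpha>: "\<alpha> > 0" using b by (simp add: \<alpha>_def)
  obtain r where r: "r > 0"
    and arc: "\<And>z a b. \<alpha> \<le> V z \<bullet> p \<Longrightarrow> norm (a - z) \<le> r \<Longrightarrow> norm (b - z) \<le> r \<Longrightarrow> H a = H b \<Longrightarrow> p \<bullet> a \<le> p \<bullet> b \<Longrightarrow>
      \<exists>s. 0 \<le> s \<and> s \<le> 2 / \<alpha> * (p \<bullet> (b - a)) \<and> X s a = b"
    using orbit_arc[OF \<alpha>] by metis
  \<comment> \<open>If \<open>V \<bullet> p\<close> stayed below \<open>\<alpha> = b / 2\<close>
    from some time on, the height would eventually grow at no more than half the rate
    \<open>b\<close> and fall behind the assumed drift.\<close>
  have good: "\<exists>t\<ge>real n. V (X t x) \<bullet> p \<ge> \<alpha>" for n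
  proof (rule ccontr)
    assume "\<not> ?thesis"
    then have less: "V (X t x) \<bullet> p \<le> \<alpha>" if "t \<ge> real n" for t
      using that by (meson linear)
    define C where "C = \<bar>p \<bullet> (X (real n) x - x)\<bar>"
    define t where "t = real n + (C + 1) / \<alpha>"
    have t: "real n \<le> t" using \<alpha> by (simp add: t_def C_def)
    have "p \<bullet> X t x - \<alpha> * t \<le> p \<bullet> X (real n) x - \<alpha> * real n"
    proof (rule DERIV_nonpos_imp_decreasing_open[OF t])
      fix s assume s: "real n < s" "s < t"
      then have s0: "s > 0" using of_nat_0_le_iff[of n] by linarith
      have "((\<lambda>t. p \<bullet> X t x - \<alpha> * t) has_real_derivative p \<bullet> V (X s x) - \<alpha>) (at s)"
        unfolding has_real_derivative_iff_has_vector_derivative has_vector_derivative_def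
        using solution_at[OF X_solution s0, of x]
        by (auto intro!: derivative_eq_intros simp: has_vector_derivative_def algebra_simps)
      moreover have "p \<bullet> V (X s x) - \<alpha> \<le> 0"
        using less[of s] s by (simp add: inner_commute)
      ultimately show "\<exists>y. ((\<lambda>t. p \<bullet> X t x - \<alpha> * t) has_real_derivative y) (at s) \<and> y \<le> 0"
        by blast
    qed (intro continuous_intros continuous_on_subset[OF X_continuous_time], auto)
    moreover have "\<alpha> * (t - real n) = C + 1"
      using \<alpha> by (simp add: t_def)
    ultimately have "p \<bullet> (X t x - x) \<le> 2 * C + 1"
      using abs_ge_self[of "p \<bullet> (X (real n) x - x)"] unfolding C_def
      by (simp add: inner_diff_right right_diff_distrib)
    moreover have "b * t \<ge> 2 * C + 2"
    proof -
      have "b * t = b * real n + 2 * (\<alpha> * ((C + 1) / \<alpha>))"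
        by (simp add: t_def \<alpha>_def algebra_simps)
      also have "\<alpha> * ((C + 1) / \<alpha>) = C + 1" using \<alpha> by simp
      finally show ?thesis using b by simp
    qed
    ultimately show False
      using drift[of t] t of_nat_0_le_iff[of n] by linarith
  qed
  then obtain T where T: "\<And>n. T n \<ge> real n" "\<And>n. V (X (T n) x) \<bullet> p \<ge> \<alpha>"
    by metis
  have T0: "T n \<ge> 0" for n
    using T(1)[of n] of_nat_0_le_iff order_trans by blast
  have "\<forall>n. \<exists>k. (\<forall>i. k $ i \<in> \<int>) \<and> X (T n) x + k \<in> cbox 0 1"
    using torus_representative by meson
  from choice[OF this] obtain k
    where k': "\<forall>n. (\<forall>i. k n $ i \<in> \<int>) \<and> X (T n) x + k n \<in> cbox 0 1" ..
  have k: "k n $ i \<in> \<int>" "X (T n) x + k n \<in> cbox 0 1" for n i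
    using k'[rule_format, of n] by simp_all
  define q where "q = (\<lambda>n. X (T n) x + k n)"
  obtain l \<sigma> where \<sigma>: "strict_mono \<sigma>" "(\<lambda>n. q (\<sigma> n)) \<longlonglongrightarrow> l"
  proof (rule seq_compactE[OF compact_imp_seq_compact[OF compact_cbox], of q 0 1])
    show "\<forall>n. q n \<in> cbox 0 1" using k(2) by (simp add: q_def)
  qed (simp add: o_def)
  obtain n1 where n1: "\<And>n. n \<ge> n1 \<Longrightarrow> norm (q (\<sigma> n) - l) < r / 2"
    using LIMSEQ_D[OF \<sigma>(2), of "r / 2"] r by auto
  \<comment> \<open>\<open>S\<close> bounds the duration of any arc joining two of the selected
    return points. Returns more than \<open>S\<close> apart in time are chosen, so that correcting
    the elapsed time by such an arc leaves a positive period.\<close>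
  define S where "S = 2 / \<alpha> * (norm p * r)"
  have S: "S \<ge> 0" using \<alpha> r by (simp add: S_def)
  obtain n2 where n2: "real n2 > T (\<sigma> n1) + S" "n2 \<ge> n1"
  proof -
    obtain n where "real n > T (\<sigma> n1) + S" using reals_Archimedean2 by blast
    then show thesis by (intro that[of "max n n1"]) auto
  qed
  define s1 s2 where "s1 = T (\<sigma> n1)" and "s2 = T (\<sigma> n2)"
  define A B where "A = q (\<sigma> n1)" and "B = q (\<sigma> n2)"
  define k1 k2 where "k1 = k (\<sigma> n1)" and "k2 = k (\<sigma> n2)"
  have k12: "k1 $ i \<in> \<int>" "k2 $ i \<in> \<int>" for i
    using k(1) by (auto simp: k1_def k2_def)
  have AB: "A = X s1 x + k1" "B = X s2 x + k2"
    by (simp_all add: A_def B_def s1_def s2_def k1_def k2_def q_def)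
  have s: "0 \<le> s1" "0 \<le> s2" "s1 + S < s2"
    using T0 T(1)[of "\<sigma> n2"] n2(1) strict_mono_imp_increasing[OF \<sigma>(1), of n2] by (auto simp: s1_def s2_def)
  have "norm (B - A) \<le> norm (B - l) + norm (A - l)"
    using norm_triangle_ineq4[of "B - l" "A - l"] by simp
  then have dist: "norm (B - A) \<le> r"
    using n1[of n1] n1[OF n2(2)] unfolding A_def B_def by linarith
  have HAB: "H A = H B"
    unfolding AB using H_shift k12 H_conserved s by simp
  have VA: "\<alpha> \<le> V A \<bullet> p"
    unfolding AB using V_shift[OF k12(1)] T(2) by (simp add: s1_def)
  have pAB: "2 / \<alpha> * (p \<bullet> (B - A)) \<le> S" "2 / \<alpha> * (p \<bullet> (A - B)) \<le> S"
  proof -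
    have "\<bar>p \<bullet> (B - A)\<bar> \<le> norm p * norm (B - A)" by (rule Cauchy_Schwarz_ineq2)
    also have "\<dots> \<le> norm p * r" using dist by (intro mult_left_mono) auto
    finally have "p \<bullet> (B - A) \<le> norm p * r" "p \<bullet> (A - B) \<le> norm p * r"
      by (auto simp: inner_diff_right)
    then show "2 / \<alpha> * (p \<bullet> (B - A)) \<le> S" "2 / \<alpha> * (p \<bullet> (A - B)) \<le> S"
      unfolding S_def using \<alpha> by (auto intro!: mult_left_mono divide_right_mono)
  qed
  \<comment> \<open>The arc may lead from the earlier return \<open>A\<close> to the later one
    \<open>B\<close> or the other way. In the first case its duration is subtracted from
    \<open>s2 - s1\<close> and the closed orbit passes through \<open>X s2 x\<close>; in the second
    it is added and the orbit passes through \<open>X s1 x\<close>.\<close>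
  obtain u \<tau> where u: "u \<ge> 0" "\<tau> > 0" "X \<tau> (X u x) = X u x + (k1 - k2)" "V (X u x) \<bullet> p \<ge> \<alpha>"
  proof (cases "p \<bullet> A \<le> p \<bullet> B")
    case True
    then obtain v where v: "0 \<le> v" "v \<le> S" "X v A = B"
      using arc[OF VA, of A B] r dist HAB pAB(1) by fastforce
    define \<tau> where "\<tau> = s2 - s1 - v"
    have \<tau>: "\<tau> > 0" using s v by (simp add: \<tau>_def)
    have 1: "X (s1 + v) x + k1 = X s2 x + k2"
      using v(3) X_shift[OF k12(1) v(1)] X_add[OF s(1) v(1)] by (simp add: AB)
    have 2: "X \<tau> (X (s1 + v) x) = X s2 x"
      using X_add[of "s1 + v" \<tau> x] s v \<tau> by (simp add: \<tau>_def)
    have "X s2 x = X (s1 + v) x + (k1 - k2)"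
      using 1 by (simp add: algebra_simps)
    moreover have "X \<tau> (X (s1 + v) x + (k1 - k2)) = X \<tau> (X (s1 + v) x) + (k1 - k2)"
      using k12 \<tau> by (intro X_shift) auto
    ultimately have "X \<tau> (X s2 x) = X s2 x + (k1 - k2)"
      using 2 by simp
    then show thesis
      using that[OF s(2) \<tau>] T(2) by (simp add: s2_def)
  next
    case False
    then obtain v where v: "0 \<le> v" "v \<le> S" "X v B = A"
      using arc[OF VA, of B A] r dist HAB pAB(2) by fastforce
    define \<tau> where "\<tau> = s2 + v - s1"
    have \<tau>: "\<tau> > 0" using s v S by (simp add: \<tau>_def)
    have "X (s2 + v) x + k2 = X s1 x + k1"
      using v(3) X_shift[OF k12(2) v(1)] X_add[OF s(2) v(1)] by (simp add: AB)
    moreover have "X \<tau> (X s1 x) = X (s2 + v) x"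
      using X_add[of s1 \<tau> x] s \<tau> by (simp add: \<tau>_def)
    ultimately have "X \<tau> (X s1 x) = X s1 x + (k1 - k2)"
      by (simp add: algebra_simps)
    then show thesis
      using that[OF s(1) \<tau>] T(2) by (simp add: s1_def)
  qed
  show thesis
  proof (rule that[OF u(2) _ u(3)])
    show kk: "(k1 - k2) $ i \<in> \<int>" for i using k12 by simp
    show "V (X u x) \<bullet> p > 0" using u(4) \<alpha> by linarith
    \<comment> \<open>A deficit in one turn would be multiplied by the number \<open>m\<close> of
      turns and finally contradict the drift of the original orbit.\<close>
    show "p \<bullet> (k1 - k2) \<ge> b * \<tau>"
    proof (rule ccontr)
      assume "\<not> ?thesis"
      then have "b * \<tau> - p \<bullet> (k1 - k2) > 0" by simp
      then obtain m :: nat where m: "p \<bullet> (X u x - x) - b * u < real m * (b * \<tau> - p \<bullet> (k1 - k2))"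
        using ex_less_of_nat_mult by blast
      have "X (u + real m * \<tau>) x = X u x + real m *\<^sub>R (k1 - k2)"
        using X_add[of u "real m * \<tau>" x] X_iterate[OF kk _ u(3)] u(1,2) by simp
      then have "b * (u + real m * \<tau>) \<le> p \<bullet> (X u x + real m *\<^sub>R (k1 - k2) - x)"
        using drift[of "u + real m * \<tau>"] u(1,2) by simp
      then show False
        using m by (simp add: inner_diff_right inner_add_right algebra_simps)
    qed
  qed
qed

end

section \<open>Invariant bump functions and the lower bound\<close>

text \<open>Squaring removes the corner of the positive part at 0; this is the cheapest continuously
  differentiable truncation.\<close>

lemma C_1_max_0_power2:
  fixes u :: "real^'n \<Rightarrow> real"
  assumes "C_k 1 u"
  shows "C_k 1 (\<lambda>x. (max 0 (u x))\<^sup>2)" "grad (\<lambda>x. (max 0 (u x))\<^sup>2) = (\<lambda>x. (2 * max 0 (u x)) *\<^sub>R grad u x)"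
proof -
  have der: "((\<lambda>s. (max 0 s)\<^sup>2) has_real_derivative 2 * max 0 s) (at s)" for s :: real
  proof -
    consider "s < 0" | "s > 0" | "s = 0" by linarith
    then show ?thesis
    proof cases
      case 1
      have "((\<lambda>_. 0) has_real_derivative 2 * max 0 s) (at s)"
        using 1 by simp
      then show ?thesis
        by (rule has_field_derivative_transform_within_open[of _ _ _ "{..<0}"]) (use 1 in auto)
    next
      case 2
      have "((\<lambda>s. s\<^sup>2) has_real_derivative 2 * max 0 s) (at s)"
        using 2 by (auto intro!: derivative_eq_intros)
      then show ?thesis
        by (rule has_field_derivative_transform_within_open[of _ _ _ "{0<..}"]) (use 2 in auto)
    next
      case 3
      have "((\<lambda>h. (max 0 h)\<^sup>2 / h) \<longlongrightarrow> 0) (at (0::real))"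
      proof (rule Lim_null_comparison)
        show "\<forall>\<^sub>F h in at (0::real). norm ((max 0 h)\<^sup>2 / h) \<le> \<bar>h\<bar>"
          by (intro always_eventually allI) (auto simp: max_def power2_eq_square)
        show "((\<lambda>h. \<bar>h\<bar>) \<longlongrightarrow> 0) (at (0::real))"
          using tendsto_rabs[OF tendsto_ident_at[of "0::real" UNIV]] by simp
      qed
      then show ?thesis
        using 3 by (simp add: has_field_derivative_def[symmetric] DERIV_def)
    qed
  qed
  have "((\<lambda>x. (max 0 (u x))\<^sup>2) has_derivative (\<lambda>h. ((2 * max 0 (u x)) *\<^sub>R grad u x) \<bullet> h)) (at x)" for x
    using has_derivative_compose[OF C_1D(1)[OF assms] der[unfolded has_field_derivative_def]] by simp
  moreover have "continuous_on UNIV (\<lambda>x. (2 * max 0 (u x)) *\<^sub>R grad u x)"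
    by (intro continuous_intros C_1D(2)[OF assms] C_1D(4)[OF assms])
  ultimately show "C_k 1 (\<lambda>x. (max 0 (u x))\<^sup>2)" "grad (\<lambda>x. (max 0 (u x))\<^sup>2) = (\<lambda>x. (2 * max 0 (u x)) *\<^sub>R grad u x)"
    by (rule C_1I)+
qed

text \<open>Differentiability and continuity of the gradient are local, so they may be checked
  separately on the two open sets covering the space. This keeps a bump on one family of orbits and
  discards it on other parts of the same level sets.\<close>

lemma C_1_cut_off:
  fixes f :: "real^'n \<Rightarrow> real"
  assumes f: "C_k 1 f" and U: "open U" and N: "open N" "U \<union> N = UNIV"
    and 0: "\<And>x. x \<in> U \<inter> N \<Longrightarrow> f x = 0 \<and> grad f x = 0"
  shows "C_k 1 (\<lambda>x. if x \<in> U then f x else 0)"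
    "grad (\<lambda>x. if x \<in> U then f x else 0) = (\<lambda>x. if x \<in> U then grad f x else 0)"
proof -
  let ?w = "\<lambda>x. if x \<in> U then f x else 0" and ?g = "\<lambda>x. if x \<in> U then grad f x else 0"
  have "(?w has_derivative (\<lambda>h. ?g x \<bullet> h)) (at x)" for x
  proof (cases "x \<in> U")
    case True
    then have "(f has_derivative (\<lambda>h. ?g x \<bullet> h)) (at x)"
      using C_1D(1)[OF f, of x] by simp
    then show ?thesis
      by (rule has_derivative_transform_within_open[OF _ U True]) auto
  next
    case False
    then have "x \<in> N" using N(2) by auto
    have "((\<lambda>x. 0) has_derivative (\<lambda>h. ?g x \<bullet> h)) (at x)"
      using False by simp
    then show ?thesis
      by (rule has_derivative_transform_within_open[OF _ N(1) \<open>x \<in> N\<close>]) (use 0 in auto)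
  qed
  moreover have "continuous_on UNIV ?g"
    unfolding N(2)[symmetric]
  proof (rule continuous_on_open_Un[OF U N(1)])
    show "continuous_on U ?g"
      by (rule continuous_on_eq[OF continuous_on_subset[OF C_1D(2)[OF f]]]) auto
    show "continuous_on N ?g"
      by (rule continuous_on_eq[of _ "\<lambda>x. 0"]) (use 0 in auto)
  qed
  ultimately show "C_k 1 ?w" "grad ?w = ?g"
    by (rule C_1I)+
qed

section \<open>An annulus of closed orbits and its bump function\<close>

context hamiltonian_flow
begin

text \<open>After time \<open>\<tau>\<close> the point \<open>z\<close> arrives, up to the shift
  \<open>k\<close>, at a point \<open>z'\<close> near \<open>y\<close> on the same level of
  \<open>H\<close>. A short orbit segment joins \<open>z'\<close> and \<open>z\<close>. If it runs
  from \<open>z'\<close> to \<open>z\<close>, its duration is added to \<open>\<tau>\<close>; if it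
  runs from \<open>z\<close> to \<open>z'\<close>, it is subtracted, which injectivity of the flow
  justifies.\<close>

lemma periodic_nearby:
  assumes k: "\<And>i. k $ i \<in> \<int>" and \<tau>: "\<tau> > 0" "X \<tau> y = y + k" and y: "V y \<bullet> p > 0"
    and \<eta>: "0 < \<eta>" "\<eta> \<le> \<tau> / 2"
  obtains \<rho> where "\<rho> > 0"
    "\<And>z. norm (z - y) < \<rho> \<Longrightarrow> \<exists>\<tau>'. \<tau> / 2 \<le> \<tau>' \<and> \<tau>' \<le> \<tau> + \<eta> \<and> X \<tau>' z = z + k"
proof -
  define \<alpha> where "\<alpha> = V y \<bullet> p"
  have \<alpha>: "\<alpha> > 0" using y by (simp add: \<alpha>_def)
  obtain r where r: "r > 0"
    and arc: "\<And>z a b. \<alpha> \<le> V z \<bullet> p \<Longrightarrow> norm (a - z) \<le> r \<Longrightarrow> norm (b - z) \<le> r \<Longrightarrow> H a = H b \<Longrightarrow> p \<bullet> a \<le> p \<bullet> b \<Longrightarrow>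
      \<exists>s. 0 \<le> s \<and> s \<le> 2 / \<alpha> * (p \<bullet> (b - a)) \<and> X s a = b"
    using orbit_arc[OF \<alpha>] by metis
  define E where "E = exp (L * \<tau>)"
  have E: "E \<ge> 1" using L_pos \<tau> by (simp add: E_def)
  \<comment> \<open>\<open>E\<close> is the Lipschitz constant of \<open>X \<tau>\<close>. The first
    bound keeps both \<open>z\<close> and \<open>z'\<close> within reach \<open>r\<close> of the arc
    lemma; the second makes the connecting segment last at most \<open>\<eta>\<close>.\<close>
  define \<rho> where "\<rho> = min (r / E) (\<eta> * \<alpha> / (2 * (norm p + 1) * (E + 1)))"
  have \<rho>: "\<rho> > 0" using r E \<eta> \<alpha> by (simp add: \<rho>_def add_nonneg_pos)
  have "\<rho> \<le> r / E" by (simp add: \<rho>_def)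
  then have \<rho>r: "E * \<rho> \<le> r" using E by (simp add: field_simps)
  moreover have "\<rho> \<le> E * \<rho>" using E \<rho> by simp
  ultimately have \<rho>r': "\<rho> \<le> r" by linarith
  have \<rho>\<eta>: "2 / \<alpha> * (norm p * ((E + 1) * \<rho>)) \<le> \<eta>"
  proof -
    have "norm p * ((E + 1) * \<rho>) \<le> (norm p + 1) * ((E + 1) * \<rho>)"
      using E \<rho> by (intro mult_right_mono) auto
    also have "\<dots> \<le> (norm p + 1) * ((E + 1) * (\<eta> * \<alpha> / (2 * (norm p + 1) * (E + 1))))"
      using E by (intro mult_left_mono) (auto simp: \<rho>_def)
    also have "\<dots> = \<eta> * \<alpha> / 2"
    proof -
      have "c * (d * (t / (2 * c * d))) = t / 2" if "c \<noteq> 0" "d \<noteq> 0" for c d t :: real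
        using that by simp
      moreover have "norm p + 1 \<noteq> 0" "E + 1 \<noteq> 0"
        using E norm_ge_zero[of p] by linarith+
      ultimately show ?thesis .
    qed
    finally have "2 / \<alpha> * (norm p * ((E + 1) * \<rho>)) \<le> 2 / \<alpha> * (\<eta> * \<alpha> / 2)"
      using \<alpha> by (intro mult_left_mono) auto
    then show ?thesis using \<alpha> by simp
  qed
  show thesis
  proof (rule that[OF \<rho>])
    fix z assume z: "norm (z - y) < \<rho>"
    have mk: "(- k) $ i \<in> \<int>" for i using k by simp
    define z' where "z' = X \<tau> z + (- k)"
    have "z' - y = X \<tau> z - X \<tau> y" using \<tau>(2) by (simp add: z'_def)
    then have "norm (z' - y) \<le> E * norm (z - y)"
      using X_lipschitz[of \<tau> z y] \<tau>(1) by (simp add: E_def)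
    also have "\<dots> \<le> E * \<rho>" using z E by (intro mult_left_mono) auto
    finally have z'E: "norm (z' - y) \<le> E * \<rho>" .
    have near: "norm (z' - y) \<le> r" "norm (z - y) \<le> r"
      using z'E \<rho>r \<rho>r' z by linarith+
    have Hz: "H z' = H z"
      unfolding z'_def using H_shift[OF mk] H_conserved \<tau>(1) by simp
    have "norm (z' - z) \<le> norm (z' - y) + norm (z - y)"
      using norm_triangle_ineq4[of "z' - y" "z - y"] by simp
    then have "norm (z' - z) \<le> (E + 1) * \<rho>"
      using z'E z by (simp add: algebra_simps)
    then have "\<bar>p \<bullet> (z' - z)\<bar> \<le> norm p * ((E + 1) * \<rho>)"
      using Cauchy_Schwarz_ineq2[of p "z' - z"] by (meson mult_left_mono norm_ge_zero order_trans)
    then have "2 / \<alpha> * (p \<bullet> (z' - z)) \<le> 2 / \<alpha> * (norm p * ((E + 1) * \<rho>))"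
      "2 / \<alpha> * (p \<bullet> (z - z')) \<le> 2 / \<alpha> * (norm p * ((E + 1) * \<rho>))"
      using \<alpha> by (intro mult_left_mono; simp add: inner_diff_right)+
    then have p\<eta>: "2 / \<alpha> * (p \<bullet> (z' - z)) \<le> \<eta>" "2 / \<alpha> * (p \<bullet> (z - z')) \<le> \<eta>"
      using \<rho>\<eta> by linarith+
    have X\<tau>: "X \<tau> z = z' + k" by (simp add: z'_def)
    show "\<exists>\<tau>'. \<tau> / 2 \<le> \<tau>' \<and> \<tau>' \<le> \<tau> + \<eta> \<and> X \<tau>' z = z + k"
    proof (cases "p \<bullet> z' \<le> p \<bullet> z")
      case True
      obtain s where s: "0 \<le> s" "s \<le> 2 / \<alpha> * (p \<bullet> (z - z'))" "X s z' = z"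
        using arc[OF _ near Hz True] by (auto simp: \<alpha>_def)
      have "X (\<tau> + s) z = X s (z' + k)"
        using X_add[of \<tau> s z] \<tau>(1) s(1) X\<tau> by simp
      also have "\<dots> = z + k"
        using X_shift[OF k s(1)] s(3) by simp
      finally show ?thesis
        using s(1,2) p\<eta> \<tau>(1) by (intro exI[of _ "\<tau> + s"]) auto
    next
      case False
      obtain s where s: "0 \<le> s" "s \<le> 2 / \<alpha> * (p \<bullet> (z' - z))" "X s z = z'"
        using arc[OF _ near(2,1) Hz[symmetric]] False by (auto simp: \<alpha>_def)
      have s\<tau>: "s \<le> \<tau> / 2" using s(2) p\<eta>(1) \<eta>(2) by linarith
      have "X s (X (\<tau> - s) z) = z' + k"
        using X_add[of "\<tau> - s" s z] \<tau>(1) s(1) s\<tau> X\<tau> by simp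
      also have "\<dots> = X s (z + k)"
        using X_shift[OF k s(1)] s(3) by simp
      finally have "X (\<tau> - s) z = z + k"
        using X_inject[OF s(1)] by blast
      then show ?thesis
        using s(1) s\<tau> \<eta> by (intro exI[of _ "\<tau> - s"]) auto
    qed
  qed
qed

text \<open>\<open>H\<close> has nonzero derivative at \<open>y\<close> along the line orthogonal to
  \<open>p\<close>, so it takes values on both sides of \<open>H y\<close> arbitrarily close to
  \<open>y\<close>; the intermediate value theorem supplies every value between them.\<close>

lemma level_near:
  assumes y: "V y \<bullet> p > 0" and \<rho>: "\<rho> > 0"
  obtains \<epsilon> where "\<epsilon> > 0" "\<And>c. \<bar>c - H y\<bar> \<le> \<epsilon> \<Longrightarrow> \<exists>y'. norm (y' - y) < \<rho> \<and> H y' = c"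
proof -
  define n where "n = (\<chi> i::2. if i = 1 then - p $ 2 else p $ 1)"
  define f where "f = (\<lambda>t. H (y + t *\<^sub>R n))"
  have df: "(f has_real_derivative grad H (y + t *\<^sub>R n) \<bullet> n) (at t)" for t
    unfolding f_def by (rule has_real_derivative_line[OF C_1D(5)[OF H_C_1]])
  have cf: "continuous_on S f" for S
    using df DERIV_isCont by (blast intro: continuous_at_imp_continuous_on)
  have "grad H (y + 0 *\<^sub>R n) \<bullet> n < 0"
    using y grad_H_perp[of y p] by (simp add: n_def)
  from DERIV_neg_dec_right[OF df this] DERIV_neg_dec_left[OF df this]
  obtain d1 d2 where d: "d1 > 0" "\<forall>h>0. h < d1 \<longrightarrow> f (0 + h) < f 0" "d2 > 0" "\<forall>h>0. h < d2 \<longrightarrow> f 0 < f (0 - h)"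
    by blast
  define q where "q = \<rho> / (norm n + 1)"
  have n1: "norm n + 1 > 0" by (simp add: add_nonneg_pos)
  then have "q > 0" using \<rho> by (simp add: q_def)
  define l where "l = min (min d1 d2) q / 2"
  have l: "0 < l" "l < d1" "l < d2" "l < q"
    using d(1,3) \<open>q > 0\<close> by (auto simp: l_def)
  have fl: "f l < f 0" "f 0 < f (- l)"
    using d(2,4) l by auto
  have f0: "f 0 = H y" by (simp add: f_def)
  show thesis
  proof (rule that[of "min (f 0 - f l) (f (- l) - f 0)"])
    fix c assume c: "\<bar>c - H y\<bar> \<le> min (f 0 - f l) (f (- l) - f 0)"
    then have "f l \<le> c" "c \<le> f (- l)"
      unfolding f0 by linarith+
    then obtain t where t: "- l \<le> t" "t \<le> l" "f t = c"
      using IVT2'[of f l c "- l"] cf l(1) by auto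
    have "norm (t *\<^sub>R n) \<le> l * (norm n + 1)"
      using t(1,2) by (auto intro!: mult_mono)
    also have "\<dots> < \<rho>"
      using l(4) n1 by (simp add: q_def field_simps)
    finally show "\<exists>y'. norm (y' - y) < \<rho> \<and> H y' = c"
      using t(3) by (intro exI[of _ "y + t *\<^sub>R n"]) (simp add: f_def)
  qed (use fl in simp)
qed

text \<open>Only whole turns count fully: rounding \<open>T / \<sigma>\<close> down loses at most
  one \<open>p \<bullet> k\<close>, and the unfinished turn loses at most
  \<open>norm p * (M * \<sigma>)\<close>.\<close>

lemma periodic_drift_bound:
  assumes k: "\<And>i. k $ i \<in> \<int>" and \<sigma>: "\<sigma> > 0" "X \<sigma> x = x + k" and pk: "p \<bullet> k \<ge> 0" and T: "T \<ge> 0"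
  shows "p \<bullet> (X T x - x) \<ge> T / \<sigma> * (p \<bullet> k) - p \<bullet> k - norm p * (M * \<sigma>)"
proof -
  obtain m s where s: "0 \<le> s" "s < \<sigma>" "T = real m * \<sigma> + s" "X T x = X s x + real m *\<^sub>R k"
    using X_reduce[OF k \<sigma> T] by blast
  have "T / \<sigma> \<le> real m + 1"
    using s \<sigma>(1) by (simp add: field_simps)
  then have "T / \<sigma> * (p \<bullet> k) \<le> (real m + 1) * (p \<bullet> k)"
    using pk by (intro mult_right_mono) auto
  moreover have "\<bar>p \<bullet> (X s x - x)\<bar> \<le> norm p * (M * \<sigma>)"
  proof -
    have "norm (X s x - X 0 x) \<le> M * (s - 0)"
      using s by (intro X_speed) auto
    also have "\<dots> \<le> M * \<sigma>" using s M_pos by simp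
    finally show ?thesis
      using Cauchy_Schwarz_ineq2[of p "X s x - x"] by (simp add: mult_left_mono order_trans)
  qed
  ultimately show ?thesis
    unfolding s(4) by (simp add: inner_diff_right inner_add_right algebra_simps)
qed

text \<open>\<open>U\<close> consists of the points whose forward orbit meets a lattice translate of
  a small disc about \<open>y\<close>; all these orbits close with the same displacement
  \<open>k\<close>. A function \<open>f\<close> of \<open>H\<close> supported in a strip of levels
  is invariant, and its restriction to \<open>U\<close> stays smooth because \<open>U\<close> is
  open and its part \<open>W\<close> in the strip is closed.\<close>

lemma invariant_bump:
  assumes k: "\<And>i. k $ i \<in> \<int>" and \<tau>: "\<tau> > 0" "X \<tau> y = y + k" and y: "V y \<bullet> p > 0"
    and b: "b > 0" "p \<bullet> k \<ge> b * \<tau>" and e: "e > 0"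
  obtains w T where "w \<in> C_k_torus 1" "\<And>x. V x \<bullet> grad w x = 0" "w y \<noteq> 0" "T > 0"
    "\<And>x. w x \<noteq> 0 \<Longrightarrow> p \<bullet> (X T x - x) / T \<ge> b - e"
proof -
  \<comment> \<open>The bound \<open>e * \<tau> / (2 * b)\<close> ensures that a period of at most
    \<open>\<tau> + \<eta>\<close> still gives the mean drift \<open>b - e / 2\<close>.\<close>
  define \<eta> where "\<eta> = min (\<tau> / 2) (e * \<tau> / (2 * b))"
  have \<eta>: "0 < \<eta>" "\<eta> \<le> \<tau> / 2" "\<eta> \<le> e * \<tau> / (2 * b)"
    using \<tau> e b(1) by (auto simp: \<eta>_def)
  obtain \<rho>0 where \<rho>0: "\<rho>0 > 0"
    and nearby: "\<And>z. norm (z - y) < \<rho>0 \<Longrightarrow> \<exists>\<tau>'. \<tau> / 2 \<le> \<tau>' \<and> \<tau>' \<le> \<tau> + \<eta> \<and> X \<tau>' z = z + k"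
    using periodic_nearby[OF k \<tau> y \<eta>(1,2)] by metis
  obtain r where r: "r > 0"
    and arc: "\<And>z a c. V y \<bullet> p \<le> V z \<bullet> p \<Longrightarrow> norm (a - z) \<le> r \<Longrightarrow> norm (c - z) \<le> r \<Longrightarrow> H a = H c \<Longrightarrow> p \<bullet> a \<le> p \<bullet> c \<Longrightarrow>
      \<exists>s. 0 \<le> s \<and> s \<le> 2 / (V y \<bullet> p) * (p \<bullet> (c - a)) \<and> X s a = c"
    using orbit_arc[OF y] by metis
  define \<rho> where "\<rho> = min \<rho>0 (r / 2)"
  have \<rho>: "\<rho> > 0" "\<rho> \<le> \<rho>0" "2 * \<rho> \<le> r" using \<rho>0 r by (auto simp: \<rho>_def)
  obtain \<epsilon> where \<epsilon>: "\<epsilon> > 0" and level: "\<And>c. \<bar>c - H y\<bar> \<le> \<epsilon> \<Longrightarrow> \<exists>y'. norm (y' - y) < \<rho> \<and> H y' = c"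
    using level_near[OF y \<rho>(1)] by metis
  define Z where "Z = {j :: real^2. \<forall>i. j $ i \<in> \<int>}"
  define U where "U = {x. \<exists>t\<ge>0. \<exists>j\<in>Z. norm (X t x - (y + j)) < \<rho>}"
  have ZD: "j \<in> Z \<Longrightarrow> j $ i \<in> \<int>" for i j by (simp add: Z_def)
  have Zlin: "j + real m *\<^sub>R k \<in> Z" "j - real m *\<^sub>R k \<in> Z" if "j \<in> Z" for j and m :: nat
    using that k by (auto simp: Z_def)

  \<comment> \<open>Near \<open>y\<close> the orbit is known to close; applying \<open>X t\<close>
    to both sides and cancelling it by injectivity transfers the closing relation back to
    \<open>x\<close>.\<close>
  have periodic_U: "\<exists>\<sigma>. \<tau> / 2 \<le> \<sigma> \<and> \<sigma> \<le> \<tau> + \<eta> \<and> X \<sigma> x = x + k" if "x \<in> U" for x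
  proof -
    from that obtain t j where t: "t \<ge> 0" and j: "j \<in> Z" and close: "norm (X t x - (y + j)) < \<rho>"
      by (auto simp: U_def)
    define z where "z = X t x - j"
    have "norm (z - y) < \<rho>0" using close \<rho>(2) by (simp add: z_def algebra_simps)
    then obtain \<sigma> where \<sigma>: "\<tau> / 2 \<le> \<sigma>" "\<sigma> \<le> \<tau> + \<eta>" "X \<sigma> z = z + k"
      using nearby by blast
    have \<sigma>0: "\<sigma> \<ge> 0" using \<sigma>(1) \<tau>(1) by linarith
    have "X t (X \<sigma> x) = X \<sigma> (z + j)"
      using X_add[OF t \<sigma>0, of x] X_add[OF \<sigma>0 t, of x] by (simp add: z_def add.commute)
    also have "\<dots> = z + k + j"
      using X_shift[OF ZD[OF j] \<sigma>0] \<sigma>(3) by simp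
    also have "\<dots> = X t (x + k)"
      using X_shift[OF k t] by (simp add: z_def)
    finally have "X \<sigma> x = x + k"
      using X_inject[OF t] by blast
    then show ?thesis using \<sigma> by blast
  qed

  \<comment> \<open>Hitting times can be reduced modulo the period of \<open>x\<close>, at the price
    of another lattice translate. The uniform bound \<open>2 * \<tau>\<close> provides the
    compactness used for the closedness of \<open>W\<close>.\<close>
  have bounded_time: "\<exists>t. 0 \<le> t \<and> t \<le> 2 * \<tau> \<and> (\<exists>j\<in>Z. norm (X t x - (y + j)) < \<rho>)" if xU: "x \<in> U" for x
  proof -
    from xU obtain t j where t: "t \<ge> 0" and j: "j \<in> Z" and close: "norm (X t x - (y + j)) < \<rho>"
      by (auto simp: U_def)
    obtain \<sigma> where \<sigma>: "\<tau> / 2 \<le> \<sigma>" "\<sigma> \<le> \<tau> + \<eta>" "X \<sigma> x = x + k"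
      using periodic_U[OF xU] by blast
    have \<sigma>0: "\<sigma> > 0" using \<sigma>(1) \<tau>(1) by linarith
    obtain m s where s: "0 \<le> s" "s < \<sigma>" "X t x = X s x + real m *\<^sub>R k"
      using X_reduce[OF k \<sigma>0 \<sigma>(3) t] by blast
    have "norm (X s x - (y + (j - real m *\<^sub>R k))) < \<rho>"
      using close unfolding s(3) by (simp add: algebra_simps)
    moreover have "s \<le> 2 * \<tau>" using s(2) \<sigma>(2) \<eta>(2) \<tau>(1) by linarith
    ultimately show ?thesis using s(1) Zlin(2)[OF j] by blast
  qed

  have "open U"
  proof -
    have "U = (\<Union>t\<in>{0..}. \<Union>j\<in>Z. {x. norm (X t x - (y + j)) < \<rho>})"
      by (auto simp: U_def)
    moreover have "open {x. norm (X t x - (y + j)) < \<rho>}" if "t \<in> {0..}" for t j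
      using that by (intro open_Collect_less continuous_intros X_continuous) auto
    ultimately show ?thesis by auto
  qed

  have cH: "continuous_on UNIV H" by (rule C_1D(4)[OF H_C_1])
  define W where "W = {x \<in> U. \<bar>H x - H y\<bar> \<le> \<epsilon>}"
  \<comment> \<open>The limit point is only known to reach within \<open>2 * \<rho>\<close> of a
    translate of \<open>y\<close>, possibly outside the open disc. Since its level is close to
    \<open>H y\<close>, the disc contains a point \<open>y'\<close> of the same level, and the task
    is to show that the orbit of the limit point hits \<open>y'\<close> up to a lattice
    shift.\<close>
  have "closed W"
    unfolding closed_sequential_limits
  proof (intro allI impI, elim conjE)
    fix xs x assume xs: "\<forall>n. xs n \<in> W" and lim: "xs \<longlonglongrightarrow> x"
    have "(\<lambda>n. H (xs n)) \<longlonglongrightarrow> H x"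
      using lim cH by (auto intro: continuous_on_tendsto_compose)
    then have "(\<lambda>n. \<bar>H (xs n) - H y\<bar>) \<longlonglongrightarrow> \<bar>H x - H y\<bar>"
      by (intro tendsto_intros)
    then have Hx: "\<bar>H x - H y\<bar> \<le> \<epsilon>"
      by (rule tendsto_upperbound) (use xs in \<open>auto simp: W_def\<close>)
    have "\<forall>n. \<exists>t. t \<in> {0..2 * \<tau>} \<and> (\<exists>j\<in>Z. norm (X t (xs n) - (y + j)) < \<rho>)"
      using bounded_time xs by (simp add: W_def)
    from choice[OF this] obtain t
      where t: "\<forall>n. t n \<in> {0..2 * \<tau>} \<and> (\<exists>j\<in>Z. norm (X (t n) (xs n) - (y + j)) < \<rho>)" ..
    obtain s \<sigma> where s: "s \<in> {0..2 * \<tau>}" "strict_mono \<sigma>" "(t \<circ> \<sigma>) \<longlonglongrightarrow> s"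
      by (rule seq_compactE[OF compact_imp_seq_compact[OF compact_Icc], of t 0 "2 * \<tau>"]) (use t in auto)
    have s0: "s \<ge> 0" using s(1) by simp
    have "(\<lambda>n. X ((t \<circ> \<sigma>) n) ((xs \<circ> \<sigma>) n)) \<longlonglongrightarrow> X s x"
      by (rule X_tendsto[OF s(3) LIMSEQ_subseq_LIMSEQ[OF lim s(2)] _ s0]) (use t in auto)
    from LIMSEQ_D[OF this \<rho>(1)] obtain n where n: "norm (X (t (\<sigma> n)) (xs (\<sigma> n)) - X s x) < \<rho>"
      by auto
    obtain j where j: "j \<in> Z" "norm (X (t (\<sigma> n)) (xs (\<sigma> n)) - (y + j)) < \<rho>"
      using t by blast
    define z where "z = X s x - j"
    have Xz: "X s x = z + j" by (simp add: z_def)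
    have "z - y = (X (t (\<sigma> n)) (xs (\<sigma> n)) - (y + j)) - (X (t (\<sigma> n)) (xs (\<sigma> n)) - X s x)"
      by (simp add: z_def)
    then have "norm (z - y) \<le> norm (X (t (\<sigma> n)) (xs (\<sigma> n)) - (y + j)) + norm (X (t (\<sigma> n)) (xs (\<sigma> n)) - X s x)"
      by (metis norm_triangle_ineq4)
    then have zr: "norm (z - y) \<le> r" using n j(2) \<rho>(3) by linarith
    have "H z = H x"
      using H_shift[OF ZD[OF j(1)], of z] H_conserved[OF s0, of x] by (simp add: Xz)
    then obtain y' where y': "norm (y' - y) < \<rho>" "H y' = H z"
      using level Hx by metis
    have y'r: "norm (y' - y) \<le> r" using y'(1) \<rho> by linarith
    \<comment> \<open>Either the connecting arc runs from \<open>z\<close> to \<open>y'\<close>, or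
      \<open>z\<close> lies ahead of \<open>y'\<close> on its closed orbit; then following that
      orbit through enough full turns brings \<open>z\<close> to a translate of
      \<open>y'\<close>.\<close>
    have "\<exists>u\<ge>0. \<exists>m. X u z = y' + real m *\<^sub>R k"
    proof (cases "p \<bullet> z \<le> p \<bullet> y'")
      case True
      then obtain u where "0 \<le> u" "X u z = y'"
        using arc[OF order_refl zr y'r y'(2)[symmetric]] by blast
      then show ?thesis by (intro exI[of _ u] conjI exI[of _ 0]) auto
    next
      case False
      then obtain u where u: "0 \<le> u" "X u y' = z"
        using arc[OF order_refl y'r zr y'(2)] by auto
      obtain \<tau>' where \<tau>': "\<tau> / 2 \<le> \<tau>'" "X \<tau>' y' = y' + k"
        using nearby y'(1) \<rho>(2) by (meson less_le_trans)
      have \<tau>'0: "\<tau>' > 0" using \<tau>' \<tau>(1) by linarith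
      obtain m :: nat where m: "u < real m * \<tau>'"
        using ex_less_of_nat_mult[OF \<tau>'0] by blast
      have "X (real m * \<tau>' - u) z = X (real m * \<tau>') y'"
        using X_add[of u "real m * \<tau>' - u" y'] u m by simp
      also have "\<dots> = y' + real m *\<^sub>R k"
        using X_iterate[OF k _ \<tau>'(2)] \<tau>'0 by simp
      finally show ?thesis
        using m by (intro exI[of _ "real m * \<tau>' - u"] conjI exI[of _ m]) auto
    qed
    then obtain u m where u: "u \<ge> 0" "X u z = y' + real m *\<^sub>R k" by blast
    have "X (s + u) x = y' + real m *\<^sub>R k + j"
      using X_add[OF s0 u(1), of x] X_shift[OF ZD[OF j(1)] u(1), of z] u(2) by (simp add: Xz)
    then have "norm (X (s + u) x - (y + (j + real m *\<^sub>R k))) < \<rho>"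
      using y'(1) by (simp add: algebra_simps)
    moreover have "s + u \<ge> 0" using s0 u(1) by simp
    ultimately have "x \<in> U"
      unfolding U_def using Zlin(1)[OF j(1)] by blast
    then show "x \<in> W" using Hx by (simp add: W_def)
  qed

  \<comment> \<open>\<open>u\<close> is positive exactly where \<open>H\<close> differs from
    \<open>H y\<close> by less than \<open>\<epsilon>\<close>, so its squared positive part vanishes
    together with its gradient outside the strip, as the cut-off requires.\<close>
  define u where "u = (\<lambda>x. \<epsilon>\<^sup>2 - (H x - H y) * (H x - H y))"
  have C1H: "C_k 1 (\<lambda>x. H x - H y)" "grad (\<lambda>x. H x - H y) = grad H"
    using C_1_diff[OF H_C_1 grad_const(1)] grad_diff[OF H_C_1 grad_const(1)] by (auto simp: grad_const(2))
  have u1: "C_k 1 u"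
    unfolding u_def by (intro C_1_diff C_1_mult grad_const(1) C1H)
  have gu: "grad u x = (- 2 * (H x - H y)) *\<^sub>R grad H x" for x
    unfolding u_def grad_diff[OF grad_const(1) C_1_mult[OF C1H(1) C1H(1)]] grad_mult(2)[OF C1H(1) C1H(1)] C1H(2)
    by (simp add: grad_const(2) scaleR_left_distrib[symmetric] scaleR_minus_left[symmetric] del: scaleR_minus_left)
  define f where "f = (\<lambda>x. (max 0 (u x))\<^sup>2)"
  have f1: "C_k 1 f" and gf: "grad f x = (2 * max 0 (u x) * (- 2 * (H x - H y))) *\<^sub>R grad H x" for x
    unfolding f_def using C_1_max_0_power2[OF u1] by (simp_all add: gu)
  define w where "w = (\<lambda>x. if x \<in> U then f x else 0)"
  have outside: "f x = 0 \<and> grad f x = 0" if "x \<in> U \<inter> - W" for x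
  proof -
    have "\<epsilon> \<le> \<bar>H x - H y\<bar>" using that by (auto simp: W_def)
    then have "\<epsilon>\<^sup>2 \<le> (H x - H y)\<^sup>2"
      using \<epsilon> by (simp add: abs_le_square_iff[symmetric])
    then have "max 0 (u x) = 0" by (simp add: u_def power2_eq_square)
    then show ?thesis unfolding gf by (simp add: f_def)
  qed
  have "U \<union> - W = UNIV" by (auto simp: W_def)
  note w = C_1_cut_off[OF f1 \<open>open U\<close> _ this outside, folded w_def]
  have w1: "C_k 1 w" and gw: "grad w = (\<lambda>x. if x \<in> U then grad f x else 0)"
    using w \<open>closed W\<close> by auto
  have Ush: "x + m \<in> U" if "x \<in> U" "\<And>i. m $ i \<in> \<int>" for x m
  proof -
    from that(1) obtain t j where t: "t \<ge> 0" and j: "j \<in> Z" and close: "norm (X t x - (y + j)) < \<rho>"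
      by (auto simp: U_def)
    have "norm (X t (x + m) - (y + (j + m))) < \<rho>"
      using close X_shift[OF that(2) t, of x] by (simp add: algebra_simps)
    moreover have "j + m \<in> Z" using j that(2) by (simp add: Z_def)
    ultimately show ?thesis using t by (auto simp: U_def)
  qed
  have "torus_periodic w"
  proof (rule torus_periodicI)
    fix x m :: "real^2" assume m: "\<And>i. m $ i \<in> \<int>"
    have "x + m \<in> U \<longleftrightarrow> x \<in> U"
      using Ush[OF _ m, of x] Ush[of "x + m" "- m"] m by auto
    then show "w (x + m) = w x"
      by (simp add: w_def f_def u_def H_shift[OF m])
  qed
  have yU: "y \<in> U"
    unfolding U_def Z_def using \<rho>(1) by (auto intro!: exI[of _ 0] bexI[of _ 0])

  \<comment> \<open>\<open>C\<close> is the loss in \<open>periodic_drift_bound\<close> for any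
    period up to \<open>2 * \<tau>\<close>. The time \<open>T\<close> is long enough that this loss
    costs at most \<open>e / 2\<close> of mean drift.\<close>
  define C where "C = p \<bullet> k + norm p * (M * (2 * \<tau>))"
  have pk: "p \<bullet> k \<ge> 0" using b \<tau>(1) by (meson less_imp_le mult_pos_pos order_trans)
  have C: "C \<ge> 0" unfolding C_def using pk M_pos \<tau>(1) by simp
  define T where "T = 2 * C / e + 1"
  have T: "T > 0" using C e by (simp add: T_def add_nonneg_pos)
  have CT: "C \<le> T * (e / 2)" using e by (simp add: T_def field_simps)
  show thesis
  proof (rule that[of w T])
    show "w \<in> C_k_torus 1"
      using w1 \<open>torus_periodic w\<close> by (simp add: C_k_torus_def)
    have "V x \<bullet> grad H x = 0" for x
      by (simp add: inner_vec_def sum_2 partial_deriv_H)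
    then show "V x \<bullet> grad w x = 0" for x
      by (simp add: gw gf)
    show "w y \<noteq> 0"
      using yU \<epsilon> by (simp add: w_def f_def u_def)
    show "T > 0" by (rule T)
    fix x assume "w x \<noteq> 0"
    then have "x \<in> U" by (simp add: w_def split: if_splits)
    then obtain \<sigma> where \<sigma>: "\<tau> / 2 \<le> \<sigma>" "\<sigma> \<le> \<tau> + \<eta>" "X \<sigma> x = x + k"
      using periodic_U by blast
    have \<sigma>0: "\<sigma> > 0" using \<sigma>(1) \<tau>(1) by linarith
    \<comment> \<open>Replacing \<open>\<sigma>\<close> by the larger \<open>\<tau> + \<eta>\<close>
      is monotone only when \<open>b - e / 2\<close> is nonnegative; otherwise the left side is
      nonpositive anyway.\<close>
    have "(b - e / 2) * \<sigma> \<le> b * \<tau>"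
    proof (cases "b - e / 2 \<ge> 0")
      case True
      have "(b - e / 2) * \<sigma> \<le> (b - e / 2) * (\<tau> + \<eta>)"
        using \<sigma>(2) True by (intro mult_left_mono) auto
      also have "\<dots> \<le> b * \<tau> - e / 2 * \<tau> + b * \<eta>"
        using \<eta>(1) e by (simp add: algebra_simps)
      also have "b * \<eta> \<le> e / 2 * \<tau>"
        using \<eta>(3) b(1) by (simp add: field_simps)
      finally show ?thesis by simp
    next
      case False
      then have "(b - e / 2) * \<sigma> \<le> 0" using \<sigma>0 by (simp add: mult_le_0_iff)
      also have "0 \<le> b * \<tau>" using b(1) \<tau>(1) by simp
      finally show ?thesis .
    qed
    then have "b - e / 2 \<le> (p \<bullet> k) / \<sigma>"
      using b(2) \<sigma>0 by (simp add: field_simps)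
    then have "T * (b - e / 2) \<le> T * ((p \<bullet> k) / \<sigma>)"
      using T by (intro mult_left_mono) auto
    moreover have "norm p * (M * \<sigma>) \<le> norm p * (M * (2 * \<tau>))"
      using \<sigma>(2) \<eta>(2) M_pos \<tau>(1) by (intro mult_left_mono) auto
    moreover have "p \<bullet> (X T x - x) \<ge> T / \<sigma> * (p \<bullet> k) - p \<bullet> k - norm p * (M * \<sigma>)"
      using T by (intro periodic_drift_bound[OF k \<sigma>0 \<sigma>(3) pk]) auto
    ultimately have "p \<bullet> (X T x - x) \<ge> T * (b - e / 2) - C"
      unfolding C_def by simp
    also have "T * (b - e / 2) - C \<ge> T * (b - e)"
      using CT by (simp add: algebra_simps)
    finally have "T * (b - e) \<le> p \<bullet> (X T x - x)" .
    then show "p \<bullet> (X T x - x) / T \<ge> b - e"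
      using T by (simp add: field_simps)
  qed
qed

lemma cell_constant_eventually_ge_inviscid:
  assumes sol: "\<And>A. A > 0 \<Longrightarrow> \<exists>S. cell_solution V p A (\<kappa> A) S" and e: "e > 0"
  shows "\<forall>\<^sub>F A in at_top. \<kappa> A / A \<ge> inviscid_constant V p - e"
proof -
  \<comment> \<open>Four losses of \<open>e / 4\<close> add up to \<open>e\<close>: the gap between
    \<open>b\<close> and the infimum, the drift on the support of the bump, the corrector, and the
    gradient loss for large \<open>A\<close>. If \<open>b \<le> 0\<close>, the target lies below 0
    and nonnegativity of the cell constant suffices.\<close>
  define b where "b = inviscid_constant V p - e / 4"
  have b: "b < inviscid_constant V p" using e by (simp add: b_def)
  show ?thesis
  proof (cases "b > 0")
    case True
    obtain x where drift: "\<And>t. t \<ge> 0 \<Longrightarrow> p \<bullet> (X t x - x) \<ge> b * t"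
      using persistent_drift[OF b] by blast
    obtain y k \<tau> where orbit: "\<tau> > 0" "\<And>i. k $ i \<in> \<int>" "X \<tau> y = y + k" "p \<bullet> k \<ge> b * \<tau>" "V y \<bullet> p > 0"
      using periodic_orbit_exists[OF True drift] by metis
    have e4: "e / 4 > 0" using e by simp
    obtain w T where w: "w \<in> C_k_torus 1" "\<And>x. V x \<bullet> grad w x = 0" "w y \<noteq> 0" and T: "T > 0"
      and wT: "\<And>x. w x \<noteq> 0 \<Longrightarrow> p \<bullet> (X T x - x) / T \<ge> b - e / 4"
      using invariant_bump[OF orbit(2,1,3,5) True orbit(4) e4] by metis
    \<comment> \<open>The corrector is built for the very time \<open>T\<close> that comes with the
      bump, so the time-averaged drift on the support of \<open>w\<close> becomes a pointwise lower
      bound there.\<close>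
    obtain \<phi> where \<phi>: "\<phi> \<in> C_k_torus 1" "\<And>x. \<bar>V x \<bullet> (p + grad \<phi> x) - p \<bullet> (X T x - x) / T\<bar> \<le> e / 4"
      using averaged_corrector[OF T e4] by metis
    have w\<phi>: "V x \<bullet> (p + grad \<phi> x) \<ge> b - e / 2" if "w x \<noteq> 0" for x
      using wT[OF that] \<phi>(2)[of x] by linarith
    have "\<forall>\<^sub>F A in at_top. \<kappa> A / A \<ge> b - e / 2 - e / 4"
      by (rule cell_constant_eventually_ge[OF _ e4 w \<phi>(1) w\<phi>]) (rule sol)
    then show ?thesis by (simp add: b_def)
  next
    case False
    have "\<kappa> A / A \<ge> inviscid_constant V p - e" if A: "A > 0" for A
    proof -
      have "\<kappa> A / A \<ge> 0"
        using sol[OF A] cell_constant_nonneg A by (meson divide_nonneg_pos)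
      then show ?thesis using False e by (simp add: b_def)
    qed
    then show ?thesis
      by (rule eventually_mono[OF eventually_gt_at_top[of 0]])
  qed
qed

end

lemma torus_C_1_lipschitz:
  fixes V :: "real^2 \<Rightarrow> real^2"
  assumes "torus_periodic V" "\<And>i. C_k 1 (\<lambda>x. V x $ i)"
  obtains L where "L > 0" "\<And>x y. norm (V x - V y) \<le> L * norm (x - y)"
proof -
  have comp: "\<exists>L\<ge>0. \<forall>x y. \<bar>V x $ i - V y $ i\<bar> \<le> L * norm (x - y)" for i
  proof -
    have "torus_periodic (\<lambda>x. V x $ i)"
      using assms(1) by (simp add: torus_periodic_def)
    from torus_bound[OF partial_deriv_periodic(1)[OF this assms(2)] C_1D(2)[OF assms(2)]]
    obtain K where K: "K > 0" "\<And>x. norm (grad (\<lambda>x. V x $ i) x) \<le> K"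
      by blast
    have "norm (V x $ i - V y $ i) \<le> K * norm (x - y)" for x y
    proof (rule differentiable_bound[OF convex_UNIV])
      show "((\<lambda>x. V x $ i) has_derivative (\<lambda>h. grad (\<lambda>x. V x $ i) x \<bullet> h)) (at x within UNIV)" for x
        using C_1D(1)[OF assms(2)] by simp
      show "onorm (\<lambda>h. grad (\<lambda>x. V x $ i) x \<bullet> h) \<le> K" for x
      proof (rule onorm_le)
        show "norm (grad (\<lambda>x. V x $ i) x \<bullet> h) \<le> K * norm h" for h
          using Cauchy_Schwarz_ineq2[of "grad (\<lambda>x. V x $ i) x" h] mult_right_mono[OF K(2)[of x], of "norm h"]
          by simp
      qed
    qed auto
    then show ?thesis using K(1) by (intro exI[of _ K]) auto
  qed
  then obtain K1 K2 where K: "K1 \<ge> 0" "\<And>x y. \<bar>V x $ 1 - V y $ 1\<bar> \<le> K1 * norm (x - y)"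
    "K2 \<ge> 0" "\<And>x y. \<bar>V x $ 2 - V y $ 2\<bar> \<le> K2 * norm (x - y)"
    by meson
  show thesis
  proof (rule that[of "K1 + K2 + 1"])
    fix x y
    have "norm (V x - V y) \<le> \<bar>V x $ 1 - V y $ 1\<bar> + \<bar>V x $ 2 - V y $ 2\<bar>"
      using norm_le_l1_cart[of "V x - V y"] by (simp add: sum_2)
    also have "\<dots> \<le> (K1 + K2) * norm (x - y)"
      using K(2,4)[of x y] by (simp add: distrib_right)
    also have "\<dots> \<le> (K1 + K2 + 1) * norm (x - y)"
      by (intro mult_right_mono) auto
    finally show "norm (V x - V y) \<le> (K1 + K2 + 1) * norm (x - y)" .
  qed (use K in auto)
qed

theorem theorem4p1:
  fixes V :: "real^2 \<Rightarrow> real^2" and p :: "real^2" and \<kappa> :: "real \<Rightarrow> real"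
  assumes "C_infinity V"
    and "torus_periodic V"
    and "\<And>x. divergence V x = 0"
    and "integral (cbox 0 1) V = 0"
    and "\<And>A. A > 0 \<Longrightarrow> is_cell_constant V p A (\<kappa> A)"
  shows "((\<lambda>A. \<kappa> A / A) \<longlongrightarrow> inviscid_constant V p) at_top"
proof -
  have C1: "C_k 1 (\<lambda>x. V x $ i)" for i
    using assms(1) unfolding C_infinity_def by blast
  interpret solenoidal_field V
    by unfold_locales (use C1 assms(2-4) in auto)
  obtain L where L: "L > 0" "\<And>x y. norm (V x - V y) \<le> L * norm (x - y)"
    using torus_C_1_lipschitz[OF assms(2) C1] by blast
  obtain M where M: "M > 0" "\<And>x. norm (V x) \<le> M"
    using torus_bound[OF periodic continuous] by blast
  interpret planar_flow V L M
    by unfold_locales (use L M assms(2) in auto)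
  obtain H where "C_k 1 H" "torus_periodic H" "\<And>x. grad H x $ 1 = V x $ 2" "\<And>x. grad H x $ 2 = - V x $ 1"
    using stream_function_exists by metis
  then interpret hamiltonian_flow V L M H
    by unfold_locales
  have sol: "\<exists>S. cell_solution V p A (\<kappa> A) S" if "A > 0" for A
    using assms(5)[OF that] unfolding is_cell_constant_def by blast
  show ?thesis
  proof (rule tendstoI)
    fix e :: real assume "e > 0"
    then have e2: "e / 2 > 0" by simp
    have "\<forall>\<^sub>F A in at_top. \<kappa> A / A \<le> inviscid_constant V p + e / 2"
      by (intro cell_constant_eventually_le sol e2)
    moreover have "\<forall>\<^sub>F A in at_top. \<kappa> A / A \<ge> inviscid_constant V p - e / 2"
      by (intro cell_constant_eventually_ge_inviscid sol e2)
    ultimately show "\<forall>\<^sub>F A in at_top. dist (\<kappa> A / A) (inviscid_constant V p) < e"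
    proof eventually_elim
      case (elim A)
      then show ?case using \<open>e > 0\<close> unfolding dist_real_def by linarith
    qed
  qed
qed

end
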